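(* Let $C=[0,\infty)^2$ and let $T:C\to C$, $T(x)=(x_1f_1(x),\,x_2f_2(x))$, where $f=(f_1,f_2)\in C^1(C,C)$ with $f_1(x)>0$ and $f_2(x)>0$ for all $x\in C$. Consider the discrete system $x(n)=T^n(x)$, $x\in C$, $n\in\mathbb N$, and assume it is dissipative. Assume that $f_1(\mathbf 0)>1$ and $f_2(\mathbf 0)>1$, and that there exists $r\gg\mathbf 0$ such that $\omega(x)\subset[\mathbf 0,r]$ for all $x\in C$, $T([\mathbf 0,r])\subset[\mathbf 0,r)$, and $\rho(M(x))<1$ for all $x\in[\mathbf 0,r]$. Assume also that the system is type-K competitive on $[\mathbf 0,r]$, i.e. for all $x\in[\mathbf 0,r]$: $\frac{\partial f_1}{\partial x_1}(x)<0$, $\frac{\partial f_2}{\partial x_2}(x)<0$, $\frac{\partial f_1}{\partial x_2}(x)\ge 0$, $\frac{\partial f_2}{\partial x_1}(x)\ge 0$. Then: (a) For each $i\in\{1,2\}$ the system has one (exactly one) fixed point $Q_i$ on the positive half $x_i$-axis; it is a saddle point with unstable manifold $W^u(Q_i)\subset\dot C$ and with the positive half $x_i$-axis as its stable manifold $W^s(Q_i)$. (b) The map $T$ has at least one fixed point $p_0$ in $\dot C$. If $p_0$ is the unique fixed point in $\dot C$, then it is globally asymptotically stable in $\dot C$. Otherwise, $T$ has at least another fixed point $p_1\gg p_0$ such that, for every $x\in\dot C$, $T^n(x)$ is eventually monotone in $\ll_K$ or $<$ and converges to a fixed point in $[p_0,p_1]$. (Here $p_0$, and $p_1$ when it occurs,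 are chosen so that (b) and (c) hold with the same points.) (c) For the global attractor $\Sigma=\mathcal A\setminus\mathcal R(\mathbf 0)$ on $C\setminus\{\mathbf 0\}$ with the decomposition $\Sigma=\Sigma_H\cup\Sigma_0\cup\Sigma_V$, we have $$\Sigma_H=W^u(Q_1)\cup\{Q_1\},\qquad \Sigma_V=W^u(Q_2)\cup\{Q_2\},$$ both are monotone curves in $<$, and either $\Sigma_0=\{p_0\}$ or $\Sigma_0$ is a monotone curve in $\ll$ from $p_0$ to $p_1$. If $\frac{\partial f_1}{\partial x_2}(x)>0$ and $\frac{\partial f_2}{\partial x_1}(x)>0$ for all $x\in[\mathbf 0,r]$, then $\Sigma_H$ and $\Sigma_V$ are monotone in $\ll$.
   Context: Notation: $\dot C=(0,\infty)^2$. $x\le y$ means $y-x\in C$; $x<y$ means $x\le y$ and $x\ne y$; $x\ll y$ means $y-x\in\dot C$. $K=\{p\in\mathbb R^2:p_1\ge 0,\ p_2\le 0\}$ with interior $\dot K$; $x\le_K y$ means $y-x\in K$; $x<_K y$ means $x\le_K y$ and $x\neq y$; $x\ll_K y$ means $y-x\in\dot K$. $[x,y]=\{z\in C:x\le z\le y\}$ and $[\mathbf 0,r)=\{z\in C:\mathbf 0\le z\ll r\}$. The system is dissipative if there is a bounded set $B\subset C$ such that for each $x\in C$, $T^n(x)\in B$ for all large enough $n$. $\omega(x)=\bigcap_{n\ge0}\overline{\{T^m(x):m\ge n\}}$. $M(x)$ is the $2\times2$ matrix with entries $m_{ij}(x)=-\frac{x_i}{f_i(x)}\frac{\partial f_i}{\partial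 x_j}(x)$, and $\rho$ denotes spectral radius. Under the hypotheses $T$ is injective on $[\mathbf 0,r]$ and $T^{-1}:T([\mathbf 0,r])\to[\mathbf 0,r]$ denotes the inverse of $T|_{[\mathbf 0,r]}$; $T^{-n}$ denotes its iterates where they are defined. $\mathcal A=\bigcap_{n=0}^\infty T^n([\mathbf 0,r])$. $\mathcal R(\mathbf 0)=\{x\in C:\ T^{-n}(x)\text{ is defined for all }n\text{ and }\lim_{n\to\infty}T^{-n}(x)=\mathbf 0\}$. For $x\in\mathcal A$, $\alpha(x)=\bigcap_{n\ge0}\overline{\{T^{-m}(x):m\ge n\}}$. With $C_H=\{x\in C:x_2=0\}$ and $C_V=\{x\in C:x_1=0\}$, $$\Sigma_H=\{x\in\Sigma:\alpha(x)\subset\Sigma\cap C_H\},\quad \Sigma_V=\{x\in\Sigma:\alpha(x)\subset\Sigma\cap C_V\},\quad \Sigma_0=\Sigma\setminus(\Sigma_H\cup\Sigma_V).$$ A nonempty compact set $\Gamma\subset Y$ with $T(\Gamma)=\Gamma$ is the global attractor on a forward invariant set $Y$ if it attracts the points of each compact subset of $Y$ uniformly. A fixed point is a saddle point if the Jacobian matrix of $T$ there has one eigenvalue of modulus less than $1$ and one of modulus greater than $1$. $W^s(Q_i)=\{x\in C:\lim_{n\to\infty} T^n(x)=Q_i\}$. $W^u(Q_i)$ is understood to exclude the point $Q_i$ itself: $W^u(Q_i)=\{x\in\mathcal A\setminus\{Q_i\}:\lim_{n\to\infty} T^{-n}(x)=Q_i\}$. A curve is monotone in $<$ (respectively $\ll$)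 if every pair of distinct points on it are related by $<$ (respectively $\ll$). A sequence $\{T^n(x)\}$ is eventually monotone in a relation $\prec$ if there is $n_0$ such that either $T^n(x)\prec T^{n+1}(x)$ for all $n\ge n_0$ or $T^{n+1}(x)\prec T^{n}(x)$ for all $n\ge n_0$ (eventually constant sequences, i.e. orbits that reach a fixed point, are also allowed). $p_0$ globally asymptotically stable in $\dot C$ means that $p_0$ is Lyapunov stable and $T^n(x)\to p_0$ for every $x\in\dot C$. *)

theory Defs
  imports "HOL-Analysis.Analysis" "Jordan_Normal_Form.Spectral_Radius"
begin

no_notation Matrix.vec_index (infixl "$" 100)
hide_const (open) Matrix.vec Matrix.mat Determinant.det

section \<open>Orders on the plane\<close>

definition quadrant :: "(real^2) set"
  where "quadrant = {x. \<forall>i. 0 \<le> x $ i}"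

definition open_quadrant :: "(real^2) set"
  where "open_quadrant = {x. \<forall>i. 0 < x $ i}"

definition K_cone :: "(real^2) set"
  where "K_cone = {p. 0 \<le> p $ 1 \<and> p $ 2 \<le> 0}"

definition sless :: "real^2 \<Rightarrow> real^2 \<Rightarrow> bool"  (infix "\<lless>" 50)
  where "x \<lless> y \<longleftrightarrow> y - x \<in> open_quadrant"

definition sless_K :: "real^2 \<Rightarrow> real^2 \<Rightarrow> bool"  (infix "\<lless>\<^sub>K" 50)
  where "x \<lless>\<^sub>K y \<longleftrightarrow> y - x \<in> interior K_cone"

text \<open>The weak and strict cone orders of the quadrant are the library orders on
  \<^typ>\<open>real^2\<close>; hence \<open>{x..y}\<close> is the order interval.\<close>

lemma le_iff_quadrant: "(x::real^2) \<le> y \<longleftrightarrow> y - x \<in> quadrant"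
  by (simp add: Finite_Cartesian_Product.less_eq_vec_def quadrant_def)

lemma less_iff_le_neq: "(x::real^2) < y \<longleftrightarrow> x \<le> y \<and> x \<noteq> y"
  by (rule order.strict_iff_order)

lemma interval_subset_quadrant: "0 \<le> x \<Longrightarrow> {x..y} = {z \<in> quadrant. x \<le> z \<and> z \<le> (y::real^2)}"
  by (auto simp: quadrant_def Finite_Cartesian_Product.less_eq_vec_def) (metis order_trans)

definition halfopen_box :: "real^2 \<Rightarrow> (real^2) set"
  where "halfopen_box r = {z \<in> quadrant. 0 \<le> z \<and> z \<lless> r}"

definition pos_axis :: "2 \<Rightarrow> (real^2) set"
  where "pos_axis i = {x. 0 < x $ i \<and> (\<forall>j. j \<noteq> i \<longrightarrow> x $ j = 0)}"

section \<open>Derivatives and eigenvalues\<close>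

text \<open>Derivatives are taken within the closed quadrant, so they are one-sided on its
  boundary. They are unique, because the quadrant has full-dimensional tangent cones.\<close>

definition C1_on_quadrant :: "(real^2 \<Rightarrow> real^2) \<Rightarrow> bool"
  where "C1_on_quadrant f \<longleftrightarrow>
    (\<forall>x\<in>quadrant. f differentiable (at x within quadrant)) \<and>
    continuous_on quadrant (\<lambda>x. jacobian f (at x within quadrant))"

definition partial_deriv :: "(real^2 \<Rightarrow> real^2) \<Rightarrow> 2 \<Rightarrow> 2 \<Rightarrow> real^2 \<Rightarrow> real"
  where "partial_deriv f i j x = jacobian f (at x within quadrant) $ i $ j"

definition M_matrix :: "(real^2 \<Rightarrow> real^2) \<Rightarrow> real^2 \<Rightarrow> real^2^2"
  where "M_matrix f x = (\<chi> i j. - (x $ i / f x $ i) * partial_deriv f i j x)"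

text \<open>Spectral notions come from \<^theory>\<open>Jordan_Normal_Form.Spectral_Radius\<close>, whose matrices are
  indexed by \<open>{0, 1}\<close> instead of the type \<^typ>\<open>2\<close>.\<close>

definition complex_matrix :: "real^2^2 \<Rightarrow> complex Matrix.mat"
  where "complex_matrix A = Matrix.mat 2 2
    (\<lambda>(i, j). complex_of_real (A $ (if i = 0 then 1 else 2) $ (if j = 0 then 1 else 2)))"

section \<open>Discrete dynamics on the quadrant\<close>

definition dissipative :: "(real^2 \<Rightarrow> real^2) \<Rightarrow> bool"
  where "dissipative T \<longleftrightarrow> (\<exists>B. bounded B \<and> B \<subseteq> quadrant \<and>
    (\<forall>x\<in>quadrant. \<forall>\<^sub>F n in sequentially. (T ^^ n) x \<in> B))"

definition omega_limit :: "(real^2 \<Rightarrow> real^2) \<Rightarrow> real^2 \<Rightarrow> (real^2) set"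
  where "omega_limit T x = (\<Inter>n. closure {(T ^^ m) x |m. n \<le> m})"

definition saddle_point :: "(real^2 \<Rightarrow> real^2) \<Rightarrow> real^2 \<Rightarrow> bool"
  where "saddle_point T q \<longleftrightarrow> T q = q \<and>
    (\<exists>a b. eigenvalue (complex_matrix (jacobian T (at q within quadrant))) a \<and>
      eigenvalue (complex_matrix (jacobian T (at q within quadrant))) b \<and>
      cmod a < 1 \<and> 1 < cmod b)"

definition globally_asymptotically_stable_in :: "(real^2 \<Rightarrow> real^2) \<Rightarrow> (real^2) set \<Rightarrow> real^2 \<Rightarrow> bool"
  where "globally_asymptotically_stable_in T Y p \<longleftrightarrow>
    (\<forall>e>0. \<exists>d>0. \<forall>x\<in>Y. dist x p < d \<longrightarrow> (\<forall>n. dist ((T ^^ n) x) p < e)) \<and>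
    (\<forall>x\<in>Y. (\<lambda>n. (T ^^ n) x) \<longlonglongrightarrow> p)"

definition global_attractor :: "(real^2 \<Rightarrow> real^2) \<Rightarrow> (real^2) set \<Rightarrow> (real^2) set \<Rightarrow> bool"
  where "global_attractor T Y \<Gamma> \<longleftrightarrow>
    T ` Y \<subseteq> Y \<and> \<Gamma> \<noteq> {} \<and> compact \<Gamma> \<and> \<Gamma> \<subseteq> Y \<and> T ` \<Gamma> = \<Gamma> \<and>
    (\<forall>S. compact S \<longrightarrow> S \<subseteq> Y \<longrightarrow>
      (\<forall>e>0. \<forall>\<^sub>F n in sequentially. \<forall>x\<in>S. infdist ((T ^^ n) x) \<Gamma> < e))"

definition eventually_monotone :: "('a \<Rightarrow> 'a \<Rightarrow> bool) \<Rightarrow> (nat \<Rightarrow> 'a) \<Rightarrow> bool"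
  where "eventually_monotone R s \<longleftrightarrow> (\<exists>n0.
    (\<forall>n\<ge>n0. R (s n) (s (Suc n))) \<or> (\<forall>n\<ge>n0. R (s (Suc n)) (s n)) \<or>
    (\<forall>n\<ge>n0. s (Suc n) = s n))"

section \<open>Backward orbits and the attractor\<close>

text \<open>In what follows \<open>r\<close> is the upper corner of the box \<open>{0..r}\<close> on which \<open>T\<close> is inverted.
  The map \<open>inverse_on_box T r\<close> is meaningful on \<open>T ` {0..r}\<close> only; when \<open>T\<close> is
  injective on the box, all its iterates stay in that domain on \<open>attractor T r\<close>.\<close>

definition inverse_on_box :: "(real^2 \<Rightarrow> real^2) \<Rightarrow> real^2 \<Rightarrow> real^2 \<Rightarrow> real^2"
  where "inverse_on_box T r = inv_into {0..r} T"

definition attractor :: "(real^2 \<Rightarrow> real^2) \<Rightarrow> real^2 \<Rightarrow> (real^2) set"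
  where "attractor T r = (\<Inter>n. (T ^^ n) ` {0..r})"

definition repulsion_zero :: "(real^2 \<Rightarrow> real^2) \<Rightarrow> real^2 \<Rightarrow> (real^2) set"
  where "repulsion_zero T r = {x \<in> quadrant.
    (\<forall>n. (inverse_on_box T r ^^ n) x \<in> T ` {0..r}) \<and>
    (\<lambda>n. (inverse_on_box T r ^^ n) x) \<longlonglongrightarrow> 0}"

definition alpha_limit :: "(real^2 \<Rightarrow> real^2) \<Rightarrow> real^2 \<Rightarrow> real^2 \<Rightarrow> (real^2) set"
  where "alpha_limit T r x = (\<Inter>n. closure {(inverse_on_box T r ^^ m) x |m. n \<le> m})"

definition stable_manifold :: "(real^2 \<Rightarrow> real^2) \<Rightarrow> real^2 \<Rightarrow> (real^2) set"
  where "stable_manifold T q = {x \<in> quadrant. (\<lambda>n. (T ^^ n) x) \<longlonglongrightarrow> q}"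

definition unstable_manifold :: "(real^2 \<Rightarrow> real^2) \<Rightarrow> real^2 \<Rightarrow> real^2 \<Rightarrow> (real^2) set"
  where "unstable_manifold T r q =
    {x \<in> attractor T r - {q}. (\<lambda>n. (inverse_on_box T r ^^ n) x) \<longlonglongrightarrow> q}"

definition Sigma_set :: "(real^2 \<Rightarrow> real^2) \<Rightarrow> real^2 \<Rightarrow> (real^2) set"
  where "Sigma_set T r = attractor T r - repulsion_zero T r"

definition Sigma_H :: "(real^2 \<Rightarrow> real^2) \<Rightarrow> real^2 \<Rightarrow> (real^2) set"
  where "Sigma_H T r =
    {x \<in> Sigma_set T r. alpha_limit T r x \<subseteq> Sigma_set T r \<inter> {y \<in> quadrant. y $ 2 = 0}}"

definition Sigma_V :: "(real^2 \<Rightarrow> real^2) \<Rightarrow> real^2 \<Rightarrow> (real^2) set"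
  where "Sigma_V T r =
    {x \<in> Sigma_set T r. alpha_limit T r x \<subseteq> Sigma_set T r \<inter> {y \<in> quadrant. y $ 1 = 0}}"

definition Sigma_0 :: "(real^2 \<Rightarrow> real^2) \<Rightarrow> real^2 \<Rightarrow> (real^2) set"
  where "Sigma_0 T r = Sigma_set T r - (Sigma_H T r \<union> Sigma_V T r)"

section \<open>Monotone curves\<close>

definition related_on :: "('a \<Rightarrow> 'a \<Rightarrow> bool) \<Rightarrow> 'a set \<Rightarrow> bool"
  where "related_on R S \<longleftrightarrow> (\<forall>x\<in>S. \<forall>y\<in>S. x \<noteq> y \<longrightarrow> R x y \<or> R y x)"

text \<open>A curve need not contain its end points: it is a homeomorphic copy of a
  nondegenerate interval of any kind.\<close>

definition monotone_curve :: "(real^2 \<Rightarrow> real^2 \<Rightarrow> bool) \<Rightarrow> (real^2) set \<Rightarrow> bool"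
  where "monotone_curve R S \<longleftrightarrow>
    (\<exists>I::real set. is_interval I \<and> (\<exists>a\<in>I. \<exists>b\<in>I. a \<noteq> b) \<and> S homeomorphic I) \<and> related_on R S"

definition monotone_curve_from_to ::
    "(real^2 \<Rightarrow> real^2 \<Rightarrow> bool) \<Rightarrow> (real^2) set \<Rightarrow> real^2 \<Rightarrow> real^2 \<Rightarrow> bool"
  where "monotone_curve_from_to R S p q \<longleftrightarrow>
    (\<exists>g. arc g \<and> path_image g = S \<and> pathstart g = p \<and> pathfinish g = q) \<and> related_on R S"

end

theory Submission
  imports Defs
begin

text \<open>Since \<open>\<rho>(M) < 1\<close>, the Jacobian of \<open>T\<close> on the box has nonnegative entries, a positive diagonal and
  a positive determinant. Hence \<open>T\<close> preserves \<open>\<le>\<close>, and by the argument of Gale and Nikaido \<open>T x \<le>\<^sub>K T y\<close>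
  implies \<open>x \<le>\<^sub>K y\<close>. Two consecutive points of an orbit are comparable for one of the two orders, so
  every forward orbit is eventually monotone in \<open>\<le>\<close> or \<open>\<le>\<^sub>K\<close>, and likewise every backward orbit in the
  attractor; both converge to fixed points.

  If two backward orbits are \<open>K\<close>-related and have the same limit, their \<open>i\<close>-th coordinates agree, because
  the diagonal entry of the Jacobian at the limit is less than 1. So \<open>\<Sigma>\<^sub>H\<close> and \<open>\<Sigma>\<^sub>V\<close> are chains for
  \<open>\<le>\<close> and \<open>\<Sigma>\<^sub>0\<close> is one for \<open>\<lless>\<close>. The coordinate sum maps a chain homeomorphically onto its image, and
  the image is an interval because the nested sets \<open>T\<^sup>n [a, b]\<close> between two fixed points \<open>a \<le> b\<close> are
  compact and connected. No unstable manifold theorem is needed.\<close>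

section \<open>Plane geometry\<close>

text \<open>The spectral hypothesis enters through \<open>J x\<close> = diag(\<open>f x\<close>) (I
  - \<open>M_matrix f x\<close>): the type-K signs make the off-diagonal product of M nonnegative,
  so its eigenvalues are real and can be compared with 1.

  The interior fixed points form a chain for \<open>\<lless>\<close> because f_i decreases in x_i
  and does not decrease in x_j, so its level set f_i = 1 rises. The least one, \<open>p0\<close>, is
  reached by monotone iteration from a point below all of them; such a point exists since
  \<open>near_zero\<close> gives one lower bound for the positive coordinates of all fixed points.
  The same bound cuts a square around 0 out of the box and leaves a compact invariant set in place
  of the punctured quadrant.

  The main obstacle is the far end of the curve issuing from Q_i: it must stay in the interval
  between Q_i and \<open>p0\<close>. A connected invariant set in this interval contains a point of
  the curve at every level of the coordinate sum from that of Q_i up to, but excluding, that of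
  \<open>p0\<close>, and a chain has only one point per level. So backward points near Q_i lie in
  the interval, and forward invariance carries the whole curve into it.\<close>

lemmas le_vec_iff = Finite_Cartesian_Product.less_eq_vec_def

lemma quadrant_iff: "x \<in> quadrant \<longleftrightarrow> 0 \<le> (x::real^2)"
  by (simp add: quadrant_def le_vec_iff)

lemma open_quadrant_iff: "x \<in> open_quadrant \<longleftrightarrow> (\<forall>i. 0 < x $ i)"
  by (simp add: open_quadrant_def)

lemma sless_iff: "x \<lless> y \<longleftrightarrow> (\<forall>i. x $ i < y $ i)"
  by (simp add: sless_def open_quadrant_def)

lemma sless_imp_le: "x \<lless> y \<Longrightarrow> x \<le> y"
  by (simp add: sless_iff le_vec_iff less_imp_le)

lemma halfopen_box_iff: "z \<in> halfopen_box r \<longleftrightarrow> 0 \<le> z \<and> z \<lless> r"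
  by (auto simp: halfopen_box_def quadrant_iff)

lemma interior_K_cone: "interior K_cone = {p. 0 < p $ 1 \<and> p $ 2 < 0}"
proof -
  have K: "K_cone = {p. p $ 1 \<ge> 0} \<inter> {p. p $ 2 \<le> 0}"
    by (auto simp: K_cone_def)
  show ?thesis
    unfolding K interior_Int interior_halfspace_component_ge interior_halfspace_component_le
    by auto
qed

lemma sless_K_iff: "x \<lless>\<^sub>K y \<longleftrightarrow> x $ 1 < y $ 1 \<and> y $ 2 < x $ 2"
  by (simp add: sless_K_def interior_K_cone)

lemma neq_2_cases:
  fixes i j k :: 2
  assumes "i \<noteq> j"
  shows "k = i \<or> k = j"
  using assms exhaust_2 by metis

lemma all_2_iff: "i \<noteq> (j::2) \<Longrightarrow> (\<forall>k. P k) \<longleftrightarrow> P i \<and> P j"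
proof -
  assume ij: "i \<noteq> j"
  have "P k" if "P i" "P j" for k
    using neq_2_cases[OF ij, of k] that by blast
  then show ?thesis by blast
qed

lemma ex_neq_2: "\<exists>j. i \<noteq> (j::2)"
  by (rule exI[of _ "if i = 1 then 2 else 1"]) auto

definition upd :: "real^2 \<Rightarrow> 2 \<Rightarrow> real \<Rightarrow> real^2"
  where "upd x k t = (\<chi> i. if i = k then t else x $ i)"

lemma upd_nth [simp]: "upd x k t $ i = (if i = k then t else x $ i)"
  by (simp add: upd_def)

lemma upd_same [simp]: "upd x k (x $ k) = x"
  by (simp add: Finite_Cartesian_Product.vec_eq_iff)

lemma upd_eq_add_axis: "upd x k t = upd x k 0 + t *\<^sub>R axis k 1"
  by (simp add: Finite_Cartesian_Product.vec_eq_iff axis_def)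

lemma upd_in_interval:
  assumes "x \<in> {a..b}" "a $ k \<le> t" "t \<le> b $ k"
  shows "upd x k t \<in> {a..b::real^2}"
  using assms by (auto simp: le_vec_iff)

text \<open>A derivative within the quadrant restricts to any segment inside it, so boundary points
  need no separate treatment. Moving one coordinate at a time brings in a single entry of the
  Jacobian, whose sign is known.\<close>

lemma coordinate_mvt:
  fixes F :: "real^2 \<Rightarrow> real^2"
  assumes diff: "\<And>x. x \<in> quadrant \<Longrightarrow> F differentiable (at x within quadrant)"
    and x: "x \<in> quadrant" and ab: "0 \<le> a" "a < b"
  obtains c where "a < c" "c < b"
    "F (upd x k b) $ m - F (upd x k a) $ m
      = (b - a) * jacobian F (at (upd x k c) within quadrant) $ m $ k"
proof -
  have D: "((\<lambda>t. F (upd x k t) $ m) has_derivative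
      (\<lambda>h. h * jacobian F (at (upd x k t) within quadrant) $ m $ k)) (at t within {a..b})"
    if t: "t \<in> {a..b}" for t
  proof -
    let ?J = "jacobian F (at (upd x k t) within quadrant)"
    have q: "upd x k u \<in> quadrant" if "u \<in> {a..b}" for u
      using that x ab by (auto simp: quadrant_def)
    have "(F has_derivative (\<lambda>h. ?J *v h)) (at (upd x k t) within quadrant)"
      using diff[OF q[OF t]] by (simp add: jacobian_works)
    then have 1: "(F has_derivative (\<lambda>h. ?J *v h)) (at (upd x k t) within upd x k ` {a..b})"
      by (rule has_derivative_subset) (use q in auto)
    have "((\<lambda>t. upd x k 0 + t *\<^sub>R axis k 1) has_derivative (\<lambda>h. h *\<^sub>R axis k 1)) (at t within {a..b})"
      by (auto intro!: derivative_eq_intros)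
    then have 2: "(upd x k has_derivative (\<lambda>h. h *\<^sub>R axis k 1)) (at t within {a..b})"
      by (simp flip: upd_eq_add_axis)
    have "((\<lambda>t. F (upd x k t)) has_derivative (\<lambda>h. ?J *v (h *\<^sub>R axis k 1))) (at t within {a..b})"
      using diff_chain_within[OF 2 1] by (simp add: o_def)
    then have "((\<lambda>t. F (upd x k t) $ m) has_derivative (\<lambda>h. (?J *v (h *\<^sub>R axis k 1)) $ m)) (at t within {a..b})"
      by (rule bounded_linear.has_derivative[OF bounded_linear_vec_nth])
    moreover have "(?J *v (h *\<^sub>R axis k 1)) $ m = h * ?J $ m $ k" for h
      using exhaust_2[of k] by (auto simp: matrix_vector_mult_def axis_def sum_2)
    ultimately show ?thesis by simp
  qed
  obtain c where "c \<in> {a<..<b}" "F (upd x k b) $ m - F (upd x k a) $ m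
      = (b - a) * jacobian F (at (upd x k c) within quadrant) $ m $ k"
    using mvt_simple[OF ab(2) D] by auto
  then show ?thesis using that[of c] by simp
qed

text \<open>On a set totally ordered by \<open>\<le>\<close>, the coordinate sum is an isometry for the 1-norm.\<close>

definition coord_sum :: "real^2 \<Rightarrow> real"
  where "coord_sum x = x $ 1 + x $ 2"

lemma coord_sum_strict_mono: "x < y \<Longrightarrow> coord_sum x < coord_sum y"
  by (auto simp: coord_sum_def less_iff_le_neq le_vec_iff Finite_Cartesian_Product.vec_eq_iff forall_2)

lemma continuous_on_coord_sum: "continuous_on S coord_sum"
  unfolding coord_sum_def by (intro continuous_intros)

lemma dist_le_coord_sum:
  assumes "x \<le> y \<or> y \<le> x"
  shows "dist x y \<le> \<bar>coord_sum x - coord_sum y\<bar>"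
proof -
  have "dist x y \<le> \<bar>x $ 1 - y $ 1\<bar> + \<bar>x $ 2 - y $ 2\<bar>"
    using norm_le_l1_cart[of "x - y"] by (simp add: dist_norm sum_2)
  also have "\<dots> = \<bar>coord_sum x - coord_sum y\<bar>"
    using assms unfolding coord_sum_def le_vec_iff forall_2 by linarith
  finally show ?thesis .
qed

text \<open>By \<open>dist_le_coord_sum\<close> the inverse is 1-Lipschitz, which also covers a
  noncompact \<open>S\<close>, such as a curve without its end point.\<close>

lemma chain_homeomorphism_coord_sum:
  assumes "\<And>x y. x \<in> S \<Longrightarrow> y \<in> S \<Longrightarrow> x \<le> y \<or> y \<le> x"
  obtains h where "homeomorphism S (coord_sum ` S) coord_sum h"
proof -
  have inj: "inj_on coord_sum S"
  proof (rule inj_onI)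
    fix x y assume "x \<in> S" "y \<in> S" "coord_sum x = coord_sum y"
    with assms[of x y] dist_le_coord_sum[of x y] show "x = y" by simp
  qed
  let ?h = "the_inv_into S coord_sum"
  have inv: "?h (coord_sum x) = x" if "x \<in> S" for x
    using the_inv_into_f_f[OF inj that] .
  have "continuous_on (coord_sum ` S) ?h"
    unfolding continuous_on_iff
  proof (clarsimp)
    fix x e :: "_" assume x: "x \<in> S" and e: "0 < (e::real)"
    show "\<exists>d>0. \<forall>y\<in>S. dist (coord_sum y) (coord_sum x) < d \<longrightarrow>
             dist (?h (coord_sum y)) (?h (coord_sum x)) < e"
      using x e inv by (intro exI[of _ e])
        (auto simp: dist_real_def intro: le_less_trans[OF dist_le_coord_sum[OF assms]])
  qed
  moreover have "?h ` coord_sum ` S = S"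
    using inv by (force simp: image_comp)
  ultimately have "homeomorphism S (coord_sum ` S) coord_sum ?h"
    using inv by (simp add: homeomorphism_def continuous_on_coord_sum)
  then show ?thesis using that by blast
qed

section \<open>Planar matrices\<close>

lemma det_dim_2:
  fixes A :: "'a::comm_ring_1 Matrix.mat"
  assumes A: "A \<in> carrier_mat 2 2"
  shows "Determinant.det A = A $$ (0,0) * A $$ (1,1) - A $$ (0,1) * A $$ (1,0)"
proof -
  have "{..<2::nat} = {0,1}" by auto
  then show ?thesis
    using A by (simp add: laplace_expansion_row[OF A, of 0] cofactor_def mat_delete_def det_single)
qed

lemma eigenvalue_complex_matrix_iff:
  "eigenvalue (complex_matrix A) k \<longleftrightarrow>
    (of_real (A $ 1 $ 1) - k) * (of_real (A $ 2 $ 2) - k) = of_real (A $ 1 $ 2 * A $ 2 $ 1)"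
proof -
  have A: "complex_matrix A \<in> carrier_mat 2 2" by (simp add: complex_matrix_def)
  show ?thesis
    unfolding eigenvalue_det[OF A] det_dim_2[OF char_matrix_closed[OF A]]
    by (simp add: char_matrix_def complex_matrix_def)
qed

text \<open>The root \<open>k\<close> of the characteristic polynomial is real and dominates both
  diagonal entries a and d. Since (k - a) * (k - d) equals the off-diagonal product, replacing
  \<open>k\<close> by 1 strictly increases the left side: I - A has a positive determinant.\<close>

lemma spectral_radius_less_1_imp:
  assumes rho: "spectral_radius (complex_matrix A) < 1"
    and "A $ 1 $ 2 * A $ 2 $ 1 \<ge> 0"
  shows "A $ 1 $ 1 < 1" "A $ 2 $ 2 < 1" "A $ 1 $ 2 * A $ 2 $ 1 < (1 - A $ 1 $ 1) * (1 - A $ 2 $ 2)"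
proof -
  define a d p where "a = A $ 1 $ 1" and "d = A $ 2 $ 2" and "p = A $ 1 $ 2 * A $ 2 $ 1"
  define q where "q = sqrt ((a - d)\<^sup>2 + 4 * p)"
  define k where "k = (a + d + q) / 2"
  have p: "0 \<le> p" using assms(2) by (simp add: p_def)
  have q2: "q\<^sup>2 = (a - d)\<^sup>2 + 4 * p" using p by (simp add: q_def)
  have q: "\<bar>a - d\<bar> \<le> q" unfolding q_def using p by (intro real_le_rsqrt) simp
  have ke: "(a - k) * (d - k) = p"
    using q2 by (simp add: k_def power2_eq_square field_simps)
  have "eigenvalue (complex_matrix A) (of_real k)"
    unfolding eigenvalue_complex_matrix_iff a_def[symmetric] d_def[symmetric] p_def[symmetric]
    by (simp flip: ke)
  then have "cmod (of_real k) \<in> cmod ` spectrum (complex_matrix A)"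
    by (intro imageI) (simp add: spectrum_def)
  then have "cmod (of_real k) \<le> spectral_radius (complex_matrix A)"
    by (intro spectral_radius_mem_max(2)[of _ 2]) (simp_all add: complex_matrix_def)
  with rho have k: "k < 1" by simp
  have "a \<le> k" "d \<le> k" using q by (auto simp: k_def)
  then have ad: "a < 1" "d < 1" using k by auto
  have "p = (k - a) * (k - d)" using ke by (simp add: algebra_simps)
  also have "\<dots> < (1 - a) * (1 - d)"
    using k \<open>a \<le> k\<close> \<open>d \<le> k\<close> by (intro mult_strict_mono') auto
  finally have "p < (1 - a) * (1 - d)" .
  with ad show "A $ 1 $ 1 < 1" "A $ 2 $ 2 < 1" "A $ 1 $ 2 * A $ 2 $ 1 < (1 - A $ 1 $ 1) * (1 - A $ 2 $ 2)"
    by (auto simp: a_def d_def p_def)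
qed

section \<open>The map on the box\<close>

lemma matrix_vector_mult_2:
  fixes A :: "real^2^2"
  shows "i \<noteq> j \<Longrightarrow> (A *v h) $ m = A $ m $ i * h $ i + A $ m $ j * h $ j"
  using neq_2_cases[of i j 1] neq_2_cases[of i j 2] by (auto simp: matrix_vector_mult_def sum_2)

text \<open>For \<open>i = 1\<close> this is the order of the cone K, for \<open>i = 2\<close> its
  reverse. The index lets one argument serve both axes.\<close>

definition leK :: "2 \<Rightarrow> real^2 \<Rightarrow> real^2 \<Rightarrow> bool"
  where "leK i x y \<longleftrightarrow> x $ i \<le> y $ i \<and> (\<forall>j. i \<noteq> j \<longrightarrow> y $ j \<le> x $ j)"

lemma leK_iff: "i \<noteq> j \<Longrightarrow> leK i x y \<longleftrightarrow> x $ i \<le> y $ i \<and> y $ j \<le> x $ j"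
  using all_2_iff[of i j "\<lambda>k. i \<noteq> k \<longrightarrow> y $ k \<le> x $ k"] by (simp add: leK_def)

lemma leK_swap: "i \<noteq> j \<Longrightarrow> leK i x y \<longleftrightarrow> leK j y x"
  using leK_iff[of i j x y] leK_iff[of j i y x] by auto

lemma le_iff_2: "i \<noteq> j \<Longrightarrow> x \<le> y \<longleftrightarrow> x $ i \<le> y $ i \<and> x $ j \<le> (y::real^2) $ j"
  unfolding le_vec_iff by (rule all_2_iff)

lemma vec_eq_iff_2: "i \<noteq> j \<Longrightarrow> x = y \<longleftrightarrow> x $ i = y $ i \<and> x $ j = (y::real^2) $ j"
  unfolding Finite_Cartesian_Product.vec_eq_iff by (rule all_2_iff)

locale typeK_system =
  fixes f T :: "real^2 \<Rightarrow> real^2" and r :: "real^2"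
  assumes T_eq: "\<And>x. x \<in> quadrant \<Longrightarrow> T x = (\<chi> i. x $ i * f x $ i)"
    and f_C1: "C1_on_quadrant f"
    and f_pos: "\<And>x i. x \<in> quadrant \<Longrightarrow> 0 < f x $ i"
    and dissip: "dissipative T"
    and f_zero: "\<And>i. 1 < f 0 $ i"
    and r_pos: "0 \<lless> r"
    and omega: "\<And>x. x \<in> quadrant \<Longrightarrow> omega_limit T x \<subseteq> {0..r}"
    and T_box: "T ` {0..r} \<subseteq> halfopen_box r"
    and spec: "\<And>x. x \<in> {0..r} \<Longrightarrow> spectral_radius (complex_matrix (M_matrix f x)) < 1"
    and typeK: "\<And>x. x \<in> {0..r} \<Longrightarrow>
        partial_deriv f 1 1 x < 0 \<and> partial_deriv f 2 2 x < 0 \<and>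
        0 \<le> partial_deriv f 1 2 x \<and> 0 \<le> partial_deriv f 2 1 x"
begin

abbreviation J :: "real^2 \<Rightarrow> real^2^2"
  where "J x \<equiv> jacobian T (at x within quadrant)"

lemma partial_deriv_diag: "x \<in> {0..r} \<Longrightarrow> partial_deriv f i i x < 0"
  using typeK[of x] exhaust_2[of i] by auto

lemma partial_deriv_offdiag: "x \<in> {0..r} \<Longrightarrow> i \<noteq> j \<Longrightarrow> 0 \<le> partial_deriv f i j x"
  using typeK[of x] exhaust_2[of i] exhaust_2[of j] by auto

lemma box_quadrant: "x \<in> {0..r} \<Longrightarrow> x \<in> quadrant"
  by (simp add: quadrant_iff)

lemma r_nonneg: "0 \<le> r"
  using r_pos by (rule sless_imp_le)

lemma T_nth: "x \<in> quadrant \<Longrightarrow> T x $ i = x $ i * f x $ i"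
  by (simp add: T_eq)

lemma T_quadrant: "x \<in> quadrant \<Longrightarrow> T x \<in> quadrant"
  by (auto simp: T_nth quadrant_def intro!: mult_nonneg_nonneg less_imp_le[OF f_pos])

lemma T_in_box: "x \<in> {0..r} \<Longrightarrow> T x \<in> {0..r}"
  using T_box by (auto simp: halfopen_box_iff sless_imp_le image_subset_iff)

lemma T_less_r: "x \<in> {0..r} \<Longrightarrow> T x $ i < r $ i"
  using T_box by (auto simp: halfopen_box_iff sless_iff image_subset_iff)

lemma f_differentiable: "x \<in> quadrant \<Longrightarrow> f differentiable (at x within quadrant)"
  using f_C1 by (simp add: C1_on_quadrant_def)

lemma T_has_derivative_formula:
  assumes x: "x \<in> quadrant"
  shows "(T has_derivative
      (\<lambda>h. \<chi> i. h $ i * f x $ i + x $ i * (jacobian f (at x within quadrant) *v h) $ i))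
      (at x within quadrant)"
proof -
  have "(f has_derivative (\<lambda>h. jacobian f (at x within quadrant) *v h)) (at x within quadrant)"
    using f_differentiable[OF x] by (simp add: jacobian_works)
  note * = bounded_linear.has_derivative[OF bounded_linear_vec_nth this]
    bounded_linear.has_derivative[OF bounded_linear_vec_nth has_derivative_ident]
  have "((\<lambda>x. x $ i * f x $ i) has_derivative
      (\<lambda>h. h $ i * f x $ i + x $ i * (jacobian f (at x within quadrant) *v h) $ i))
      (at x within quadrant)" for i
    using has_derivative_mult[OF *(2) *(1), of i i] by (simp add: algebra_simps)
  then have "((\<lambda>x. \<chi> i. x $ i * f x $ i) has_derivative
      (\<lambda>h. \<chi> i. h $ i * f x $ i + x $ i * (jacobian f (at x within quadrant) *v h) $ i))
      (at x within quadrant)"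
    by (subst has_derivative_componentwise_within) (auto simp: Basis_vec_def inner_axis)
  then show ?thesis
    by (rule has_derivative_transform[OF x, rotated]) (simp add: T_eq)
qed

lemma T_differentiable: "x \<in> quadrant \<Longrightarrow> T differentiable (at x within quadrant)"
  using T_has_derivative_formula by (auto simp: differentiable_def)

lemma T_has_derivative:
  "x \<in> quadrant \<Longrightarrow> (T has_derivative (\<lambda>h. J x *v h)) (at x within quadrant)"
  using T_differentiable by (simp add: jacobian_works)

lemma T_continuous: "continuous_on quadrant T"
  using T_differentiable
  by (auto intro!: differentiable_imp_continuous_on simp: differentiable_on_def)

lemma T_continuous_box: "continuous_on {0..r} T"
  using T_continuous by (rule continuous_on_subset) (auto simp: box_quadrant)

lemma jacobian_T:
  assumes x: "x \<in> quadrant"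
  shows "J x $ i $ j = (if i = j then f x $ i else 0) + x $ i * partial_deriv f i j x"
proof -
  have "(\<lambda>h. J x *v h) =
      (\<lambda>h. \<chi> i. h $ i * f x $ i + x $ i * (jacobian f (at x within quadrant) *v h) $ i)"
  proof (rule frechet_derivative_unique_within[OF T_has_derivative[OF x] T_has_derivative_formula[OF x]])
    \<comment> \<open>Positive steps in the coordinate directions stay in the quadrant, so the
      derivative is unique even at its corner.\<close>
    fix b :: "real^2" and e :: real
    assume "b \<in> Basis" "0 < e"
    then show "\<exists>d. 0 < \<bar>d\<bar> \<and> \<bar>d\<bar> < e \<and> x + d *\<^sub>R b \<in> quadrant"
      using x by (intro exI[of _ "e/2"]) (auto simp: Basis_vec_def quadrant_def axis_def)
  qed
  then have "(J x *v axis j 1) $ i =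
      axis j 1 $ i * f x $ i + x $ i * (jacobian f (at x within quadrant) *v axis j 1) $ i"
    by (simp add: fun_eq_iff)
  then show ?thesis
    by (simp add: matrix_vector_mult_basis column_def partial_deriv_def) (simp add: axis_def)
qed

text \<open>The factor x_i / f_i in the definition of M is chosen for this factorization; it turns
  bounds on M into signs for the Jacobian.\<close>

lemma J_M_matrix:
  assumes x: "x \<in> quadrant"
  shows "J x $ i $ j = f x $ i * ((if i = j then 1 else 0) - M_matrix f x $ i $ j)"
  using f_pos[OF x, of i] by (simp add: jacobian_T[OF x] M_matrix_def field_simps)

text \<open>The off-diagonal entries of M are nonpositive by type-K competition, so their product is
  nonnegative and the eigenvalue lemma applies.\<close>

lemma M_matrix_bounds:
  assumes x: "x \<in> {0..r}" and ij: "i \<noteq> j"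
  shows "M_matrix f x $ i $ i < 1"
    "M_matrix f x $ i $ j * M_matrix f x $ j $ i < (1 - M_matrix f x $ i $ i) * (1 - M_matrix f x $ j $ j)"
proof -
  have np: "M_matrix f x $ k $ l \<le> 0" if "k \<noteq> l" for k l
    using partial_deriv_offdiag[OF x that] f_pos[OF box_quadrant[OF x], of k] x
    by (auto simp: M_matrix_def le_vec_iff intro!: mult_nonneg_nonneg divide_nonneg_nonneg less_imp_le)
  have "0 \<le> M_matrix f x $ 1 $ 2 * M_matrix f x $ 2 $ 1"
    using np[of 1 2] np[of 2 1] by (simp add: mult_nonpos_nonpos)
  note * = spectral_radius_less_1_imp[OF spec[OF x] this]
  show "M_matrix f x $ i $ i < 1" using * exhaust_2[of i] by auto
  show "M_matrix f x $ i $ j * M_matrix f x $ j $ i < (1 - M_matrix f x $ i $ i) * (1 - M_matrix f x $ j $ j)"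
    using * ij exhaust_2[of i] exhaust_2[of j] by (auto simp: mult.commute)
qed

lemma J_offdiag: "x \<in> {0..r} \<Longrightarrow> i \<noteq> j \<Longrightarrow> 0 \<le> J x $ i $ j"
  using partial_deriv_offdiag[of x i j] by (simp add: jacobian_T box_quadrant le_vec_iff)

lemma J_diag: "x \<in> {0..r} \<Longrightarrow> 0 < J x $ i $ i"
  using M_matrix_bounds(1)[of x i] f_pos[of x i] ex_neq_2[of i]
  by (auto simp: J_M_matrix box_quadrant)

lemma J_det:
  assumes x: "x \<in> {0..r}" and ij: "i \<noteq> j"
  shows "J x $ i $ j * J x $ j $ i < J x $ i $ i * J x $ j $ j"
proof -
  have "0 < f x $ i * f x $ j" using f_pos[OF box_quadrant[OF x]] by simp
  from mult_strict_left_mono[OF M_matrix_bounds(2)[OF x ij] this] show ?thesis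
    using ij by (simp add: J_M_matrix box_quadrant[OF x] algebra_simps)
qed

lemma f_upd_strict:
  assumes x: "x \<in> {0..r}" and "0 \<le> a" "a < b" "b \<le> r $ k"
  shows "f (upd x k b) $ k < f (upd x k a) $ k"
proof -
  obtain c where c: "a < c" "c < b" "f (upd x k b) $ k - f (upd x k a) $ k
      = (b - a) * partial_deriv f k k (upd x k c)"
    using coordinate_mvt[OF f_differentiable box_quadrant[OF x] assms(2,3)]
    unfolding partial_deriv_def by blast
  have "upd x k c \<in> {0..r}" using x c assms by (intro upd_in_interval) auto
  then have "(b - a) * partial_deriv f k k (upd x k c) < 0"
    using partial_deriv_diag assms by (intro mult_pos_neg) auto
  with c show ?thesis by simp
qed

lemma f_upd_mono:
  assumes x: "x \<in> {0..r}" and "0 \<le> a" "a \<le> b" "b \<le> r $ k" and ik: "i \<noteq> k"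
  shows "f (upd x k a) $ i \<le> f (upd x k b) $ i"
proof (cases "a < b")
  case True
  obtain c where c: "a < c" "c < b" "f (upd x k b) $ i - f (upd x k a) $ i
      = (b - a) * partial_deriv f i k (upd x k c)"
    using coordinate_mvt[OF f_differentiable box_quadrant[OF x] assms(2) True]
    unfolding partial_deriv_def by blast
  have "upd x k c \<in> {0..r}" using x c assms by (intro upd_in_interval) auto
  then have "0 \<le> (b - a) * partial_deriv f i k (upd x k c)"
    using partial_deriv_offdiag[OF _ ik] assms by (intro mult_nonneg_nonneg) auto
  with c show ?thesis by simp
qed (use assms in simp)

lemma T_upd_strict:
  assumes x: "x \<in> {0..r}" and "0 \<le> a" "a < b" "b \<le> r $ k"
  shows "T (upd x k a) $ k < T (upd x k b) $ k"
proof -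
  obtain c where c: "a < c" "c < b" "T (upd x k b) $ k - T (upd x k a) $ k
      = (b - a) * J (upd x k c) $ k $ k"
    using coordinate_mvt[OF T_differentiable box_quadrant[OF x] assms(2,3)] by blast
  have "upd x k c \<in> {0..r}" using x c assms by (intro upd_in_interval) auto
  then have "0 < (b - a) * J (upd x k c) $ k $ k"
    using J_diag assms by (intro mult_pos_pos) auto
  with c show ?thesis by simp
qed

lemma T_upd_mono:
  assumes x: "x \<in> {0..r}" and "0 \<le> a" "a \<le> b" "b \<le> r $ k"
  shows "T (upd x k a) $ i \<le> T (upd x k b) $ i"
proof (cases "i = k \<or> a = b")
  case True
  then show ?thesis using T_upd_strict[OF x] assms by (cases "a = b") (auto intro: less_imp_le)
next
  case False
  have "upd x k a \<in> quadrant" "upd x k b \<in> quadrant"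
    using upd_in_interval[OF x] assms by (auto intro!: box_quadrant)
  moreover have "0 \<le> x $ i" using x by (simp add: le_vec_iff)
  ultimately show ?thesis
    using f_upd_mono[OF x assms(2-4)] False by (simp add: T_nth mult_left_mono)
qed

text \<open>The path from \<open>x\<close> to \<open>y\<close> along two sides of the rectangle they
  span stays in the box, and \<open>T\<close> increases on each side.\<close>

lemma T_mono:
  assumes x: "x \<in> {0..r}" and y: "y \<in> {0..r}" and xy: "x \<le> y"
  shows "T x \<le> T y"
proof -
  define z where "z = upd x 1 (y $ 1)"
  have z: "z \<in> {0..r}" "y = upd z 2 (y $ 2)" "z $ 2 = x $ 2"
    using x y by (auto simp: z_def vec_eq_iff_2[of 1 2] le_iff_2[of 1 2])
  have "T x $ m \<le> T z $ m" for m
    using T_upd_mono[OF x, of "x $ 1" "y $ 1" 1 m] x y xy by (simp add: z_def le_iff_2[of 1 2])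
  moreover have "T z $ m \<le> T y $ m" for m
    using T_upd_mono[OF z(1), of "x $ 2" "y $ 2" 2 m] x y xy z
    by (metis le_vec_iff atLeastAtMost_iff upd_same zero_index)
  ultimately show ?thesis unfolding le_vec_iff by (meson order_trans)
qed

lemma T_strict:
  assumes x: "x \<in> {0..r}" and y: "y \<in> {0..r}" and xy: "x \<le> y" and i: "x $ i < y $ i"
  shows "T x $ i < T y $ i"
proof -
  have z: "upd x i (y $ i) \<in> {0..r}"
    using x y by (intro upd_in_interval) (auto simp: le_vec_iff)
  have "T x $ i < T (upd x i (y $ i)) $ i"
    using T_upd_strict[OF x, of "x $ i" "y $ i" i] x y i by (simp add: le_vec_iff)
  also have "\<dots> \<le> T y $ i"
    using T_mono[OF z y] xy by (simp add: le_vec_iff)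
  finally show ?thesis .
qed

end

section \<open>Inverse monotonicity in the type-K order\<close>

context typeK_system begin

lemma T_linear_approx:
  assumes "x \<in> quadrant" "0 < e"
  shows "\<exists>d>0. \<forall>y m. y \<in> quadrant \<longrightarrow> norm (y - x) < d \<longrightarrow>
      \<bar>T y $ m - T x $ m - (J x *v (y - x)) $ m\<bar> \<le> e * norm (y - x)"
proof -
  obtain d where d: "0 < d" "\<And>y. y \<in> quadrant \<Longrightarrow> norm (y - x) < d \<Longrightarrow>
      norm (T y - T x - J x *v (y - x)) \<le> e * norm (y - x)"
    using T_has_derivative[OF assms(1)] assms(2) unfolding has_derivative_within_alt by blast
  have "\<bar>T y $ m - T x $ m - (J x *v (y - x)) $ m\<bar> \<le> e * norm (y - x)"
    if "y \<in> quadrant" "norm (y - x) < d" for y m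
    using component_le_norm_cart[of "T y - T x - J x *v (y - x)" m] d(2)[OF that] by simp
  with d(1) show ?thesis by blast
qed

lemma norm_le_2: "i \<noteq> j \<Longrightarrow> norm (x::real^2) \<le> \<bar>x $ i\<bar> + \<bar>x $ j\<bar>"
  using norm_le_l1_cart[of x] neq_2_cases[of i j 1] neq_2_cases[of i j 2] by (auto simp: sum_2)

text \<open>The local form of the inverse monotonicity: a positive left vector of the Jacobian
  turns it into a scalar inequality.\<close>

lemma K_isolated:
  assumes y: "y \<in> {0..r}" and ij: "i \<noteq> j"
  shows "\<exists>e>0. \<forall>z\<in>{0..r}. y $ i \<le> z $ i \<longrightarrow> z $ j \<le> y $ j \<longrightarrow>
      T z $ i \<le> T y $ i \<longrightarrow> T y $ j \<le> T z $ j \<longrightarrow> norm (z - y) < e \<longrightarrow> z = y"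
proof -
  \<comment> \<open>With B the Jacobian after changing the sign of its off-diagonal entries,
    \<open>(wi, wj)\<close> is the vector of column sums of the adjugate of B. It is positive and
    its product with B is \<open>(D, D)\<close>.\<close>
  define wi wj D where "wi = J y $ j $ j + J y $ j $ i" and "wj = J y $ i $ i + J y $ i $ j"
    and "D = J y $ i $ i * J y $ j $ j - J y $ i $ j * J y $ j $ i"
  have pos: "0 < wi" "0 < wj" "0 < D"
    using J_diag[OF y] J_offdiag[OF y] J_det[OF y] ij
    by (auto simp: wi_def wj_def D_def intro!: add_pos_nonneg)
  \<comment> \<open>The weighted linearization error is then at most half of the main term
    \<open>D * (u + v)\<close>.\<close>
  define e where "e = D / (2 * (wi + wj))"
  have e: "0 < e" "e * (wi + wj) = D / 2" using pos by (auto simp: e_def field_simps)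
  obtain d where d: "0 < d" "\<And>z m. z \<in> quadrant \<Longrightarrow> norm (z - y) < d \<Longrightarrow>
      \<bar>T z $ m - T y $ m - (J y *v (z - y)) $ m\<bar> \<le> e * norm (z - y)"
    using T_linear_approx[OF box_quadrant[OF y] e(1)] by blast
  have "z = y" if z: "z \<in> {0..r}" "y $ i \<le> z $ i" "z $ j \<le> y $ j"
      "T z $ i \<le> T y $ i" "T y $ j \<le> T z $ j" "norm (z - y) < d" for z
  proof -
    define u v where "u = z $ i - y $ i" and "v = y $ j - z $ j"
    have uv: "0 \<le> u" "0 \<le> v" using z by (auto simp: u_def v_def)
    have Ji: "(J y *v (z - y)) $ i = J y $ i $ i * u - J y $ i $ j * v"
      and Jj: "(J y *v (z - y)) $ j = J y $ j $ i * u - J y $ j $ j * v"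
      by (auto simp: matrix_vector_mult_2[OF ij] u_def v_def algebra_simps)
    have n: "norm (z - y) \<le> u + v"
      using norm_le_2[OF ij, of "z - y"] uv by (simp add: u_def v_def)
    have "J y $ i $ i * u - J y $ i $ j * v \<le> e * (u + v)"
      "J y $ j $ j * v - J y $ j $ i * u \<le> e * (u + v)"
      using d(2)[OF box_quadrant[OF z(1)] z(6), of i] d(2)[OF box_quadrant[OF z(1)] z(6), of j]
        z(4,5) mult_left_mono[OF n less_imp_le[OF e(1)]] unfolding Ji Jj by auto
    then have "wi * (J y $ i $ i * u - J y $ i $ j * v) + wj * (J y $ j $ j * v - J y $ j $ i * u)
        \<le> wi * (e * (u + v)) + wj * (e * (u + v))"
      using pos by (intro add_mono mult_left_mono) auto
    moreover have "wi * (J y $ i $ i * u - J y $ i $ j * v) + wj * (J y $ j $ j * v - J y $ j $ i * u)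
        = D * (u + v)"
      by (simp add: wi_def wj_def D_def algebra_simps)
    moreover have "wi * (e * (u + v)) + wj * (e * (u + v)) = D / 2 * (u + v)"
      unfolding e(2)[symmetric] by (simp add: algebra_simps)
    ultimately have "D * (u + v) \<le> 0" by simp
    with pos(3) uv have "u = 0 \<and> v = 0" by (auto simp: mult_le_0_iff)
    then have "z $ i = y $ i" "z $ j = y $ j" by (auto simp: u_def v_def)
    then show ?thesis using vec_eq_iff_2[OF ij] by blast
  qed
  with d(1) show ?thesis by blast
qed

text \<open>Some vector of the open cone is mapped into the open cone by the Jacobian, so a pair of
  points in reversed position can be moved closer to each other.\<close>

lemma K_decrease:
  assumes z: "z \<in> {0..r}" and ij: "i \<noteq> j" and ab: "a < z $ i" "z $ j < b" "0 \<le> a" "b \<le> r $ j"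
  obtains z' where "z' \<in> {0..r}" "a < z' $ i" "z' $ i < z $ i" "z $ j < z' $ j" "z' $ j < b"
    "T z' $ i < T z $ i" "T z $ j < T z' $ j"
proof -
  \<comment> \<open>These are the row sums of the same adjugate: the Jacobian maps the direction
    \<open>(-al, be)\<close> to \<open>(-D, D)\<close>.\<close>
  define al be D where "al = J z $ j $ j + J z $ i $ j" and "be = J z $ i $ i + J z $ j $ i"
    and "D = J z $ i $ i * J z $ j $ j - J z $ i $ j * J z $ j $ i"
  have pos: "0 < al" "0 < be" "0 < D"
    using J_diag[OF z] J_offdiag[OF z] J_det[OF z] ij
    by (auto simp: al_def be_def D_def intro!: add_pos_nonneg)
  define e where "e = D / (2 * (al + be))"
  have e: "0 < e" "e * (al + be) = D / 2" using pos by (auto simp: e_def field_simps)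
  obtain d where d: "0 < d" "\<And>y m. y \<in> quadrant \<Longrightarrow> norm (y - z) < d \<Longrightarrow>
      \<bar>T y $ m - T z $ m - (J z *v (y - z)) $ m\<bar> \<le> e * norm (y - z)"
    using T_linear_approx[OF box_quadrant[OF z] e(1)] by blast
  \<comment> \<open>The three bounds keep \<open>z'\<close> within the range of the linear
    approximation, above \<open>a\<close> and below \<open>b\<close>; halving makes them
    strict.\<close>
  define m where "m = min (d / (al + be)) (min ((z $ i - a) / al) ((b - z $ j) / be))"
  define t where "t = m / 2"
  have m: "0 < m" using pos d(1) ab by (simp add: m_def)
  then have tp: "0 < t" "t < m" by (simp_all add: t_def)
  then have "t < d / (al + be)" "t < (z $ i - a) / al" "t < (b - z $ j) / be"
    by (simp_all add: m_def)
  then have t: "t * (al + be) < d" "t * al < z $ i - a" "t * be < b - z $ j"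
    using pos by (auto simp: field_simps)
  define z' where "z' = (\<chi> k. if k = i then z $ i - t * al else z $ j + t * be)"
  have z'n: "z' $ i = z $ i - t * al" "z' $ j = z $ j + t * be"
    using ij by (auto simp: z'_def)
  have tab: "0 < t * al" "0 < t * be" using tp pos by auto
  have box: "z' \<in> {0..r}"
    using z ab t tab unfolding atLeastAtMost_iff le_iff_2[OF ij] z'n by simp
  have n: "norm (z' - z) \<le> t * (al + be)"
    using norm_le_2[OF ij, of "z' - z"] tab by (simp add: z'n algebra_simps)
  have Ji: "(J z *v (z' - z)) $ i = - t * D" and Jj: "(J z *v (z' - z)) $ j = t * D"
    by (auto simp: matrix_vector_mult_2[OF ij] z'n al_def be_def D_def algebra_simps)
  have "e * norm (z' - z) \<le> e * (t * (al + be))"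
    using n e(1) by (intro mult_left_mono) auto
  also have "\<dots> = t * (e * (al + be))" by simp
  also have "\<dots> < t * D" unfolding e(2) using tp pos by simp
  finally have "T z' $ i < T z $ i" "T z $ j < T z' $ j"
    using d(2)[OF box_quadrant[OF box], of i] d(2)[OF box_quadrant[OF box], of j] n t(1)
    unfolding Ji Jj by auto
  with box z'n t tab show ?thesis by (intro that[of z']) auto
qed

text \<open>The argument of Gale and Nikaido: among the points that are in reversed position relative
  to \<open>y\<close>, a closest one could be moved still closer.\<close>

lemma K_no_reversal:
  assumes y: "y \<in> {0..r}" and x: "x \<in> {0..r}" and ij: "i \<noteq> j"
    and yx: "y $ i < x $ i" "x $ j < y $ j"
  shows "\<not> (T x $ i \<le> T y $ i \<and> T y $ j \<le> T x $ j)"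
proof
  assume Txy: "T x $ i \<le> T y $ i \<and> T y $ j \<le> T x $ j"
  obtain e where e: "0 < e" "\<And>z. z \<in> {0..r} \<Longrightarrow> y $ i \<le> z $ i \<Longrightarrow> z $ j \<le> y $ j \<Longrightarrow>
      T z $ i \<le> T y $ i \<Longrightarrow> T y $ j \<le> T z $ j \<Longrightarrow> norm (z - y) < e \<Longrightarrow> z = y"
    using K_isolated[OF y ij] by blast
  \<comment> \<open>Removing the ball excludes \<open>y\<close>, which satisfies the conditions
    trivially, and keeps the set compact.\<close>
  define X where "X = {0..r} \<inter> {z. y $ i \<le> z $ i} \<inter> {z. z $ j \<le> y $ j} \<inter> - ball y e"
  define Y where "Y = {z \<in> X. T z $ i \<le> T y $ i \<and> T y $ j \<le> T z $ j}"
  have X: "compact X"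
    unfolding X_def by (intro compact_Int_closed closed_halfspace_component_le_cart
      closed_halfspace_component_ge_cart) (auto simp: interval_cbox)
  have cT: "continuous_on X T"
    using T_continuous_box by (rule continuous_on_subset) (auto simp: X_def)
  have "closed {z \<in> X. T z $ i \<le> T y $ i}" "closed {z \<in> X. T y $ j \<le> T z $ j}"
    by (intro continuous_on_closed_Collect_le continuous_intros cT compact_imp_closed X)+
  then have "compact (X \<inter> ({z \<in> X. T z $ i \<le> T y $ i} \<inter> {z \<in> X. T y $ j \<le> T z $ j}))"
    by (intro compact_Int_closed X closed_Int)
  moreover have "X \<inter> ({z \<in> X. T z $ i \<le> T y $ i} \<inter> {z \<in> X. T y $ j \<le> T z $ j}) = Y"
    by (auto simp: Y_def)
  ultimately have Y: "compact Y" by simp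
  have xY: "x \<in> Y"
    using e(2)[OF x] x yx Txy by (force simp: Y_def X_def dist_norm norm_minus_commute)
  have "continuous_on Y (\<lambda>z. z $ i - z $ j)" by (intro continuous_intros)
  \<comment> \<open>Up to a constant, \<open>z $ i - z $ j\<close> is the 1-norm distance from
    \<open>y\<close> on this region.\<close>
  then obtain z where z: "z \<in> Y" "\<And>w. w \<in> Y \<Longrightarrow> z $ i - z $ j \<le> w $ i - w $ j"
    using continuous_attains_inf[OF Y] xY by blast
  have zb: "z \<in> {0..r}" "y $ i \<le> z $ i" "z $ j \<le> y $ j" "T z $ i \<le> T y $ i" "T y $ j \<le> T z $ j"
    and "\<not> norm (z - y) < e"
    using z(1) by (auto simp: Y_def X_def dist_norm norm_minus_commute)
  then have zy: "z \<noteq> y" using e(1) by auto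
  \<comment> \<open>If either coordinate agreed with that of \<open>y\<close>, the two points would
    be comparable for \<open>\<le>\<close>, and strict monotonicity of \<open>T\<close> would
    contradict the reversed images. So the minimizer is interior to the region and can be
    moved.\<close>
  have i: "y $ i < z $ i"
  proof (rule ccontr)
    assume "\<not> y $ i < z $ i"
    with zb zy have "z \<le> y" "z $ j < y $ j" by (auto simp: le_iff_2[OF ij] vec_eq_iff_2[OF ij])
    from T_strict[OF zb(1) y this] zb(5) show False by simp
  qed
  have j: "z $ j < y $ j"
  proof (rule ccontr)
    assume "\<not> z $ j < y $ j"
    with zb zy i have "y \<le> z" by (auto simp: le_iff_2[OF ij] vec_eq_iff_2[OF ij])
    from T_strict[OF y zb(1) this i] zb(4) show False by simp
  qed
  have yb: "0 \<le> y $ i" "y $ j \<le> r $ j" using y by (auto simp: le_vec_iff)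
  obtain w where w: "w \<in> {0..r}" "y $ i < w $ i" "w $ i < z $ i" "z $ j < w $ j" "w $ j < y $ j"
    "T w $ i < T z $ i" "T z $ j < T w $ j"
    using K_decrease[OF zb(1) ij i j yb] by metis
  \<comment> \<open>The point \<open>w\<close> cannot fall into the removed ball: by
    \<open>K_isolated\<close> it would equal \<open>y\<close>, but its i-th coordinate is
    larger.\<close>
  have "w \<in> Y"
    using e(2)[OF w(1)] w zb by (force simp: Y_def X_def dist_norm norm_minus_commute)
  from z(2)[OF this] w show False by simp
qed

text \<open>If the conclusion fails, the points are either strictly reversed, which
  \<open>K_no_reversal\<close> excludes, or comparable for \<open>\<le>\<close>, and then a strictly
  larger coordinate stays strictly larger under \<open>T\<close>.\<close>

lemma K_inverse:
  assumes x: "x \<in> {0..r}" and y: "y \<in> {0..r}" and xy: "leK i (T x) (T y)"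
  shows "leK i x y"
proof -
  obtain j where ij: "i \<noteq> j" using ex_neq_2 by blast
  have T: "T x $ i \<le> T y $ i" "T y $ j \<le> T x $ j" using xy leK_iff[OF ij] by auto
  have "x $ i \<le> y $ i \<and> y $ j \<le> x $ j"
  proof (rule ccontr)
    assume "\<not> (x $ i \<le> y $ i \<and> y $ j \<le> x $ j)"
    then consider "y $ i < x $ i" "x $ j < y $ j" | "y \<le> x" "y $ i < x $ i" | "x \<le> y" "x $ j < y $ j"
      by (force simp: le_iff_2[OF ij])
    then show False
    proof cases
      case 1 then show False using K_no_reversal[OF y x ij 1] T by auto
    next
      case 2 then show False using T_strict[OF y x, of i] T by auto
    next
      case 3 then show False using T_strict[OF x y, of j] T by auto
    qed
  qed
  then show ?thesis using leK_iff[OF ij] by blast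
qed

lemma T_inj: "inj_on T {0..r}"
proof (rule inj_onI)
  fix x y assume xy: "x \<in> {0..r}" "y \<in> {0..r}" "T x = T y"
  then have "leK 1 (T x) (T y)" "leK 1 (T y) (T x)" by (simp_all add: leK_def)
  with xy have "leK 1 x y" "leK 1 y x" by (blast intro: K_inverse)+
  then show "x = y" by (auto simp: leK_iff[of 1 2] vec_eq_iff_2[of 1 2])
qed

end

section \<open>Convergence of forward orbits\<close>

lemma sless_eventually:
  assumes "(s \<longlongrightarrow> l) F" "l \<lless> b"
  shows "\<forall>\<^sub>F n in F. s n \<lless> b"
proof -
  have "\<forall>\<^sub>F n in F. s n $ i < b $ i" for i
    using order_tendstoD(2)[OF tendsto_vec_nth[OF assms(1)], of i] assms(2) by (auto simp: sless_iff)
  then have "\<forall>\<^sub>F n in F. s n $ 1 < b $ 1 \<and> s n $ 2 < b $ 2" by (simp add: eventually_conj_iff)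
  then show ?thesis by (simp add: sless_iff forall_2)
qed

lemma sless_eventually':
  assumes "(s \<longlongrightarrow> l) F" "a \<lless> l"
  shows "\<forall>\<^sub>F n in F. a \<lless> s n"
proof -
  have "\<forall>\<^sub>F n in F. a $ i < s n $ i" for i
    using order_tendstoD(1)[OF tendsto_vec_nth[OF assms(1)], of _ i] assms(2) by (auto simp: sless_iff)
  then have "\<forall>\<^sub>F n in F. a $ 1 < s n $ 1 \<and> a $ 2 < s n $ 2" by (simp add: eventually_conj_iff)
  then show ?thesis by (simp add: sless_iff forall_2)
qed

lemma le_vec_limit:
  fixes l :: "real^2"
  assumes "s \<longlonglongrightarrow> l" "\<forall>\<^sub>F n in sequentially. s n \<le> b"
  shows "l \<le> b"
  using assms tendsto_upperbound[OF tendsto_vec_nth[OF assms(1)]]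
  by (simp add: le_vec_iff eventually_mono)

lemma ge_vec_limit:
  fixes l :: "real^2"
  assumes "s \<longlonglongrightarrow> l" "\<forall>\<^sub>F n in sequentially. a \<le> s n"
  shows "a \<le> l"
  using assms tendsto_lowerbound[OF tendsto_vec_nth[OF assms(1)]]
  by (simp add: le_vec_iff eventually_mono)

lemma Inter_closure_tails_convergent:
  fixes s :: "nat \<Rightarrow> 'a::metric_space"
  assumes "s \<longlonglongrightarrow> l"
  shows "(\<Inter>n. closure {s m |m. n \<le> m}) = {l}"
proof (intro equalityI subsetI)
  fix y assume y: "y \<in> (\<Inter>n. closure {s m |m. n \<le> m})"
  have "dist y l \<le> e" if e: "0 < e" for e
  proof -
    obtain n where n: "\<And>m. n \<le> m \<Longrightarrow> dist (s m) l < e"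
      using assms e unfolding lim_sequentially by blast
    have "closure {s m |m. n \<le> m} \<subseteq> cball l e"
      using n by (intro closure_minimal) (auto simp: dist_commute less_imp_le)
    with y show ?thesis by (auto simp: dist_commute)
  qed
  then have "dist y l \<le> 0" by (rule field_le_epsilon[of _ 0, simplified])
  then show "y \<in> {l}" by simp
next
  fix y assume "y \<in> {l}"
  moreover have "l \<in> closure {s m |m. n \<le> m}" for n
    unfolding closure_sequential
    using LIMSEQ_ignore_initial_segment[OF assms, of n]
    by (intro exI[of _ "\<lambda>k. s (k + n)"]) auto
  ultimately show "y \<in> (\<Inter>n. closure {s m |m. n \<le> m})" by blast
qed

lemma coordinatewise_monoseq_convergent:
  fixes s :: "nat \<Rightarrow> real^2"
  assumes "bounded (range s)" and "\<And>i. monoseq (\<lambda>n. s (n + n0) $ i)"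
  shows "\<exists>l. s \<longlonglongrightarrow> l"
proof -
  have "\<exists>c. (\<lambda>n. s (n + n0) $ i) \<longlonglongrightarrow> c" for i
  proof -
    obtain B where "\<And>n. norm (s n) \<le> B" using assms(1) by (auto simp: bounded_iff)
    then have "norm (s (n + n0) $ i) \<le> B" for n
      using component_le_norm_cart[of "s (n + n0)" i] by (metis order_trans real_norm_def)
    then have "Bseq (\<lambda>n. s (n + n0) $ i)" by (rule BseqI')
    then show ?thesis using Bseq_monoseq_convergent assms(2) by (auto simp: convergent_def)
  qed
  then obtain c where "\<And>i. (\<lambda>n. s (n + n0) $ i) \<longlonglongrightarrow> c i" by metis
  then have "(\<lambda>n. s (n + n0)) \<longlonglongrightarrow> (\<chi> i. c i)"
    by (intro vec_tendstoI) simp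
  then show ?thesis using LIMSEQ_offset by blast
qed

lemma monoseq_from:
  fixes u :: "nat \<Rightarrow> real"
  assumes "(\<forall>n\<ge>n0. u n \<le> u (Suc n)) \<or> (\<forall>n\<ge>n0. u (Suc n) \<le> u n)"
  shows "monoseq (\<lambda>n. u (n + n0))"
  using assms by (auto simp: monoseq_Suc)

text \<open>The condition on \<open>R\<close> is posed per coordinate so that it covers both
  \<open><\<close> and \<open>\<lless>\<^sub>K\<close>, in which the two coordinates move in
  opposite senses.\<close>

lemma eventually_monotone_convergent:
  fixes s :: "nat \<Rightarrow> real^2"
  assumes "bounded (range s)" and em: "eventually_monotone R s"
    and R: "\<And>i. (\<forall>x y. R x y \<longrightarrow> x $ i \<le> y $ i) \<or> (\<forall>x y. R x y \<longrightarrow> y $ i \<le> x $ i)"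
  shows "\<exists>l. s \<longlonglongrightarrow> l"
proof -
  obtain n0 where n0: "(\<forall>n\<ge>n0. R (s n) (s (Suc n))) \<or> (\<forall>n\<ge>n0. R (s (Suc n)) (s n)) \<or>
      (\<forall>n\<ge>n0. s (Suc n) = s n)"
    using em by (auto simp: eventually_monotone_def)
  have "(\<forall>n\<ge>n0. s n $ i \<le> s (Suc n) $ i) \<or> (\<forall>n\<ge>n0. s (Suc n) $ i \<le> s n $ i)" for i
    using n0 R[of i] by (elim disjE) auto
  then have "monoseq (\<lambda>n. s (n + n0) $ i)" for i
    by (rule monoseq_from[where u = "\<lambda>n. s n $ i"])
  then show ?thesis by (rule coordinatewise_monoseq_convergent[OF assms(1)])
qed

text \<open>A failure of \<open>P\<close> persists by the second assumption, and then
  \<open>Q\<close> holds from there on. It is applied to an order relation between consecutive orbit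
  points that is inherited towards smaller indices: the direction switches at most once.\<close>

lemma eventually_or_always:
  assumes "\<And>n::nat. P n \<or> Q n" "\<And>n. P (Suc n) \<Longrightarrow> P n"
  shows "(\<forall>n. P n) \<or> (\<exists>n0. \<forall>n\<ge>n0. Q n)"
proof (cases "\<forall>n. P n")
  case False
  then obtain n0 where n0: "\<not> P n0" by blast
  have "\<not> P n" if "n0 \<le> n" for n
    using that by (induction rule: dec_induct) (use n0 assms(2) in auto)
  then show ?thesis using assms(1) by blast
qed simp

context typeK_system begin

lemma box_compact: "compact {0..r}"
  by (simp add: interval_cbox)

lemma funpow_T_quadrant: "x \<in> quadrant \<Longrightarrow> (T ^^ n) x \<in> quadrant"
  by (induction n) (auto intro: T_quadrant)

lemma funpow_T_box: "x \<in> {0..r} \<Longrightarrow> (T ^^ n) x \<in> {0..r}"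
  by (induction n) (use T_in_box in auto)

lemma funpow_T_mono:
  "x \<in> {0..r} \<Longrightarrow> y \<in> {0..r} \<Longrightarrow> x \<le> y \<Longrightarrow> (T ^^ n) x \<le> (T ^^ n) y"
  by (induction n) (use T_mono funpow_T_box in auto)

lemma funpow_T_continuous: "continuous_on quadrant (T ^^ n)"
proof (induction n)
  case (Suc n)
  have "continuous_on ((T ^^ n) ` quadrant) T"
    using T_continuous by (rule continuous_on_subset) (auto intro: funpow_T_quadrant)
  from continuous_on_compose[OF Suc this] show ?case by (simp add: o_def)
qed simp

lemma quadrant_closed: "closed quadrant"
proof -
  have eq: "quadrant = (\<Inter>i. {x. 0 \<le> x $ i})" by (auto simp: quadrant_def)
  show ?thesis
    unfolding eq by (intro closed_INT ballI closed_halfspace_component_ge_cart)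
qed

lemma fixed_limit:
  assumes s: "s \<longlonglongrightarrow> p" and q: "\<And>n. s n \<in> quadrant" and Ts: "(\<lambda>n. T (s n)) \<longlonglongrightarrow> p"
  shows "T p = p" "p \<in> quadrant"
proof -
  show p: "p \<in> quadrant"
    using closed_sequentially[OF quadrant_closed _ s] q by blast
  have "(\<lambda>n. T (s n)) \<longlonglongrightarrow> T p"
    using continuous_on_tendsto_compose[OF T_continuous s p] q by simp
  then show "T p = p" using Ts LIMSEQ_unique by blast
qed

text \<open>Dissipativity gives the orbit an accumulation point, which lies in the closed box by the
  hypothesis on omega-limit sets. Its image lies strictly below \<open>r\<close>, an open condition,
  so the image of a nearby orbit point does too.\<close>

lemma orbit_enters_box:
  assumes x: "x \<in> quadrant"
  shows "\<exists>n. (T ^^ n) x \<in> halfopen_box r"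
proof -
  obtain B where B: "bounded B" "\<forall>\<^sub>F n in sequentially. (T ^^ n) x \<in> B"
    using dissip x unfolding dissipative_def by blast
  then obtain N where N: "\<And>n. N \<le> n \<Longrightarrow> (T ^^ n) x \<in> B" by (auto simp: eventually_sequentially)
  define s where "s n = (T ^^ (n + N)) x" for n
  have "compact (closure B)" using B(1) by (simp add: compact_closure)
  moreover have "s n \<in> closure B" for n using N[of "n + N"] closure_subset[of B] by (auto simp: s_def)
  ultimately obtain l k where k: "strict_mono k" "(s \<circ> k) \<longlonglongrightarrow> l"
    unfolding compact_def by meson
  have "l \<in> closure {(T ^^ m) x |m. n \<le> m}" for n
  proof -
    have "(\<lambda>j. (s \<circ> k) (j + n)) \<longlonglongrightarrow> l" using k(2) by (rule LIMSEQ_ignore_initial_segment)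
    moreover have "n \<le> k (j + n) + N" for j
      using seq_suble[OF k(1), of "j + n"] by simp
    ultimately show ?thesis
      unfolding closure_sequential
      by (intro exI[of _ "\<lambda>j. (s \<circ> k) (j + n)"]) (auto simp: s_def)
  qed
  then have l: "l \<in> {0..r}" using omega[OF x] unfolding omega_limit_def by blast
  have q: "(s \<circ> k) n \<in> quadrant" for n using x by (simp add: s_def funpow_T_quadrant)
  have "(\<lambda>n. T ((s \<circ> k) n)) \<longlonglongrightarrow> T l"
    using continuous_on_tendsto_compose[OF T_continuous k(2) box_quadrant[OF l]] q by simp
  moreover have "T l \<lless> r" using T_less_r[OF l] by (simp add: sless_iff)
  ultimately have "\<forall>\<^sub>F n in sequentially. T ((s \<circ> k) n) \<lless> r" by (rule sless_eventually)
  then obtain n where "T ((s \<circ> k) n) \<lless> r" by (meson eventually_happens trivial_limit_sequentially)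
  moreover have "T ((s \<circ> k) n) = (T ^^ Suc (k n + N)) x" by (simp add: s_def)
  moreover have "T ((s \<circ> k) n) \<in> quadrant" using q T_quadrant by blast
  ultimately show ?thesis by (metis halfopen_box_iff quadrant_iff)
qed

lemma orbit_enters_box': "x \<in> quadrant \<Longrightarrow> \<exists>n. (T ^^ n) x \<in> {0..r}"
  using orbit_enters_box halfopen_box_iff sless_imp_le by fastforce

text \<open>A \<open>\<le>\<close>-comparison of consecutive points propagates forward by
  monotonicity. If none ever occurs, consecutive points are always strictly K-related, and
  K-relations propagate backward by \<open>K_inverse\<close>.\<close>

lemma forward_monotone_box:
  assumes x: "x \<in> {0..r}"
  shows "eventually_monotone (\<lless>\<^sub>K) (\<lambda>n. (T ^^ n) x) \<or> eventually_monotone (<) (\<lambda>n. (T ^^ n) x)"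
proof -
  define z where "z n = (T ^^ n) x" for n
  have zb: "z n \<in> {0..r}" for n using funpow_T_box[OF x] by (simp add: z_def)
  have zS: "z (Suc n) = T (z n)" for n by (simp add: z_def)
  have zmono: "z (Suc m) \<le> z (Suc n)" if "z m \<le> z n" for m n
    using T_mono[OF zb zb that] by (simp add: zS)
  consider n where "z n \<le> z (Suc n)" | n where "z (Suc n) \<le> z n"
    | "\<forall>n. \<not> z n \<le> z (Suc n) \<and> \<not> z (Suc n) \<le> z n" by blast
  then show ?thesis
  proof cases
    case 1
    have up: "z m \<le> z (Suc m)" if "n \<le> m" for m
      using that by (induction rule: dec_induct) (use 1 zmono in auto)
    show ?thesis
    proof (cases "\<exists>m\<ge>n. z (Suc m) = z m")
      case True
      then obtain m where m: "z (Suc m) = z m" by blast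
      have "z (Suc k) = z k" if "m \<le> k" for k
        using that by (induction rule: dec_induct) (use m zS in auto)
      then show ?thesis by (auto simp: eventually_monotone_def z_def)
    next
      case False
      with up have "\<forall>m\<ge>n. z m < z (Suc m)" by (metis less_iff_le_neq)
      then show ?thesis by (auto simp: eventually_monotone_def z_def)
    qed
  next
    case 2
    have up: "z (Suc m) \<le> z m" if "n \<le> m" for m
      using that by (induction rule: dec_induct) (use 2 zmono in auto)
    show ?thesis
    proof (cases "\<exists>m\<ge>n. z (Suc m) = z m")
      case True
      then obtain m where m: "z (Suc m) = z m" by blast
      have "z (Suc k) = z k" if "m \<le> k" for k
        using that by (induction rule: dec_induct) (use m zS in auto)
      then show ?thesis by (auto simp: eventually_monotone_def z_def)
    next
      case False
      with up have "\<forall>m\<ge>n. z (Suc m) < z m" by (metis less_iff_le_neq)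
      then show ?thesis by (auto simp: eventually_monotone_def z_def)
    qed
  next
    case 3
    have PQ: "z n \<lless>\<^sub>K z (Suc n) \<or> z (Suc n) \<lless>\<^sub>K z n" for n
      using 3[rule_format, of n] by (auto simp: sless_K_iff le_vec_iff forall_2)
    have down: "z n \<lless>\<^sub>K z (Suc n)" if "z (Suc n) \<lless>\<^sub>K z (Suc (Suc n))" for n
    proof -
      have "leK 1 (z n) (z (Suc n))"
        using that by (intro K_inverse[OF zb zb]) (auto simp: leK_iff[of 1 2] sless_K_iff simp flip: zS)
      with PQ[of n] show ?thesis by (auto simp: leK_iff[of 1 2] sless_K_iff)
    qed
    have "(\<forall>n. z n \<lless>\<^sub>K z (Suc n)) \<or> (\<exists>n0. \<forall>n\<ge>n0. z (Suc n) \<lless>\<^sub>K z n)"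
      by (rule eventually_or_always[OF PQ down])
    then have "eventually_monotone (\<lless>\<^sub>K) z"
      unfolding eventually_monotone_def by blast
    then show ?thesis by (simp add: z_def[abs_def])
  qed
qed

lemma forward_monotone:
  assumes x: "x \<in> quadrant"
  shows "eventually_monotone (\<lless>\<^sub>K) (\<lambda>n. (T ^^ n) x) \<or> eventually_monotone (<) (\<lambda>n. (T ^^ n) x)"
proof -
  obtain n where n: "(T ^^ n) x \<in> {0..r}" using orbit_enters_box'[OF x] by blast
  have "eventually_monotone R (\<lambda>n. (T ^^ n) x)"
    if "eventually_monotone R (\<lambda>m. (T ^^ m) ((T ^^ n) x))" for R
  proof -
    define u where "u m = (T ^^ m) x" for m
    have "(T ^^ m) ((T ^^ n) x) = u (m + n)" for m by (simp add: u_def funpow_add)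
    with that obtain n0 where n0: "(\<forall>m\<ge>n0. R (u (m + n)) (u (Suc m + n))) \<or>
       (\<forall>m\<ge>n0. R (u (Suc m + n)) (u (m + n))) \<or> (\<forall>m\<ge>n0. u (Suc m + n) = u (m + n))"
      unfolding eventually_monotone_def by metis
    have *: "\<forall>k\<ge>n0 + n. Q k" if "\<forall>m\<ge>n0. Q (m + n)" for Q
    proof (intro allI impI)
      fix k assume "n0 + n \<le> k"
      then show "Q k" using that[rule_format, of "k - n"] by simp
    qed
    from n0[unfolded add_Suc] consider "\<forall>m\<ge>n0. R (u (m + n)) (u (Suc (m + n)))"
      | "\<forall>m\<ge>n0. R (u (Suc (m + n))) (u (m + n))" | "\<forall>m\<ge>n0. u (Suc (m + n)) = u (m + n)"
      by blast
    then show ?thesis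
      unfolding eventually_monotone_def u_def[symmetric]
    proof cases
      case 1 from *[OF this] show "\<exists>n0. (\<forall>n\<ge>n0. R (u n) (u (Suc n))) \<or>
        (\<forall>n\<ge>n0. R (u (Suc n)) (u n)) \<or> (\<forall>n\<ge>n0. u (Suc n) = u n)" by blast
    next
      case 2 from *[OF this] show "\<exists>n0. (\<forall>n\<ge>n0. R (u n) (u (Suc n))) \<or>
        (\<forall>n\<ge>n0. R (u (Suc n)) (u n)) \<or> (\<forall>n\<ge>n0. u (Suc n) = u n)" by blast
    next
      case 3 from *[OF this] show "\<exists>n0. (\<forall>n\<ge>n0. R (u n) (u (Suc n))) \<or>
        (\<forall>n\<ge>n0. R (u (Suc n)) (u n)) \<or> (\<forall>n\<ge>n0. u (Suc n) = u n)" by blast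
    qed
  qed
  with forward_monotone_box[OF n] show ?thesis by blast
qed

lemma forward_convergent:
  assumes x: "x \<in> quadrant"
  shows "\<exists>p\<in>{0..r}. T p = p \<and> (\<lambda>n. (T ^^ n) x) \<longlonglongrightarrow> p"
proof -
  obtain N where N: "(T ^^ N) x \<in> {0..r}" using orbit_enters_box'[OF x] by blast
  define z where "z n = (T ^^ n) ((T ^^ N) x)" for n
  have zb: "z n \<in> {0..r}" for n using funpow_T_box[OF N] by (simp add: z_def)
  then have "range z \<subseteq> {0..r}" by (rule image_subsetI)
  then have "bounded (range z)" by (rule bounded_subset[OF compact_imp_bounded[OF box_compact]])
  then have "\<exists>p. z \<longlonglongrightarrow> p"
  proof -
    assume b: "bounded (range z)"
    from forward_monotone_box[OF N] show ?thesis
    proof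
      assume "eventually_monotone (\<lless>\<^sub>K) (\<lambda>n. (T ^^ n) ((T ^^ N) x))"
      moreover have "(\<forall>x y. x \<lless>\<^sub>K y \<longrightarrow> x $ i \<le> y $ i) \<or> (\<forall>x y. x \<lless>\<^sub>K y \<longrightarrow> y $ i \<le> x $ i)" for i
        using exhaust_2[of i] by (auto simp: sless_K_iff)
      ultimately show ?thesis using eventually_monotone_convergent[OF b, of "(\<lless>\<^sub>K)"] by (simp add: z_def[abs_def])
    next
      assume "eventually_monotone (<) (\<lambda>n. (T ^^ n) ((T ^^ N) x))"
      moreover have "\<forall>x y. x < y \<longrightarrow> x $ i \<le> (y::real^2) $ i" for i
        by (auto simp: less_iff_le_neq le_vec_iff)
      ultimately show ?thesis using eventually_monotone_convergent[OF b, of "(<)"] by (simp add: z_def[abs_def])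
    qed
  qed
  then obtain p where p: "z \<longlonglongrightarrow> p" by blast
  have "(\<lambda>n. T (z n)) = (\<lambda>n. z (Suc n))" by (simp add: z_def)
  then have "(\<lambda>n. T (z n)) \<longlonglongrightarrow> p" using LIMSEQ_Suc[OF p] by simp
  from fixed_limit[OF p _ this] zb have "T p = p" by (blast intro: box_quadrant)
  moreover have "p \<in> {0..r}"
    using closed_sequentially[OF compact_imp_closed[OF box_compact] _ p] zb by blast
  moreover have "(\<lambda>n. (T ^^ n) x) \<longlonglongrightarrow> p"
  proof (rule LIMSEQ_offset)
    show "(\<lambda>n. (T ^^ (n + N)) x) \<longlonglongrightarrow> p"
      using p by (simp add: z_def[abs_def] funpow_add)
  qed
  ultimately show ?thesis by blast
qed

end

section \<open>Backward orbits\<close>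

context typeK_system begin

abbreviation g :: "real^2 \<Rightarrow> real^2"
  where "g \<equiv> inverse_on_box T r"

abbreviation A :: "(real^2) set"
  where "A \<equiv> attractor T r"

text \<open>For a \<open>B\<close> invariant in the box this is its largest subset mapped onto
  itself by \<open>T\<close>. The attractor, \<open>Sigma_set T r\<close> and
  \<open>Sigma_0 T r\<close> are all cores, and the axis curves are located with the help of another
  one.\<close>

definition core :: "(real^2) set \<Rightarrow> (real^2) set"
  where "core B = (\<Inter>n. (T ^^ n) ` B)"

definition invariant_in_box :: "(real^2) set \<Rightarrow> bool"
  where "invariant_in_box B \<longleftrightarrow> B \<subseteq> {0..r} \<and> T ` B \<subseteq> B"

lemma attractor_core: "A = core {0..r}"
  by (simp add: attractor_def core_def)

lemma invariant_box: "invariant_in_box {0..r}"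
  unfolding invariant_in_box_def using T_in_box by blast

lemma invariant_interval:
  assumes "a \<in> {0..r}" "b \<in> {0..r}" "a \<le> T a" "T b \<le> b"
  shows "invariant_in_box {a..b}"
proof -
  have box: "x \<in> {0..r}" if "x \<in> {a..b}" for x
    using that assms by (auto intro: order_trans)
  have "T x \<in> {a..b}" if "x \<in> {a..b}" for x
    using T_mono[OF assms(1) box[OF that]] T_mono[OF box[OF that] assms(2)] that assms(3,4)
    by (auto intro: order_trans)
  with box show ?thesis unfolding invariant_in_box_def by blast
qed

lemma g_T: "x \<in> {0..r} \<Longrightarrow> g (T x) = x"
  by (simp add: inverse_on_box_def inv_into_f_f[OF T_inj])

lemma core_subset: "core B \<subseteq> B"
  unfolding core_def by (rule INF_lower2[of 0]) auto

lemma invariant_funpow: "invariant_in_box B \<Longrightarrow> x \<in> B \<Longrightarrow> (T ^^ n) x \<in> B"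
  by (induction n) (auto simp: invariant_in_box_def)

text \<open>Each image \<open>T^(n+1) B\<close> supplies a preimage of \<open>x\<close> in
  \<open>T^n B\<close>; injectivity on the box makes all these preimages one point.\<close>

lemma core_step:
  assumes B: "invariant_in_box B" and x: "x \<in> core B"
  shows "g x \<in> core B" "T (g x) = x"
proof -
  have "x \<in> (T ^^ Suc 0) ` B" using x unfolding core_def by blast
  then obtain b where b: "b \<in> {0..r}" "x = T b" using B by (auto simp: invariant_in_box_def)
  then have gx: "g x = b" by (simp add: g_T)
  with b show "T (g x) = x" by simp
  have "b \<in> (T ^^ n) ` B" for n
  proof -
    have "x \<in> (T ^^ Suc n) ` B" using x unfolding core_def by blast
    then obtain w where w: "w \<in> B" "x = T ((T ^^ n) w)" by auto
    have "(T ^^ n) w \<in> {0..r}"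
      using invariant_funpow[OF B w(1)] B unfolding invariant_in_box_def by blast
    with w(2) gx have "b = (T ^^ n) w" by (simp add: g_T)
    with w(1) show ?thesis by blast
  qed
  then show "g x \<in> core B" unfolding core_def gx by blast
qed

lemma core_backward:
  assumes "invariant_in_box B" "x \<in> core B"
  shows "(g ^^ n) x \<in> core B"
  by (induction n) (use assms core_step(1) in auto)

lemma funpow_T_g:
  assumes x: "x \<in> A"
  shows "(T ^^ n) ((g ^^ n) x) = x"
proof (induction n)
  case (Suc n)
  have "(g ^^ n) x \<in> core {0..r}"
    using core_backward[OF invariant_box] x by (simp add: attractor_core)
  then have "T (g ((g ^^ n) x)) = (g ^^ n) x" by (rule core_step(2)[OF invariant_box])
  with Suc show ?case by (simp add: funpow_swap1)
qed simp

lemma T_funpow_g_Suc: "x \<in> A \<Longrightarrow> T ((g ^^ Suc n) x) = (g ^^ n) x"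
  using core_step(2)[OF invariant_box] core_backward[OF invariant_box] by (simp add: attractor_core)

lemma funpow_g_attractor: "x \<in> A \<Longrightarrow> (g ^^ n) x \<in> A"
  using core_backward[OF invariant_box] by (simp add: attractor_core)

lemma attractor_box: "x \<in> A \<Longrightarrow> x \<in> {0..r}"
  using core_subset unfolding attractor_core by blast

lemma funpow_g_box: "x \<in> A \<Longrightarrow> (g ^^ n) x \<in> {0..r}"
  by (rule attractor_box[OF funpow_g_attractor])

lemma core_iff:
  assumes B: "invariant_in_box B"
  shows "x \<in> core B \<longleftrightarrow> x \<in> A \<and> (\<forall>n. (g ^^ n) x \<in> B)"
proof
  assume x: "x \<in> core B"
  have "core B \<subseteq> A"
    using B unfolding attractor_core core_def invariant_in_box_def by (intro INF_mono) blast
  with x show "x \<in> A \<and> (\<forall>n. (g ^^ n) x \<in> B)"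
    using core_backward[OF B x] core_subset by blast
next
  assume "x \<in> A \<and> (\<forall>n. (g ^^ n) x \<in> B)"
  then have "x \<in> (T ^^ n) ` B" for n using funpow_T_g by (metis imageI)
  then show "x \<in> core B" unfolding core_def by blast
qed

lemma T_core:
  assumes B: "invariant_in_box B"
  shows "T ` core B = core B"
proof (intro equalityI subsetI)
  fix y assume "y \<in> T ` core B"
  then obtain x where x: "x \<in> core B" "y = T x" by blast
  have "y \<in> (T ^^ n) ` B" for n
  proof (cases n)
    case 0
    then show ?thesis using x core_subset[of B] B by (auto simp: invariant_in_box_def)
  next
    case (Suc m)
    have "x \<in> (T ^^ m) ` B" using x unfolding core_def by blast
    then show ?thesis using x(2) Suc by auto
  qed
  then show "y \<in> core B" unfolding core_def by blast
next
  fix x assume "x \<in> core B"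
  from core_step[OF B this] show "x \<in> T ` core B" by (metis imageI)
qed

lemma fixed_in_core:
  assumes B: "invariant_in_box B" and p: "p \<in> B" "T p = p"
  shows "p \<in> core B" "(g ^^ n) p = p"
proof -
  have "(T ^^ n) p = p" for n by (induction n) (use p in auto)
  then have "p \<in> (T ^^ n) ` B" for n by (intro image_eqI[OF _ p(1)]) simp
  then show "p \<in> core B" unfolding core_def by blast
  have "g p = p" using g_T[of p] p B by (auto simp: invariant_in_box_def)
  then show "(g ^^ n) p = p" by (induction n) auto
qed

lemma fixed_in_attractor: "p \<in> {0..r} \<Longrightarrow> T p = p \<Longrightarrow> p \<in> A \<and> (\<lambda>n. (g ^^ n) p) \<longlonglongrightarrow> p"
  using fixed_in_core[OF invariant_box] by (simp add: attractor_core)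

section \<open>Compactness, connectedness and attraction of cores\<close>

lemma core_image_compact:
  assumes B: "invariant_in_box B" and "compact B"
  shows "compact ((T ^^ n) ` B)"
proof (rule compact_continuous_image)
  show "continuous_on B (T ^^ n)"
    using B box_quadrant by (intro continuous_on_subset[OF funpow_T_continuous]) (auto simp: invariant_in_box_def)
qed fact

lemma core_image_nest:
  assumes B: "invariant_in_box B" and mn: "m \<le> n"
  shows "(T ^^ n) ` B \<subseteq> (T ^^ m) ` B"
proof
  fix y assume "y \<in> (T ^^ n) ` B"
  then obtain x where x: "x \<in> B" "y = (T ^^ (m + (n - m))) x" using mn by auto
  then have "y = (T ^^ m) ((T ^^ (n - m)) x)" by (simp add: funpow_add)
  then show "y \<in> (T ^^ m) ` B" using invariant_funpow[OF B x(1)] by blast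
qed

lemma core_compact: "invariant_in_box B \<Longrightarrow> compact B \<Longrightarrow> compact (core B)"
  using core_image_compact[of B] core_subset[of B] unfolding core_def
  by (auto simp: compact_eq_bounded_closed intro: bounded_subset)

lemma core_connected:
  assumes B: "invariant_in_box B" "compact B" "connected B"
  shows "connected (core B)"
  unfolding core_def
proof (rule connected_nest)
  show "connected ((T ^^ n) ` B)" for n
    using B box_quadrant
    by (intro connected_continuous_image continuous_on_subset[OF funpow_T_continuous])
      (auto simp: invariant_in_box_def)
qed (use B core_image_compact core_image_nest in auto)

text \<open>Otherwise the points of \<open>T^n B\<close> at distance at least \<open>e\<close> from
  the core form nested nonempty compact sets, and a common point of them would lie in the
  core.\<close>

lemma core_attracts:
  assumes B: "invariant_in_box B" "compact B" and e: "0 < e"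
  shows "\<exists>N. \<forall>n\<ge>N. \<forall>x\<in>B. infdist ((T ^^ n) x) (core B) < e"
proof (rule ccontr)
  assume "\<not> ?thesis"
  then have ne: "\<exists>n\<ge>N. \<exists>x\<in>B. e \<le> infdist ((T ^^ n) x) (core B)" for N
    by (meson not_le)
  define F where "F n = {y \<in> (T ^^ n) ` B. e \<le> infdist y (core B)}" for n
  have "compact (F n)" for n
  proof -
    have "closed {y. e \<le> infdist y (core B)}"
      by (intro closed_Collect_le continuous_intros)
    from compact_Int_closed[OF core_image_compact[OF B] this] show ?thesis
      by (simp add: F_def Int_def conj_commute)
  qed
  moreover have "F n \<noteq> {}" for n
  proof -
    obtain k x where k: "n \<le> k" "x \<in> B" "e \<le> infdist ((T ^^ k) x) (core B)" using ne by blast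
    then have "(T ^^ k) x \<in> (T ^^ n) ` B" using core_image_nest[OF B(1)] by blast
    with k show ?thesis unfolding F_def by blast
  qed
  moreover have "m \<le> n \<Longrightarrow> F n \<subseteq> F m" for m n
    using core_image_nest[OF B(1)] unfolding F_def by blast
  ultimately have "\<Inter> (range F) \<noteq> {}" by (rule compact_nest)
  then obtain y where y: "\<And>n. y \<in> F n" by blast
  then have "y \<in> core B" unfolding core_def F_def by blast
  moreover have "e \<le> infdist y (core B)" using y[of 0] by (simp add: F_def)
  ultimately show False using e by simp
qed

section \<open>Backward orbits in the attractor converge\<close>

lemma backward_leK:
  assumes x: "x \<in> A" and y: "y \<in> A" and xy: "leK i x y"
  shows "leK i ((g ^^ n) x) ((g ^^ n) y)"
proof (induction n)
  case (Suc n)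
  then show ?case
    using T_funpow_g_Suc[OF x, of n] T_funpow_g_Suc[OF y, of n]
    by (intro K_inverse[OF funpow_g_box[OF x] funpow_g_box[OF y]]) simp
qed (use xy in simp)

text \<open>The roles of the two orders are exchanged against the forward case: along a backward
  orbit K-relations persist for all later indices, while \<open>\<le>\<close> is inherited towards
  smaller ones.\<close>

lemma backward_convergent:
  assumes x: "x \<in> A"
  shows "\<exists>p\<in>{0..r}. T p = p \<and> (\<lambda>n. (g ^^ n) x) \<longlonglongrightarrow> p"
proof -
  define y where "y n = (g ^^ n) x" for n
  have yb: "y n \<in> {0..r}" for n using funpow_g_box[OF x] by (simp add: y_def)
  have yA: "y n \<in> A" for n using funpow_g_attractor[OF x] by (simp add: y_def)
  have Ty: "T (y (Suc n)) = y n" for n using T_funpow_g_Suc[OF x] by (simp add: y_def)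
  have yadd: "(g ^^ k) (y n) = y (k + n)" for k n by (simp add: y_def funpow_add)
  have "range y \<subseteq> {0..r}" using yb by (rule image_subsetI)
  then have bd: "bounded (range y)" by (rule bounded_subset[OF compact_imp_bounded[OF box_compact]])
  have "\<exists>n0. \<forall>i. (\<forall>n\<ge>n0. y n $ i \<le> y (Suc n) $ i) \<or> (\<forall>n\<ge>n0. y (Suc n) $ i \<le> y n $ i)"
  proof (cases "\<exists>n i. leK i (y n) (y (Suc n))")
    case True
    then obtain n0 i where n0: "leK i (y n0) (y (Suc n0))" by blast
    have K: "leK i (y n) (y (Suc n))" if "n0 \<le> n" for n
      using backward_leK[OF yA yA n0, of "n - n0"] that by (simp add: yadd)
    have "(\<forall>n\<ge>n0. y n $ k \<le> y (Suc n) $ k) \<or> (\<forall>n\<ge>n0. y (Suc n) $ k \<le> y n $ k)" for k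
      using K by (cases "k = i") (auto simp: leK_def)
    then show ?thesis by blast
  next
    case False
    then have nK: "\<not> leK 1 (y n) (y (Suc n))" "\<not> leK 2 (y n) (y (Suc n))" for n by auto
    have PQ: "y n \<le> y (Suc n) \<or> y (Suc n) \<le> y n" for n
      using nK[of n] by (auto simp: leK_iff[of 1 2] leK_iff[of 2 1] le_iff_2[of 1 2])
    have down: "y n \<le> y (Suc n)" if "y (Suc n) \<le> y (Suc (Suc n))" for n
      using T_mono[OF yb yb that] by (simp add: Ty)
    have "(\<forall>n. y n \<le> y (Suc n)) \<or> (\<exists>n0. \<forall>n\<ge>n0. y (Suc n) \<le> y n)"
      by (rule eventually_or_always[OF PQ down])
    then show ?thesis unfolding le_vec_iff by blast
  qed
  then obtain n0 where "\<And>i. (\<forall>n\<ge>n0. y n $ i \<le> y (Suc n) $ i) \<or> (\<forall>n\<ge>n0. y (Suc n) $ i \<le> y n $ i)"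
    by blast
  then have "monoseq (\<lambda>n. y (n + n0) $ i)" for i
    by (rule monoseq_from[where u = "\<lambda>n. y n $ i"])
  then obtain p where p: "y \<longlonglongrightarrow> p" using coordinatewise_monoseq_convergent[OF bd] by blast
  have "(\<lambda>n. T (y (Suc n))) \<longlonglongrightarrow> p" using p by (simp add: Ty)
  from fixed_limit[OF LIMSEQ_Suc[OF p] _ this] yb have "T p = p" by (blast intro: box_quadrant)
  moreover have "p \<in> {0..r}"
    using closed_sequentially[OF compact_imp_closed[OF box_compact] _ p] yb by blast
  ultimately show ?thesis using p by (auto simp: y_def[abs_def])
qed

lemma backward_limit_unique:
  assumes "(\<lambda>n. (g ^^ n) x) \<longlonglongrightarrow> p"
  shows "alpha_limit T r x = {p}"
  unfolding alpha_limit_def by (rule Inter_closure_tails_convergent[OF assms])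

end

section \<open>Repulsion from the origin\<close>

context typeK_system begin

lemma f_continuous: "continuous_on quadrant f"
  using f_differentiable
  by (auto intro!: differentiable_imp_continuous_on simp: differentiable_on_def)

lemma J_continuous: "continuous_on quadrant (\<lambda>x. J x $ i $ j)"
proof -
  have "continuous_on quadrant (\<lambda>x. (if i = j then f x $ i else 0) + x $ i * partial_deriv f i j x)"
    using f_C1 f_continuous unfolding C1_on_quadrant_def partial_deriv_def
    by (cases "i = j") (auto intro!: continuous_intros)
  then show ?thesis by (rule continuous_on_eq) (simp add: jacobian_T)
qed

lemma continuous_less_near:
  assumes "continuous_on quadrant h" "q \<in> quadrant" "h q < (c::real)"
  shows "\<exists>d>0. \<forall>z\<in>quadrant. dist z q < d \<longrightarrow> h z < c"
proof -
  obtain d where "0 < d" "\<forall>z\<in>quadrant. dist z q < d \<longrightarrow> dist (h z) (h q) < c - h q"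
    using assms unfolding continuous_on_iff by (metis diff_gt_0_iff_gt)
  then show ?thesis by (force simp: dist_real_def)
qed

lemma fixed_f: "p \<in> quadrant \<Longrightarrow> T p = p \<Longrightarrow> 0 < p $ i \<Longrightarrow> f p $ i = 1"
  using T_nth[of p i] by simp

lemma fixed_box:
  assumes "p \<in> quadrant" "T p = p"
  shows "p \<in> {0..r}"
proof -
  have "(T ^^ n) p = p" for n by (induction n) (use assms in auto)
  then show ?thesis using orbit_enters_box'[OF assms(1)] by simp
qed

text \<open>Here f_i equals 1, and the remaining term of the diagonal entry is negative.\<close>

lemma J_diag_fixed:
  assumes p: "p \<in> {0..r}" "T p = p" "0 < p $ i"
  shows "J p $ i $ i < 1"
proof -
  have "p $ i * partial_deriv f i i p < 0"
    using partial_deriv_diag[OF p(1)] p(3) by (rule mult_pos_neg[rotated])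
  then show ?thesis using fixed_f[OF box_quadrant[OF p(1)] p(2,3)]
    by (simp add: jacobian_T[OF box_quadrant[OF p(1)]])
qed

text \<open>Near a fixed point, the diagonal entries of the Jacobian are below 1, so along backward
  orbits in \<open>K\<close>-relation the distance of the \<open>i\<close>-th coordinates does not decrease.\<close>

lemma backward_contraction:
  assumes x: "x \<in> A" and y: "y \<in> A" and xy: "leK i x y"
    and q: "q \<in> {0..r}" "T q = q" "0 < q $ i"
    and lim: "(\<lambda>n. (g ^^ n) x) \<longlonglongrightarrow> q" "(\<lambda>n. (g ^^ n) y) \<longlonglongrightarrow> q"
  shows "x $ i = y $ i"
proof (rule ccontr)
  assume ne: "x $ i \<noteq> y $ i"
  obtain j where ij: "i \<noteq> j" using ex_neq_2 by blast
  define u v where "u n = (g ^^ n) x" and "v n = (g ^^ n) y" for n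
  have ub: "u n \<in> {0..r}" and vb: "v n \<in> {0..r}" for n
    using funpow_g_box x y by (simp_all add: u_def v_def)
  have Tu: "T (u (Suc n)) = u n" and Tv: "T (v (Suc n)) = v n" for n
    using T_funpow_g_Suc x y by (simp_all add: u_def v_def)
  have uv: "u n $ i \<le> v n $ i" "v n $ j \<le> u n $ j" for n
    using backward_leK[OF x y xy, of n] by (auto simp: u_def v_def leK_iff[OF ij])
  \<comment> \<open>The point with the i-th coordinate of \<open>u n\<close> and the j-th of
    \<open>v n\<close> lies below \<open>u n\<close>. Comparing \<open>v n\<close> with it needs
    only a segment in direction \<open>i\<close>, and by monotonicity the error has the favourable
    sign.\<close>
  have w_le: "upd (v n) i (u n $ i) \<in> {0..r}" "T (upd (v n) i (u n $ i)) $ i \<le> T (u n) $ i" for n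
  proof -
    show w: "upd (v n) i (u n $ i) \<in> {0..r}"
      using ub[of n] vb[of n] by (intro upd_in_interval) (auto simp: le_vec_iff)
    have "upd (v n) i (u n $ i) \<le> u n"
      using uv[of n] ij by (simp add: le_iff_2[OF ij])
    from T_mono[OF w ub this] show "T (upd (v n) i (u n $ i)) $ i \<le> T (u n) $ i"
      by (simp add: le_vec_iff)
  qed
  have pos: "u n $ i < v n $ i" for n
  proof (induction n)
    case 0
    then show ?case using ne uv(1)[of 0] by (simp add: u_def v_def)
  next
    case (Suc n)
    show ?case
    proof (rule ccontr)
      assume "\<not> u (Suc n) $ i < v (Suc n) $ i"
      with uv(1)[of "Suc n"] have "u (Suc n) $ i = v (Suc n) $ i" by simp
      with w_le(2)[of "Suc n"] Suc show False by (simp add: Tu Tv)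
    qed
  qed
  obtain d where d: "0 < d" "\<And>z. z \<in> quadrant \<Longrightarrow> dist z q < d \<Longrightarrow> J z $ i $ i < 1"
    using continuous_less_near[OF J_continuous box_quadrant[OF q(1)] J_diag_fixed[OF q]] by blast
  have "u \<longlonglongrightarrow> q" "v \<longlonglongrightarrow> q" using lim by (simp_all add: u_def[abs_def] v_def[abs_def])
  \<comment> \<open>Half the radius for each of the two coordinates of the intermediate point
    \<open>upd ?v i c\<close>.\<close>
  then have "\<forall>\<^sub>F n in sequentially. dist (u n) q < d / 2 \<and> dist (v n) q < d / 2"
    using d(1) by (intro eventually_conj tendstoD) auto
  then obtain N where N: "\<And>n. N \<le> n \<Longrightarrow> dist (u n) q < d / 2 \<and> dist (v n) q < d / 2"
    by (auto simp: eventually_sequentially)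
  have step: "v n $ i - u n $ i \<le> v (Suc n) $ i - u (Suc n) $ i" if n: "N \<le> n" for n
  proof -
    let ?u = "u (Suc n)" and ?v = "v (Suc n)"
    have nn: "0 \<le> ?u $ i" using ub[of "Suc n"] by (simp add: le_vec_iff)
    obtain c where c: "?u $ i < c" "c < ?v $ i"
      "T (upd ?v i (?v $ i)) $ i - T (upd ?v i (?u $ i)) $ i = (?v $ i - ?u $ i) * J (upd ?v i c) $ i $ i"
      using coordinate_mvt[OF T_differentiable box_quadrant[OF vb] nn pos] by blast
    have cq: "upd ?v i c \<in> quadrant"
      using vb[of "Suc n"] c nn by (auto simp: quadrant_def le_vec_iff)
    have "dist (upd ?v i c) q \<le> \<bar>c - q $ i\<bar> + \<bar>?v $ j - q $ j\<bar>"
      using norm_le_2[OF ij, of "upd ?v i c - q"] ij by (simp add: dist_norm)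
    also have "\<bar>?v $ j - q $ j\<bar> < d / 2"
      using N[of "Suc n"] n component_le_norm_cart[of "?v - q" j] by (simp add: dist_norm)
    also have "\<bar>c - q $ i\<bar> < d / 2"
      using N[of "Suc n"] n c component_le_norm_cart[of "?v - q" i] component_le_norm_cart[of "?u - q" i]
      unfolding dist_norm vector_minus_component by linarith
    finally have "dist (upd ?v i c) q < d" by simp
    then have "(?v $ i - ?u $ i) * J (upd ?v i c) $ i $ i \<le> (?v $ i - ?u $ i) * 1"
      using d(2)[OF cq] pos[of "Suc n"] by (intro mult_left_mono) auto
    with c(3) w_le(2)[of "Suc n"] show ?thesis by (simp add: Tu Tv)
  qed
  have "v N $ i - u N $ i \<le> v n $ i - u n $ i" if "N \<le> n" for n
    using that by (induction rule: dec_induct) (use step in \<open>force+\<close>)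
  moreover have "(\<lambda>n. v n $ i - u n $ i) \<longlonglongrightarrow> q $ i - q $ i"
    using \<open>u \<longlonglongrightarrow> q\<close> \<open>v \<longlonglongrightarrow> q\<close> by (intro tendsto_intros)
  ultimately have "v N $ i - u N $ i \<le> 0"
    using tendsto_lowerbound[of "\<lambda>n. v n $ i - u n $ i" 0 sequentially "v N $ i - u N $ i"]
    by (auto simp: eventually_sequentially)
  then show False using pos[of N] by simp
qed

section \<open>The origin as a repeller\<close>

definition near_zero :: "real \<Rightarrow> real \<Rightarrow> bool"
  where "near_zero \<delta> c \<longleftrightarrow> 0 < \<delta> \<and> 1 < c \<and> (\<forall>i. \<delta> < r $ i) \<and>
    (\<forall>x\<in>quadrant. (\<forall>i. x $ i \<le> \<delta>) \<longrightarrow> (\<forall>i. c \<le> f x $ i))"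

text \<open>On a small square at the origin both growth factors exceed a common constant above 1, by
  continuity of \<open>f\<close>.\<close>

lemma near_zero_exists: "\<exists>\<delta> c. near_zero \<delta> c"
proof -
  \<comment> \<open>The midpoint between 1 and the smaller of the two growth factors at 0.\<close>
  define c where "c = (1 + min (f 0 $ 1) (f 0 $ 2)) / 2"
  have c1: "1 < c" using f_zero by (auto simp: c_def)
  have "c < f 0 $ i" for i
    using exhaust_2[of i] f_zero[of 1] f_zero[of 2] by (auto simp: c_def min_def field_simps)
  moreover have 0: "0 \<in> quadrant" by (simp add: quadrant_def)
  ultimately have "\<exists>d>0. \<forall>z\<in>quadrant. dist z 0 < d \<longrightarrow> - f z $ i < - c" for i
    by (intro continuous_less_near continuous_intros f_continuous) auto
  then obtain D where D: "\<And>i. 0 < D i" "\<And>i z. z \<in> quadrant \<Longrightarrow> dist z 0 < D i \<Longrightarrow> - f z $ i < - c"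
    by metis
  define d where "d = Min {D 1, D 2, r $ 1, r $ 2}"
  have "0 < r $ i" for i using r_pos by (simp add: sless_iff)
  then have dpos: "0 < d" using D(1) by (simp add: d_def)
  have dD: "d \<le> D i" "d \<le> r $ i" for i using exhaust_2[of i] by (auto simp: d_def)
  \<comment> \<open>A point of the square has 1-norm at most \<open>2 * d / 3\<close>, hence
    distance less than \<open>d\<close> from 0.\<close>
  have "c \<le> f x $ i" if x: "x \<in> quadrant" "\<forall>i. x $ i \<le> d / 3" for x i
  proof -
    have "dist x 0 \<le> \<bar>x $ 1\<bar> + \<bar>x $ 2\<bar>" using norm_le_2[of 1 2 x] by simp
    also have "\<dots> \<le> d / 3 + d / 3" using x by (intro add_mono) (auto simp: quadrant_def)
    also have "\<dots> < D i" using dpos dD(1)[of i] by simp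
    finally show ?thesis using D(2)[OF x(1)] by force
  qed
  moreover have "d / 3 < r $ i" for i using dpos dD(2)[of i] by simp
  ultimately have "near_zero (d / 3) c"
    using dpos c1 by (simp add: near_zero_def)
  then show ?thesis by blast
qed

lemma axis_point_box: "0 \<le> t \<Longrightarrow> t \<le> r $ i \<Longrightarrow> upd 0 i t \<in> {0..r}"
  using r_nonneg by (intro upd_in_interval) auto

definition away :: "real \<Rightarrow> (real^2) set"
  where "away \<delta> = {x \<in> {0..r}. \<exists>i. \<delta> \<le> x $ i}"

text \<open>Only one coordinate of \<open>x\<close> is known to be large. By monotonicity
  \<open>x\<close> may be replaced by the point of the i-th axis at height \<delta>, which lies in
  the square where f_i is at least \<open>c\<close>.\<close>

lemma away_step:
  assumes nz: "near_zero \<delta> c" and x: "x \<in> {0..r}" and i: "\<delta> \<le> x $ i"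
  shows "\<delta> < T x $ i"
proof -
  let ?u = "upd 0 i \<delta>"
  have d: "0 < \<delta>" "1 < c" "\<delta> < r $ i" using nz by (auto simp: near_zero_def)
  then have u: "?u \<in> {0..r}" by (intro axis_point_box) auto
  have "\<forall>k. ?u $ k \<le> \<delta>" using d by simp
  then have "c \<le> f ?u $ i" using nz box_quadrant[OF u] unfolding near_zero_def by blast
  then have "\<delta> * c \<le> T ?u $ i" using d by (simp add: T_nth[OF box_quadrant[OF u]])
  moreover have "?u \<le> x" using x i by (simp add: le_vec_iff)
  then have "T ?u $ i \<le> T x $ i" using T_mono[OF u x] by (simp add: le_vec_iff)
  moreover have "\<delta> < \<delta> * c" using d by simp
  ultimately show ?thesis by simp
qed

lemma away_invariant: "near_zero \<delta> c \<Longrightarrow> invariant_in_box (away \<delta>)"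
  using away_step T_in_box less_imp_le unfolding invariant_in_box_def away_def by blast

lemma away_compact: "compact (away \<delta>)"
proof -
  have eq: "away \<delta> = {0..r} \<inter> ({x. \<delta> \<le> x $ 1} \<union> {x. \<delta> \<le> x $ 2})"
    by (auto simp: away_def) (metis exhaust_2)
  show ?thesis
    unfolding eq
    by (intro compact_Int_closed box_compact closed_Un closed_halfspace_component_ge_cart)
qed

lemma T_eq_0_iff: "x \<in> quadrant \<Longrightarrow> T x $ i = 0 \<longleftrightarrow> x $ i = 0"
  using f_pos[of x i] by (simp add: T_nth)

lemma funpow_T_eq_0_iff: "x \<in> quadrant \<Longrightarrow> (T ^^ n) x $ i = 0 \<longleftrightarrow> x $ i = 0"
  by (induction n) (auto simp: T_eq_0_iff funpow_T_quadrant)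

lemma funpow_T_pos_iff: "x \<in> quadrant \<Longrightarrow> 0 < (T ^^ n) x $ i \<longleftrightarrow> 0 < x $ i"
  using funpow_T_eq_0_iff[of x n i] funpow_T_quadrant[of x n]
  by (auto simp: quadrant_def less_le)

lemma T_eq_0D: "x \<in> quadrant \<Longrightarrow> T x = 0 \<Longrightarrow> x = 0"
  using T_eq_0_iff[of x] by (simp add: Finite_Cartesian_Product.vec_eq_iff)

text \<open>Lowering the other coordinate to 0 does not increase f_i. For a small
  \<open>p $ i\<close> the resulting axis point lies in the square, so f_i is at least c > 1 at
  \<open>p\<close>, where it has to be 1.\<close>

lemma fixed_coordinate_gt:
  assumes nz: "near_zero \<delta> c" and p: "p \<in> {0..r}" "T p = p" "0 < p $ i"
  shows "\<delta> < p $ i"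
proof (rule ccontr)
  assume "\<not> \<delta> < p $ i"
  moreover have "p $ i \<le> r $ i" using p by (simp add: le_vec_iff)
  ultimately have u: "upd 0 i (p $ i) \<in> {0..r}" "\<forall>k. upd 0 i (p $ i) $ k \<le> \<delta>"
    using p(3) nz axis_point_box[of "p $ i" i] by (simp_all add: near_zero_def)
  then have "c \<le> f (upd 0 i (p $ i)) $ i"
    using nz box_quadrant unfolding near_zero_def by blast
  also obtain j where ij: "i \<noteq> j" using ex_neq_2 by blast
  have "f (upd 0 i (p $ i)) $ i \<le> f p $ i"
  proof -
    have "upd p j 0 = upd 0 i (p $ i)" using ij by (simp add: vec_eq_iff_2[OF ij])
    then show ?thesis
      using f_upd_mono[OF p(1), of 0 "p $ j" j i] p(1) ij by (simp add: le_vec_iff)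
  qed
  finally show False using fixed_f[OF box_quadrant[OF p(1)] p(2,3)] nz by (simp add: near_zero_def)
qed

text \<open>A positive coordinate grows at least like \<open>c ^ n\<close> while the orbit stays in
  the square, so the orbit leaves it. One more step makes both conclusions strict, hence open, as
  the compactness argument requires.\<close>

lemma enters_away:
  assumes nz: "near_zero \<delta> c" and x: "x \<in> quadrant" "x \<noteq> 0"
  shows "\<exists>n. (T ^^ n) x \<lless> r \<and> (\<exists>i. \<delta> < (T ^^ n) x $ i)"
proof -
  obtain m where m: "(T ^^ m) x \<in> {0..r}" using orbit_enters_box'[OF x(1)] by blast
  obtain i where "x $ i \<noteq> 0" using x(2) by (auto simp: Finite_Cartesian_Product.vec_eq_iff)
  define z where "z n = (T ^^ n) ((T ^^ m) x)" for n
  have z0: "0 < z n $ i" for n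
    using \<open>x $ i \<noteq> 0\<close> x(1) funpow_T_pos_iff[OF funpow_T_quadrant] funpow_T_pos_iff
    by (auto simp: z_def quadrant_def less_le)
  have zb: "z n \<in> {0..r}" for n using funpow_T_box[OF m] by (simp add: z_def)
  have zS: "z (Suc n) = T (z n)" for n by (simp add: z_def)
  have "\<exists>n k. \<delta> \<le> z n $ k"
  proof (rule ccontr)
    assume *: "\<not> ?thesis"
    have "z 0 $ i * c ^ n \<le> z n $ i" for n
    proof (induction n)
      case (Suc n)
      have "c \<le> f (z n) $ i"
        using * nz box_quadrant[OF zb] unfolding near_zero_def by (meson less_imp_le not_le)
      with Suc have "z 0 $ i * c ^ n * c \<le> z n $ i * f (z n) $ i"
        using z0[of n] z0[of 0] nz by (intro mult_mono) (auto simp: near_zero_def)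
      then show ?case by (simp add: zS T_nth box_quadrant[OF zb] mult_ac)
    qed simp
    then have "c ^ n \<le> \<delta> / z 0 $ i" for n
      using *[unfolded not_ex not_le, rule_format, of n i] z0[of 0]
      by (simp add: field_simps) (meson less_imp_le order_trans)
    moreover obtain n where "\<delta> / z 0 $ i < c ^ n"
      using real_arch_pow[of c] nz unfolding near_zero_def by blast
    ultimately show False by (meson not_le)
  qed
  then obtain n k where "\<delta> \<le> z n $ k" by blast
  then have "\<delta> < z (Suc n) $ k" unfolding zS using away_step[OF nz zb] by blast
  moreover have "z (Suc n) \<lless> r" using T_less_r[OF zb] by (simp add: sless_iff zS)
  moreover have "z (Suc n) = (T ^^ (Suc n + m)) x" by (simp add: z_def funpow_add)
  ultimately show ?thesis by metis
qed

text \<open>Start points that enter ever later would accumulate at some \<open>l\<close> in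
  \<open>S\<close>. The entry of \<open>l\<close> is an open condition, so nearby start points enter
  at the same time, and invariance keeps them inside.\<close>

lemma compact_enters_away:
  assumes nz: "near_zero \<delta> c" and S: "compact S" "S \<subseteq> quadrant - {0}"
  shows "\<exists>N. \<forall>n\<ge>N. \<forall>x\<in>S. (T ^^ n) x \<in> away \<delta>"
proof (rule ccontr)
  assume "\<not> ?thesis"
  then have ne: "\<exists>n\<ge>N. \<exists>x\<in>S. (T ^^ n) x \<notin> away \<delta>" for N by blast
  have stay: "(T ^^ n) x \<in> away \<delta>" if "(T ^^ m) x \<in> away \<delta>" "m \<le> n" for m n x
  proof -
    have "(T ^^ n) x = (T ^^ (n - m)) ((T ^^ m) x)"
      using that(2) by (metis funpow_add le_add_diff_inverse2 o_apply)
    then show ?thesis using invariant_funpow[OF away_invariant[OF nz] that(1)] by simp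
  qed
  with ne have "\<exists>x\<in>S. (T ^^ N) x \<notin> away \<delta>" for N by blast
  then obtain s where s: "\<And>N. s N \<in> S" "\<And>N. (T ^^ N) (s N) \<notin> away \<delta>" by metis
  obtain l k where k: "l \<in> S" "strict_mono k" "(s \<circ> k) \<longlonglongrightarrow> l"
    using S(1) s(1) unfolding compact_def by meson
  have lq: "l \<in> quadrant" "l \<noteq> 0" using k(1) S(2) by auto
  obtain m i where m: "(T ^^ m) l \<lless> r" "\<delta> < (T ^^ m) l $ i" using enters_away[OF nz lq] by blast
  have sq: "(s \<circ> k) n \<in> quadrant" for n using s(1) S(2) by auto
  have lim: "(\<lambda>n. (T ^^ m) ((s \<circ> k) n)) \<longlonglongrightarrow> (T ^^ m) l"
    using continuous_on_tendsto_compose[OF funpow_T_continuous k(3) lq(1)] sq by simp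
  have "\<forall>\<^sub>F n in sequentially. (T ^^ m) ((s \<circ> k) n) \<lless> r \<and> \<delta> < (T ^^ m) ((s \<circ> k) n) $ i \<and> m \<le> n"
    using sless_eventually[OF lim m(1)] order_tendstoD(1)[OF tendsto_vec_nth[OF lim] m(2)]
      eventually_ge_at_top by (intro eventually_conj)
  then obtain n where n: "(T ^^ m) ((s \<circ> k) n) \<lless> r" "\<delta> < (T ^^ m) ((s \<circ> k) n) $ i" "m \<le> n"
    by (auto simp: eventually_sequentially)
  have "(T ^^ m) (s (k n)) \<in> away \<delta>"
    using n(1,2) funpow_T_quadrant[OF sq, of m n]
    by (auto simp: away_def sless_imp_le quadrant_iff intro!: exI[of _ i])
  then have "(T ^^ k n) (s (k n)) \<in> away \<delta>"
    using stay seq_suble[OF k(2), of n] n(3) by (meson order_trans)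
  with s(2) show False by blast
qed

text \<open>A backward orbit in \<open>away \<delta>\<close> cannot tend to 0. Conversely a nonzero
  backward limit is a fixed point with a coordinate above \<delta>, so late backward points lie in
  \<open>away \<delta>\<close>, and forward invariance brings in the earlier ones.\<close>

lemma Sigma_core:
  assumes nz: "near_zero \<delta> c"
  shows "Sigma_set T r = core (away \<delta>)"
proof (intro equalityI subsetI)
  fix x assume x: "x \<in> core (away \<delta>)"
  have xA: "x \<in> A" and xg: "(g ^^ n) x \<in> away \<delta>" for n
    using x core_iff[OF away_invariant[OF nz]] by auto
  have "\<not> (\<lambda>n. (g ^^ n) x) \<longlonglongrightarrow> 0"
  proof
    assume "(\<lambda>n. (g ^^ n) x) \<longlonglongrightarrow> 0"
    then have "0 \<in> away \<delta>"
      by (rule closed_sequentially[OF compact_imp_closed[OF away_compact], rotated]) (rule xg)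
    then show False using nz by (auto simp: away_def near_zero_def)
  qed
  with xA show "x \<in> Sigma_set T r" by (simp add: Sigma_set_def repulsion_zero_def)
next
  fix x assume x: "x \<in> Sigma_set T r"
  then have xA: "x \<in> A" and nr: "x \<notin> repulsion_zero T r" by (auto simp: Sigma_set_def)
  obtain p where p: "p \<in> {0..r}" "T p = p" "(\<lambda>n. (g ^^ n) x) \<longlonglongrightarrow> p"
    using backward_convergent[OF xA] by blast
  have "(g ^^ n) x \<in> T ` {0..r}" for n
    using T_funpow_g_Suc[OF xA, of n] funpow_g_box[OF xA, of "Suc n"] by (metis imageI)
  with nr xA have "\<not> (\<lambda>n. (g ^^ n) x) \<longlonglongrightarrow> 0"
    using box_quadrant attractor_box unfolding repulsion_zero_def by blast
  with p have "p \<noteq> 0" by metis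
  then obtain i where "p $ i \<noteq> 0" by (auto simp: Finite_Cartesian_Product.vec_eq_iff)
  then have i: "\<delta> < p $ i" using fixed_coordinate_gt[OF nz p(1,2)] p(1) by (auto simp: le_vec_iff less_le)
  have "(g ^^ n) x \<in> away \<delta>" for n
  proof -
    have "\<forall>\<^sub>F m in sequentially. \<delta> < (g ^^ m) x $ i \<and> n \<le> m"
      using order_tendstoD(1)[OF tendsto_vec_nth[OF p(3)] i] eventually_ge_at_top
      by (intro eventually_conj)
    then obtain m where m: "\<delta> < (g ^^ m) x $ i" "n \<le> m" by (auto simp: eventually_sequentially)
    then have "(g ^^ m) x \<in> away \<delta>"
      using funpow_g_box[OF xA, of m] by (auto simp: away_def intro!: exI[of _ i])
    then have "(T ^^ (m - n)) ((g ^^ (m - n)) ((g ^^ n) x)) \<in> away \<delta>"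
      using invariant_funpow[OF away_invariant[OF nz]] m(2)
      by (metis funpow_add le_add_diff_inverse2 o_apply)
    then show ?thesis using funpow_T_g[OF funpow_g_attractor[OF xA]] by simp
  qed
  with xA show "x \<in> core (away \<delta>)" using core_iff[OF away_invariant[OF nz]] by blast
qed

end

section \<open>Fixed points on the axes\<close>

lemma pos_axis_iff: "x \<in> pos_axis i \<longleftrightarrow> 0 < x $ i \<and> x = upd 0 i (x $ i)"
  by (auto simp: pos_axis_def Finite_Cartesian_Product.vec_eq_iff)

lemma pos_axis_iff_2: "i \<noteq> j \<Longrightarrow> x \<in> pos_axis i \<longleftrightarrow> 0 < x $ i \<and> x $ j = 0"
  by (auto simp: pos_axis_iff vec_eq_iff_2)

lemma limit_coordinate_zero:
  fixes l :: "real^2"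
  assumes "s \<longlonglongrightarrow> l" "\<And>n. s n $ i = 0"
  shows "l $ i = 0"
  using tendsto_vec_nth[OF assms(1), of i] assms(2) by (simp add: LIMSEQ_const_iff)

context typeK_system begin

lemma f_axis_strict:
  "0 \<le> a \<Longrightarrow> a < b \<Longrightarrow> b \<le> r $ i \<Longrightarrow> f (upd 0 i b) $ i < f (upd 0 i a) $ i"
  using f_upd_strict[of 0] r_nonneg by simp

text \<open>Along the axis f_i decreases strictly, from above 1 at 0 to below 1 at
  \<open>r $ i\<close>, because the box is mapped strictly below \<open>r\<close>.\<close>

lemma axis_fixed_point:
  "\<exists>!q. q \<in> pos_axis i \<and> T q = q"
proof -
  obtain j where ij: "i \<noteq> j" using ex_neq_2 by blast
  have ri: "0 < r $ i" using r_pos by (simp add: sless_iff)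
  have u0: "upd 0 i 0 = 0" by (simp add: Finite_Cartesian_Product.vec_eq_iff)
  have "continuous_on {0..r $ i} (\<lambda>t. upd 0 i 0 + t *\<^sub>R axis i 1)"
    by (intro continuous_intros)
  then have "continuous_on {0..r $ i} (upd 0 i)" by (simp flip: upd_eq_add_axis)
  then have "continuous_on {0..r $ i} (\<lambda>t. f (upd 0 i t))"
    by (rule continuous_on_compose2[OF f_continuous]) (auto intro!: box_quadrant[OF axis_point_box])
  then have c: "continuous_on {0..r $ i} (\<lambda>t. f (upd 0 i t) $ i)" by (intro continuous_intros)
  have b: "upd 0 i (r $ i) \<in> {0..r}" using ri by (intro axis_point_box) auto
  have "f (upd 0 i (r $ i)) $ i < 1"
    using T_less_r[OF b, of i] ri by (simp add: T_nth[OF box_quadrant[OF b]])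
  then obtain t where t: "0 \<le> t" "t \<le> r $ i" "f (upd 0 i t) $ i = 1"
    using IVT2'[of "\<lambda>t. f (upd 0 i t) $ i" "r $ i" 1 0] c f_zero[of i] ri by (auto simp: u0)
  have "t \<noteq> 0" using t f_zero[of i] by (auto simp: u0)
  with t have tp: "0 < t" by simp
  have tq: "upd 0 i t \<in> quadrant" using axis_point_box[OF t(1,2)] by (rule box_quadrant)
  have "T (upd 0 i t) = upd 0 i t"
    using t(3) ij by (simp add: vec_eq_iff_2[OF ij] T_nth[OF tq])
  then have ex: "upd 0 i t \<in> pos_axis i \<and> T (upd 0 i t) = upd 0 i t"
    using tp by (simp add: pos_axis_iff)
  moreover have "q = upd 0 i t" if q: "q \<in> pos_axis i \<and> T q = q" for q
  proof -
    have qa: "0 < q $ i" "q = upd 0 i (q $ i)" using q by (auto simp: pos_axis_iff)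
    have "q \<in> quadrant" using q by (auto simp: pos_axis_def quadrant_def) (metis less_imp_le order_refl)
    with q have qb: "q \<in> {0..r}" using fixed_box by blast
    have "f q $ i = 1" using fixed_f[OF box_quadrant[OF qb] _ qa(1)] q by simp
    then have f1: "f (upd 0 i (q $ i)) $ i = 1" using qa(2) by simp
    have "q $ i \<le> r $ i" using qb by (simp add: le_vec_iff)
    then have "q $ i = t"
      using f_axis_strict[of "q $ i" t i] f_axis_strict[of t "q $ i" i] f1 t qa(1)
      by (cases "q $ i" t rule: linorder_cases) auto
    with qa(2) show ?thesis by simp
  qed
  ultimately show ?thesis by blast
qed

definition Q :: "2 \<Rightarrow> real^2"
  where "Q i = (THE q. q \<in> pos_axis i \<and> T q = q)"

lemma Q_props: "Q i \<in> pos_axis i" "T (Q i) = Q i"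
  using theI'[OF axis_fixed_point[of i]] by (auto simp: Q_def)

lemma Q_unique: "q \<in> pos_axis i \<Longrightarrow> T q = q \<Longrightarrow> q = Q i"
  using axis_fixed_point[of i] Q_props[of i] by blast

lemma Q_pos: "0 < Q i $ i"
  using Q_props(1) by (simp add: pos_axis_iff)

lemma Q_zero: "i \<noteq> j \<Longrightarrow> Q i $ j = 0"
  using Q_props(1)[of i] by (simp add: pos_axis_def)

lemma pos_axis_quadrant: "x \<in> pos_axis i \<Longrightarrow> x \<in> quadrant"
  by (auto simp: pos_axis_def quadrant_def) (metis less_imp_le order_refl)

lemma Q_box: "Q i \<in> {0..r}"
  using fixed_box[OF pos_axis_quadrant] Q_props by blast

lemma fixed_cases:
  assumes "p \<in> quadrant" "T p = p"
  obtains "p = 0" | i where "p = Q i" | "p \<in> open_quadrant"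
proof -
  have nn: "0 \<le> p $ k" for k using assms by (simp add: quadrant_def)
  consider "p $ 1 = 0" "p $ 2 = 0" | "0 < p $ 1" "p $ 2 = 0" | "p $ 1 = 0" "0 < p $ 2"
    | "0 < p $ 1" "0 < p $ 2" using nn[of 1] nn[of 2] by linarith
  then show ?thesis
  proof cases
    case 1 then show ?thesis using that(1) by (simp add: vec_eq_iff_2[of 1 2])
  next
    case 2 then show ?thesis using that(2) Q_unique[of p 1] assms(2) by (simp add: pos_axis_iff_2[of 1 2])
  next
    case 3 then show ?thesis using that(2) Q_unique[of p 2] assms(2) by (simp add: pos_axis_iff_2[of 2 1])
  next
    case 4 then show ?thesis using that(3) by (simp add: open_quadrant_def forall_2)
  qed
qed

text \<open>Moving along axis \<open>i\<close> does not lower f_j, which exceeds 1 at 0. This value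
  is the eigenvalue at \<open>Q i\<close> transversal to the axis.\<close>

lemma f_Q_transversal:
  assumes ij: "i \<noteq> j"
  shows "1 < f (Q i) $ j"
proof -
  have u0: "upd 0 i 0 = 0" by (simp add: Finite_Cartesian_Product.vec_eq_iff)
  have Qu: "upd 0 i (Q i $ i) = Q i" using Q_props(1)[of i] by (simp add: pos_axis_iff)
  have "f (upd 0 i 0) $ j \<le> f (upd 0 i (Q i $ i)) $ j"
    using Q_box[of i] Q_pos[of i] r_nonneg ij by (intro f_upd_mono) (auto simp: le_vec_iff)
  then show ?thesis using f_zero[of j] by (simp add: u0 Qu)
qed

text \<open>At \<open>Q i\<close> the Jacobian is triangular, since row \<open>j\<close> carries the
  factor \<open>Q i $ j = 0\<close>; its diagonal entries are the eigenvalues.\<close>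

lemma Q_saddle: "saddle_point T (Q i)"
proof -
  obtain j where ij: "i \<noteq> j" using ex_neq_2 by blast
  note q = box_quadrant[OF Q_box[of i]]
  have ii: "0 < J (Q i) $ i $ i" "J (Q i) $ i $ i < 1"
    using J_diag[OF Q_box] J_diag_fixed[OF Q_box Q_props(2) Q_pos] by auto
  have jj: "J (Q i) $ j $ j = f (Q i) $ j" and ji: "J (Q i) $ j $ i = 0"
    using ij Q_zero[OF ij] by (auto simp: jacobian_T[OF q])
  have "J (Q i) $ 1 $ 2 * J (Q i) $ 2 $ 1 = 0"
    using ji ij exhaust_2[of i] exhaust_2[of j] by auto
  then have "eigenvalue (complex_matrix (J (Q i))) (of_real (J (Q i) $ k $ k))" for k
    unfolding eigenvalue_complex_matrix_iff using exhaust_2[of k] by auto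
  then have "eigenvalue (complex_matrix (J (Q i))) (of_real (J (Q i) $ i $ i))"
    "eigenvalue (complex_matrix (J (Q i))) (of_real (J (Q i) $ j $ j))" by blast+
  moreover have "cmod (of_real (J (Q i) $ i $ i)) < 1" using ii by simp
  moreover have "1 < cmod (of_real (J (Q i) $ j $ j))" using f_Q_transversal[OF ij] by (simp add: jj)
  ultimately show ?thesis unfolding saddle_point_def using Q_props(2) by blast
qed

lemma forward_limit_nonzero:
  assumes x: "x \<in> quadrant" "x \<noteq> 0" and lim: "(\<lambda>n. (T ^^ n) x) \<longlonglongrightarrow> p"
  shows "p \<noteq> 0"
proof -
  obtain \<delta> c where nz: "near_zero \<delta> c" using near_zero_exists by blast
  obtain N where N: "\<And>n. N \<le> n \<Longrightarrow> (T ^^ n) x \<in> away \<delta>"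
    using compact_enters_away[OF nz, of "{x}"] x by auto
  have "(\<lambda>n. (T ^^ (n + N)) x) \<longlonglongrightarrow> p" using lim by (rule LIMSEQ_ignore_initial_segment)
  then have "p \<in> away \<delta>"
    by (rule closed_sequentially[OF compact_imp_closed[OF away_compact], rotated]) (simp add: N)
  then show ?thesis using nz by (auto simp: away_def near_zero_def)
qed

text \<open>Near \<open>Q i\<close> a positive j-th coordinate is multiplied by factors above 1 and
  cannot tend to 0. On the axis, the forward limit is a nonzero fixed point of the axis.\<close>

lemma stable_manifold_Q: "stable_manifold T (Q i) = pos_axis i"
proof (intro equalityI subsetI)
  obtain j where ij: "i \<noteq> j" using ex_neq_2 by blast
  fix x assume "x \<in> stable_manifold T (Q i)"
  then have x: "x \<in> quadrant" and lim: "(\<lambda>n. (T ^^ n) x) \<longlonglongrightarrow> Q i"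
    by (auto simp: stable_manifold_def)
  have nn: "0 \<le> x $ k" for k using x by (simp add: quadrant_def)
  have "x $ i \<noteq> 0"
  proof
    assume "x $ i = 0"
    then have "(T ^^ n) x $ i = 0" for n using funpow_T_eq_0_iff[OF x] by simp
    from limit_coordinate_zero[OF lim this] show False using Q_pos[of i] by simp
  qed
  moreover have "x $ j = 0"
  proof (rule ccontr)
    assume "x $ j \<noteq> 0"
    then have "0 < x $ j" using nn[of j] by simp
    then have pos: "0 < (T ^^ n) x $ j" for n using funpow_T_pos_iff[OF x] by simp
    have "(\<lambda>n. f ((T ^^ n) x) $ j) \<longlonglongrightarrow> f (Q i) $ j"
      using continuous_on_tendsto_compose[OF f_continuous lim box_quadrant[OF Q_box]]
        funpow_T_quadrant[OF x] by (intro tendsto_vec_nth) simp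
    from order_tendstoD(1)[OF this f_Q_transversal[OF ij]]
    obtain N where N: "\<And>n. N \<le> n \<Longrightarrow> 1 < f ((T ^^ n) x) $ j" by (auto simp: eventually_sequentially)
    have "(T ^^ N) x $ j \<le> (T ^^ n) x $ j" if "N \<le> n" for n
      using that
    proof (induction rule: dec_induct)
      case (step n)
      have "(T ^^ n) x $ j * 1 \<le> (T ^^ n) x $ j * f ((T ^^ n) x) $ j"
        using N[of n] step pos[of n] by (intro mult_left_mono) auto
      with step show ?case by (simp add: T_nth[OF funpow_T_quadrant[OF x]])
    qed simp
    then have "(T ^^ N) x $ j \<le> Q i $ j"
      by (intro tendsto_lowerbound[OF tendsto_vec_nth[OF lim, of j]])
        (auto simp: eventually_sequentially)
    then show False using pos[of N] Q_zero[OF ij] by simp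
  qed
  ultimately show "x \<in> pos_axis i" using nn[of i] by (simp add: pos_axis_iff_2[OF ij])
next
  obtain j where ij: "i \<noteq> j" using ex_neq_2 by blast
  fix x assume xa: "x \<in> pos_axis i"
  then have x: "x \<in> quadrant" by (rule pos_axis_quadrant)
  have x0: "x \<noteq> 0" using xa by (auto simp: pos_axis_def)
  obtain p where p: "p \<in> {0..r}" "T p = p" "(\<lambda>n. (T ^^ n) x) \<longlonglongrightarrow> p"
    using forward_convergent[OF x] by blast
  have "(T ^^ n) x $ j = 0" for n
    using funpow_T_eq_0_iff[OF x] xa by (simp add: pos_axis_iff_2[OF ij])
  then have "p $ j = 0" by (rule limit_coordinate_zero[OF p(3)])
  moreover have "p \<noteq> 0" using forward_limit_nonzero[OF x x0 p(3)] .
  ultimately have "p \<in> pos_axis i"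
    using p(1) by (auto simp: pos_axis_iff_2[OF ij] le_vec_iff less_le vec_eq_iff_2[OF ij])
  then have "p = Q i" using p(2) Q_unique by blast
  with p x show "x \<in> stable_manifold T (Q i)" by (simp add: stable_manifold_def)
qed

lemma backward_to_Q_pos:
  assumes x: "x \<in> A" and lim: "(\<lambda>n. (g ^^ n) x) \<longlonglongrightarrow> Q i"
  shows "0 < x $ i"
proof (rule ccontr)
  assume "\<not> 0 < x $ i"
  moreover have "0 \<le> x $ i" using attractor_box[OF x] by (simp add: le_vec_iff)
  ultimately have x0: "x $ i = 0" by simp
  have "(g ^^ n) x $ i = 0" for n
    using funpow_T_eq_0_iff[OF box_quadrant[OF funpow_g_box[OF x]]] funpow_T_g[OF x] x0 by metis
  from limit_coordinate_zero[OF lim this] show False using Q_pos[of i] by simp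
qed

text \<open>Two points of one axis are always K-related, so a point of axis \<open>i\<close> with
  backward limit \<open>Q i\<close> equals \<open>Q i\<close> by
  \<open>backward_contraction\<close>.\<close>

lemma unstable_manifold_open: "unstable_manifold T r (Q i) \<subseteq> open_quadrant"
proof
  obtain j where ij: "i \<noteq> j" using ex_neq_2 by blast
  fix x assume "x \<in> unstable_manifold T r (Q i)"
  then have x: "x \<in> A" "x \<noteq> Q i" "(\<lambda>n. (g ^^ n) x) \<longlonglongrightarrow> Q i"
    by (auto simp: unstable_manifold_def)
  have QA: "Q i \<in> A" "(\<lambda>n. (g ^^ n) (Q i)) \<longlonglongrightarrow> Q i"
    using fixed_in_attractor[OF Q_box Q_props(2)] by auto
  have "x $ j \<noteq> 0"
  proof
    assume x0: "x $ j = 0"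
    then have "leK i x (Q i) \<or> leK i (Q i) x"
      using Q_zero[OF ij] by (auto simp: leK_iff[OF ij])
    then have "x $ i = Q i $ i"
      using backward_contraction[OF x(1) QA(1) _ Q_box Q_props(2) Q_pos x(3) QA(2)]
        backward_contraction[OF QA(1) x(1) _ Q_box Q_props(2) Q_pos QA(2) x(3)] by auto
    with x0 x(2) show False using Q_zero[OF ij] by (simp add: vec_eq_iff_2[OF ij])
  qed
  moreover have "0 \<le> x $ j" using attractor_box[OF x(1)] by (simp add: le_vec_iff)
  moreover have "0 < x $ i" by (rule backward_to_Q_pos[OF x(1,3)])
  ultimately have "0 < x $ i \<and> 0 < x $ j" by simp
  then show "x \<in> open_quadrant" unfolding open_quadrant_iff by (rule all_2_iff[OF ij, THEN iffD2])
qed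

lemma forward_limit_open:
  assumes x: "x \<in> open_quadrant"
  shows "\<exists>p\<in>open_quadrant. T p = p \<and> (\<lambda>n. (T ^^ n) x) \<longlonglongrightarrow> p"
proof -
  have xq: "x \<in> quadrant" "x \<noteq> 0"
    using x by (auto simp: open_quadrant_def quadrant_def less_imp_le)
  obtain p where p: "p \<in> {0..r}" "T p = p" "(\<lambda>n. (T ^^ n) x) \<longlonglongrightarrow> p"
    using forward_convergent[OF xq(1)] by blast
  from box_quadrant[OF p(1)] p(2) show ?thesis
  proof (cases rule: fixed_cases)
    case 1 then show ?thesis using forward_limit_nonzero[OF xq p(3)] by simp
  next
    case (2 i)
    then have "x \<in> stable_manifold T (Q i)" using p xq by (simp add: stable_manifold_def)
    then have "x \<in> pos_axis i" by (simp add: stable_manifold_Q)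
    moreover obtain j where "i \<noteq> j" using ex_neq_2 by blast
    ultimately show ?thesis using x by (auto simp: pos_axis_iff_2 open_quadrant_def less_le)
  next
    case 3 then show ?thesis using p by blast
  qed
qed

end

section \<open>Interior fixed points\<close>

lemma connected_image_interval:
  fixes h :: "real^2 \<Rightarrow> real"
  assumes "continuous_on S h" "connected S" "a \<in> S" "b \<in> S" "h a \<le> t" "t \<le> h b"
  shows "t \<in> h ` S"
  using connected_continuous_image[OF assms(1,2)] assms(3-6)
  by (meson connected_contains_Icc atLeastAtMost_iff imageI subsetD)

lemma coord_sum_mono: "x \<le> y \<Longrightarrow> coord_sum x \<le> coord_sum y"
  by (simp add: coord_sum_def le_vec_iff add_mono)

lemma chain_arc:
  fixes S :: "(real^2) set"
  assumes chain: "\<And>x y. x \<in> S \<Longrightarrow> y \<in> S \<Longrightarrow> x \<le> y \<or> y \<le> x"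
    and S: "connected S" "S \<subseteq> {a..b}" "a \<in> S" "b \<in> S" "a < b"
  shows "\<exists>\<gamma>. arc \<gamma> \<and> path_image \<gamma> = S \<and> pathstart \<gamma> = a \<and> pathfinish \<gamma> = b"
proof -
  obtain h where h: "homeomorphism S (coord_sum ` S) coord_sum h"
    using chain_homeomorphism_coord_sum[OF chain] by blast
  define u v where "u = coord_sum a" and "v = coord_sum b"
  have uv: "u < v" using S(5) by (simp add: u_def v_def coord_sum_strict_mono)
  have "coord_sum x \<in> {u..v}" if "x \<in> S" for x
    using that S(2) by (auto simp: u_def v_def coord_sum_mono)
  moreover have "t \<in> coord_sum ` S" if "t \<in> {u..v}" for t
    using that connected_image_interval[OF continuous_on_coord_sum S(1,3,4)] by (simp add: u_def v_def)
  ultimately have im: "coord_sum ` S = {u..v}" by blast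
  have hS: "continuous_on {u..v} h" "h ` {u..v} = S" "\<And>x. x \<in> S \<Longrightarrow> h (coord_sum x) = x"
    "\<And>t. t \<in> {u..v} \<Longrightarrow> coord_sum (h t) = t"
    using h unfolding homeomorphism_def im by blast+
  define \<phi> where "\<phi> t = u + t * (v - u)" for t :: real
  have \<phi>im: "\<phi> ` {0..1} = {u..v}"
  proof (intro equalityI subsetI)
    fix y assume "y \<in> \<phi> ` {0..1}"
    then obtain t where t: "0 \<le> t" "t \<le> 1" "y = \<phi> t" by auto
    have "t * (v - u) \<le> 1 * (v - u)" using t uv by (intro mult_right_mono) auto
    then have "y \<le> v" using t(3) by (simp add: \<phi>_def algebra_simps)
    moreover have "u \<le> y" using t uv by (simp add: \<phi>_def)
    ultimately show "y \<in> {u..v}" by simp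
  next
    fix y assume "y \<in> {u..v}"
    then have "y = \<phi> ((y - u) / (v - u))" "(y - u) / (v - u) \<in> {0..1}"
      using uv by (simp_all add: \<phi>_def)
    then show "y \<in> \<phi> ` {0..1}" by blast
  qed
  have "continuous_on {0..1} \<phi>" unfolding \<phi>_def by (intro continuous_intros)
  then have "continuous_on {0..1} (h \<circ> \<phi>)"
    using hS(1) by (intro continuous_on_compose) (simp_all add: \<phi>im)
  moreover have "inj_on (h \<circ> \<phi>) {0..1}"
  proof (rule comp_inj_on)
    show "inj_on \<phi> {0..1}" using uv by (auto simp: inj_on_def \<phi>_def)
    show "inj_on h (\<phi> ` {0..1})" unfolding \<phi>im by (rule inj_on_inverseI[of _ coord_sum]) (rule hS(4))
  qed
  ultimately have "arc (h \<circ> \<phi>)" by (simp add: arc_def path_def)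
  moreover have "path_image (h \<circ> \<phi>) = S"
    unfolding path_image_def image_comp[symmetric] \<phi>im by (rule hS(2))
  moreover have "pathstart (h \<circ> \<phi>) = a" "pathfinish (h \<circ> \<phi>) = b"
    using hS(3)[OF S(3)] hS(3)[OF S(4)] by (simp_all add: pathstart_def pathfinish_def \<phi>_def u_def v_def)
  ultimately show ?thesis by blast
qed

text \<open>The interval is half-open because the end point \<open>p0\<close> approached by the axis
  curves belongs to \<open>Sigma_0 T r\<close> and not to them.\<close>

lemma chain_monotone_curve:
  fixes S :: "(real^2) set"
  assumes chain: "\<And>x y. x \<in> S \<Longrightarrow> y \<in> S \<Longrightarrow> x \<le> y \<or> y \<le> x"
    and im: "coord_sum ` S = {u..<v}" "u < v" and R: "related_on R S"
  shows "monotone_curve R S"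
proof -
  obtain h where "homeomorphism S (coord_sum ` S) coord_sum h"
    using chain_homeomorphism_coord_sum[OF chain] by blast
  then have "S homeomorphic {u..<v}" unfolding im(1) homeomorphic_def by blast
  moreover have "is_interval {u..<v}" by (simp add: is_interval_co)
  moreover have "u \<in> {u..<v}" "(u + v) / 2 \<in> {u..<v}" "u \<noteq> (u + v) / 2" using im(2) by auto
  ultimately show ?thesis using R unfolding monotone_curve_def by blast
qed

context typeK_system begin

text \<open>Both points satisfy f_i = 1. If the j-th coordinate did not increase as well, f_i would
  be strictly smaller at \<open>q\<close> than at \<open>p\<close>.\<close>

lemma fixed_coordinate_less:
  assumes p: "p \<in> {0..r}" "T p = p" and q: "q \<in> {0..r}" "T q = q"
    and ij: "i \<noteq> j" and i: "0 < p $ i" "p $ i < q $ i"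
  shows "p $ j < q $ j"
proof (rule ccontr)
  assume "\<not> p $ j < q $ j"
  then have j: "q $ j \<le> p $ j" by simp
  have "f q $ i = f (upd q j (q $ j)) $ i" by simp
  also have "\<dots> \<le> f (upd q j (p $ j)) $ i"
    using p q j ij by (intro f_upd_mono) (auto simp: le_vec_iff)
  also have "upd q j (p $ j) = upd p i (q $ i)" using ij by (simp add: vec_eq_iff_2[OF ij])
  also have "f (upd p i (q $ i)) $ i < f (upd p i (p $ i)) $ i"
    using p q i by (intro f_upd_strict) (auto simp: le_vec_iff)
  finally show False
    using fixed_f[OF box_quadrant[OF p(1)] p(2) i(1)] fixed_f[OF box_quadrant[OF q(1)] q(2), of i] i
    by simp
qed

definition interior_fixed :: "(real^2) set"
  where "interior_fixed = {p \<in> open_quadrant. T p = p}"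

lemma interior_fixed_pos: "p \<in> interior_fixed \<Longrightarrow> 0 < p $ i"
  by (simp add: interior_fixed_def open_quadrant_def)

lemma interior_fixed_T: "p \<in> interior_fixed \<Longrightarrow> T p = p"
  by (simp add: interior_fixed_def)

lemma interior_fixed_box: "p \<in> interior_fixed \<Longrightarrow> p \<in> {0..r}"
  by (rule fixed_box) (auto simp: interior_fixed_def open_quadrant_def quadrant_def less_imp_le)

lemma interior_fixed_comparable:
  assumes p: "p \<in> interior_fixed" and q: "q \<in> interior_fixed"
  shows "p = q \<or> p \<lless> q \<or> q \<lless> p"
proof -
  note pq = fixed_coordinate_less[OF interior_fixed_box[OF p] interior_fixed_T[OF p]
      interior_fixed_box[OF q] interior_fixed_T[OF q] _ interior_fixed_pos[OF p]]
  note qp = fixed_coordinate_less[OF interior_fixed_box[OF q] interior_fixed_T[OF q]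
      interior_fixed_box[OF p] interior_fixed_T[OF p] _ interior_fixed_pos[OF q]]
  have "p $ 1 < q $ 1 \<longleftrightarrow> p $ 2 < q $ 2" "q $ 1 < p $ 1 \<longleftrightarrow> q $ 2 < p $ 2"
    by (rule iffI; erule pq[rotated] qp[rotated]; simp)+
  then have "p $ 1 = q $ 1 \<and> p $ 2 = q $ 2 \<or> p $ 1 < q $ 1 \<and> p $ 2 < q $ 2 \<or>
      q $ 1 < p $ 1 \<and> q $ 2 < p $ 2" by linarith
  then show ?thesis by (simp add: sless_iff forall_2 vec_eq_iff_2[of 1 2])
qed

lemma Q_le_interior_fixed:
  assumes p: "p \<in> interior_fixed"
  shows "Q i \<le> p"
proof -
  obtain j where ij: "i \<noteq> j" using ex_neq_2 by blast
  have "Q i $ i \<le> p $ i"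
    using fixed_coordinate_less[OF interior_fixed_box[OF p] interior_fixed_T[OF p]
        Q_box[of i] Q_props(2) ij interior_fixed_pos[OF p]]
      Q_zero[OF ij] interior_fixed_pos[OF p, of j] by force
  moreover have "Q i $ j \<le> p $ j" using Q_zero[OF ij] interior_fixed_pos[OF p, of j] by simp
  ultimately show ?thesis by (simp add: le_iff_2[OF ij])
qed

section \<open>The least and the greatest interior fixed point\<close>

lemma T_sless:
  assumes "x \<in> {0..r}" "y \<in> {0..r}" "x \<lless> y"
  shows "T x \<lless> T y"
  using T_strict[OF assms(1,2) sless_imp_le[OF assms(3)]] assms(3) by (simp add: sless_iff)

lemma funpow_T_sless:
  "x \<in> {0..r} \<Longrightarrow> y \<in> {0..r} \<Longrightarrow> x \<lless> y \<Longrightarrow> (T ^^ n) x \<lless> (T ^^ n) y"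
  by (induction n) (use T_sless funpow_T_box in auto)

lemma funpow_fixed: "T p = p \<Longrightarrow> (T ^^ n) p = p"
  by (induction n) auto

definition subsolution :: "real^2 \<Rightarrow> bool"
  where "subsolution e \<longleftrightarrow> e \<in> {0..r} \<and> 0 \<lless> e \<and> e \<lless> T e \<and> (\<forall>p\<in>interior_fixed. e \<lless> p)"

lemma subsolution_exists: "\<exists>e. subsolution e"
proof -
  obtain \<delta> c where nz: "near_zero \<delta> c" using near_zero_exists by blast
  \<comment> \<open>The corner of the square at the origin: \<open>away_step\<close> pushes both
    coordinates up, and all interior fixed points lie beyond it.\<close>
  define e :: "real^2" where "e = (\<chi> i. \<delta>)"
  have e: "e $ i = \<delta>" for i by (simp add: e_def)
  have eb: "e \<in> {0..r}" using nz by (simp add: le_vec_iff e near_zero_def less_imp_le)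
  moreover have "0 \<lless> e" using nz by (simp add: sless_iff e near_zero_def)
  moreover have "e \<lless> T e" using away_step[OF nz eb] by (simp add: sless_iff e)
  moreover have "e \<lless> p" if p: "p \<in> interior_fixed" for p
    using fixed_coordinate_gt[OF nz interior_fixed_box[OF p] interior_fixed_T[OF p] interior_fixed_pos[OF p]]
    by (simp add: sless_iff e)
  ultimately show ?thesis unfolding subsolution_def by blast
qed

lemma funpow_T_increasing:
  "e \<in> {0..r} \<Longrightarrow> e \<le> T e \<Longrightarrow> (T ^^ n) e \<le> (T ^^ Suc n) e"
  using funpow_T_mono[OF _ T_in_box] by (simp add: funpow_swap1)

lemma funpow_T_decreasing:
  "e \<in> {0..r} \<Longrightarrow> T e \<le> e \<Longrightarrow> (T ^^ Suc n) e \<le> (T ^^ n) e"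
  using funpow_T_mono[OF T_in_box] by (simp add: funpow_swap1)

text \<open>The orbit of a subsolution stays below every interior fixed point and converges to one,
  so its limit is the least one and does not depend on the subsolution.\<close>

lemma least_interior_fixed:
  "\<exists>p0\<in>interior_fixed. \<forall>e. subsolution e \<longrightarrow> (\<lambda>n. (T ^^ n) e) \<longlonglongrightarrow> p0"
proof -
  have lim: "\<exists>p\<in>interior_fixed. (\<lambda>n. (T ^^ n) e) \<longlonglongrightarrow> p \<and> (\<forall>q\<in>interior_fixed. p \<le> q)" if e: "subsolution e" for e
  proof -
    have eb: "e \<in> {0..r}" "e \<in> open_quadrant" and ef: "\<And>p. p \<in> interior_fixed \<Longrightarrow> e \<lless> p"
      using e by (auto simp: subsolution_def sless_iff open_quadrant_def)
    obtain p where p: "p \<in> interior_fixed" "(\<lambda>n. (T ^^ n) e) \<longlonglongrightarrow> p"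
      using forward_limit_open[OF eb(2)] by (auto simp: interior_fixed_def)
    have "p \<le> q" if q: "q \<in> interior_fixed" for q
    proof (rule le_vec_limit[OF p(2)])
      have "(T ^^ n) e \<le> q" for n
        using funpow_T_mono[OF eb(1) interior_fixed_box[OF q] sless_imp_le[OF ef[OF q]], of n]
          funpow_fixed[OF interior_fixed_T[OF q]] by simp
      then show "\<forall>\<^sub>F n in sequentially. (T ^^ n) e \<le> q" by simp
    qed
    with p show ?thesis by blast
  qed
  obtain e where "subsolution e" using subsolution_exists by blast
  from lim[OF this] obtain p0 where p0: "p0 \<in> interior_fixed" "\<forall>q\<in>interior_fixed. p0 \<le> q" by blast
  have "(\<lambda>n. (T ^^ n) e) \<longlonglongrightarrow> p0" if "subsolution e" for e
    using lim[OF that] p0 by (metis order_antisym)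
  with p0 show ?thesis by blast
qed

text \<open>Chosen as the common limit of all subsolutions, the form that \<open>p0_le\<close> uses;
  minimality follows from it.\<close>

definition p0 :: "real^2"
  where "p0 = (SOME p. p \<in> interior_fixed \<and> (\<forall>e. subsolution e \<longrightarrow> (\<lambda>n. (T ^^ n) e) \<longlonglongrightarrow> p))"

lemma p0_props: "p0 \<in> interior_fixed" "subsolution e \<Longrightarrow> (\<lambda>n. (T ^^ n) e) \<longlonglongrightarrow> p0"
  using someI_ex[OF least_interior_fixed[unfolded Bex_def]] by (auto simp: p0_def)

text \<open>Late backward points of \<open>x\<close> lie above a subsolution \<open>e\<close>, since
  their limit does strictly. Applying \<open>T\<close> as many times forward puts \<open>x\<close>
  above \<open>T^n e\<close>.\<close>

lemma p0_le:
  assumes x: "x \<in> A" and p: "p \<in> interior_fixed" "(\<lambda>n. (g ^^ n) x) \<longlonglongrightarrow> p"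
  shows "p0 \<le> x"
proof -
  obtain e where e: "subsolution e" using subsolution_exists by blast
  then have eb: "e \<in> {0..r}" and ep: "e \<lless> p" using p by (auto simp: subsolution_def)
  have "\<forall>\<^sub>F n in sequentially. (T ^^ n) e \<le> x"
  proof (rule eventually_mono[OF sless_eventually'[OF p(2) ep]])
    fix n assume "e \<lless> (g ^^ n) x"
    from funpow_T_mono[OF eb funpow_g_box[OF x] sless_imp_le[OF this], of n]
    show "(T ^^ n) e \<le> x" by (simp add: funpow_T_g[OF x])
  qed
  then show ?thesis by (rule le_vec_limit[OF p0_props(2)[OF e]])
qed

lemma p0_least: "p \<in> interior_fixed \<Longrightarrow> p0 \<le> p"
  using p0_le fixed_in_attractor interior_fixed_box interior_fixed_T by blast

lemma r_box: "r \<in> {0..r}"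
  using r_nonneg by simp

definition p1 :: "real^2"
  where "p1 = lim (\<lambda>n. (T ^^ n) r)"

lemma p1_props: "p1 \<in> interior_fixed" "(\<lambda>n. (T ^^ n) r) \<longlonglongrightarrow> p1"
proof -
  have "r \<in> open_quadrant" using r_pos by (simp add: sless_iff open_quadrant_def)
  from forward_limit_open[OF this] show "p1 \<in> interior_fixed" "(\<lambda>n. (T ^^ n) r) \<longlonglongrightarrow> p1"
    by (auto simp: interior_fixed_def p1_def limI)
qed

text \<open>The n-th backward point lies below \<open>r\<close>, hence \<open>x\<close> lies below
  \<open>T^n r\<close>, for every n.\<close>

lemma le_p1:
  assumes x: "x \<in> A"
  shows "x \<le> p1"
proof (rule ge_vec_limit[OF p1_props(2)])
  have "x \<le> (T ^^ n) r" for n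
    using funpow_T_mono[OF funpow_g_box[OF x] r_box, of n n] funpow_g_box[OF x, of n]
    by (simp add: funpow_T_g[OF x])
  then show "\<forall>\<^sub>F n in sequentially. x \<le> (T ^^ n) r" by simp
qed

lemma p1_greatest: "p \<in> interior_fixed \<Longrightarrow> p \<le> p1"
  using le_p1 fixed_in_attractor interior_fixed_box interior_fixed_T by blast

lemma p0_p1:
  assumes "interior_fixed \<noteq> {p0}"
  shows "p0 \<lless> p1"
proof -
  obtain p where p: "p \<in> interior_fixed" "p \<noteq> p0" using assms p0_props(1) by blast
  then have "p1 \<noteq> p0" using p0_least p1_greatest by (metis order_antisym)
  moreover have "\<not> p1 \<lless> p0"
    using p0_least[OF p1_props(1)] by (auto simp: sless_iff le_vec_iff) (metis not_le)
  ultimately show ?thesis using interior_fixed_comparable[OF p0_props(1) p1_props(1)] by auto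
qed

text \<open>The orbits of a subsolution and of \<open>r\<close> bound invariant order intervals that
  contain \<open>p0\<close> in their interior and, as \<open>p1\<close> equals \<open>p0\<close>
  here, shrink to it.\<close>

lemma p0_stable:
  assumes un: "interior_fixed = {p0}"
  shows "globally_asymptotically_stable_in T open_quadrant p0"
proof -
  have p10: "p1 = p0" using p1_props(1) un by blast
  obtain e where e: "subsolution e" using subsolution_exists by blast
  then have eb: "e \<in> {0..r}" and eT: "e \<le> T e" and ep: "e \<lless> p0"
    using p0_props(1) by (auto simp: subsolution_def sless_imp_le)
  have pb: "p0 \<in> {0..r}" and pT: "T p0 = p0"
    using p0_props(1) interior_fixed_box interior_fixed_T by auto
  have rp: "p0 \<lless> r" using T_less_r[OF pb] by (simp add: sless_iff pT)
  define a b where "a n = (T ^^ n) e" and "b n = (T ^^ n) r" for n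
  have ab: "a n \<in> {0..r}" "b n \<in> {0..r}" for n
    using funpow_T_box eb r_box by (simp_all add: a_def b_def)
  have abp: "a n \<lless> p0" "p0 \<lless> b n" for n
    using funpow_T_sless[OF eb pb ep, of n] funpow_T_sless[OF pb r_box rp, of n]
    by (simp_all add: a_def b_def funpow_fixed[OF pT])
  have inv: "invariant_in_box {a n..b n}" for n
    using funpow_T_increasing[OF eb eT, of n] funpow_T_decreasing[OF r_box, of n] T_in_box[OF r_box]
    by (intro invariant_interval ab) (auto simp: a_def b_def)
  have a_lim: "a \<longlonglongrightarrow> p0" and b_lim: "b \<longlonglongrightarrow> p0"
    using p0_props(2)[OF e] p1_props(2) p10 by (simp_all add: a_def[abs_def] b_def[abs_def])
  have cs: "(\<lambda>n. coord_sum (b n) - coord_sum (a n)) \<longlonglongrightarrow> coord_sum p0 - coord_sum p0"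
    unfolding coord_sum_def by (intro tendsto_intros a_lim b_lim)
  have "\<exists>d>0. \<forall>x\<in>open_quadrant. dist x p0 < d \<longrightarrow> (\<forall>n. dist ((T ^^ n) x) p0 < \<epsilon>)" if \<epsilon>: "0 < \<epsilon>" for \<epsilon>
  proof -
    obtain N where N: "coord_sum (b N) - coord_sum (a N) < \<epsilon>"
      using order_tendstoD(2)[OF cs, of \<epsilon>] \<epsilon> by (auto simp: eventually_sequentially)
    have "\<forall>\<^sub>F x in nhds p0. a N \<lless> x \<and> x \<lless> b N"
      using sless_eventually'[OF tendsto_ident_at abp(1)] sless_eventually[OF filterlim_ident abp(2)]
        sless_eventually'[OF filterlim_ident abp(1)]
      by (intro eventually_conj)
    then obtain d where d: "0 < d" "\<And>x. dist x p0 < d \<Longrightarrow> a N \<lless> x \<and> x \<lless> b N"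
      unfolding eventually_nhds_metric by blast
    have "dist ((T ^^ n) x) p0 < \<epsilon>" if x: "dist x p0 < d" for x n
    proof -
      have "x \<in> {a N..b N}" using d(2)[OF x] by (simp add: sless_imp_le)
      then have y: "(T ^^ n) x \<in> {a N..b N}" by (rule invariant_funpow[OF inv])
      let ?y = "(T ^^ n) x"
      have p: "p0 \<in> {a N..b N}" using abp by (simp add: sless_imp_le)
      have "dist ?y p0 \<le> \<bar>?y $ 1 - p0 $ 1\<bar> + \<bar>?y $ 2 - p0 $ 2\<bar>"
        using norm_le_2[of 1 2 "?y - p0"] by (simp add: dist_norm)
      also have "\<dots> \<le> (b N $ 1 - a N $ 1) + (b N $ 2 - a N $ 2)"
        using y p unfolding atLeastAtMost_iff le_vec_iff forall_2 by linarith
      also have "\<dots> < \<epsilon>" using N by (simp add: coord_sum_def)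
      finally show ?thesis .
    qed
    with d(1) show ?thesis by blast
  qed
  moreover have "(\<lambda>n. (T ^^ n) x) \<longlonglongrightarrow> p0" if "x \<in> open_quadrant" for x
  proof -
    obtain p where "p \<in> interior_fixed" "(\<lambda>n. (T ^^ n) x) \<longlonglongrightarrow> p"
      using forward_limit_open[OF \<open>x \<in> open_quadrant\<close>] by (auto simp: interior_fixed_def)
    with un show ?thesis by simp
  qed
  ultimately show ?thesis unfolding globally_asymptotically_stable_in_def by blast
qed

section \<open>The decomposition of Sigma by backward limits\<close>

lemma Sigma_iff:
  "x \<in> Sigma_set T r \<longleftrightarrow> x \<in> A \<and> (\<exists>p\<in>{0..r}. T p = p \<and> p \<noteq> 0 \<and> (\<lambda>n. (g ^^ n) x) \<longlonglongrightarrow> p)"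
proof
  assume x: "x \<in> Sigma_set T r"
  then have xA: "x \<in> A" by (simp add: Sigma_set_def)
  obtain p where p: "p \<in> {0..r}" "T p = p" "(\<lambda>n. (g ^^ n) x) \<longlonglongrightarrow> p"
    using backward_convergent[OF xA] by blast
  have "(g ^^ n) x \<in> T ` {0..r}" for n
    using T_funpow_g_Suc[OF xA, of n] funpow_g_box[OF xA, of "Suc n"] by (metis imageI)
  then have "\<not> (\<lambda>n. (g ^^ n) x) \<longlonglongrightarrow> 0"
    using x box_quadrant[OF attractor_box[OF xA]] unfolding Sigma_set_def repulsion_zero_def by blast
  with p xA show "x \<in> A \<and> (\<exists>p\<in>{0..r}. T p = p \<and> p \<noteq> 0 \<and> (\<lambda>n. (g ^^ n) x) \<longlonglongrightarrow> p)" by metis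
next
  assume "x \<in> A \<and> (\<exists>p\<in>{0..r}. T p = p \<and> p \<noteq> 0 \<and> (\<lambda>n. (g ^^ n) x) \<longlonglongrightarrow> p)"
  then obtain p where p: "x \<in> A" "p \<noteq> 0" "(\<lambda>n. (g ^^ n) x) \<longlonglongrightarrow> p" by blast
  then have "\<not> (\<lambda>n. (g ^^ n) x) \<longlonglongrightarrow> 0" using LIMSEQ_unique by blast
  with p(1) show "x \<in> Sigma_set T r" by (simp add: Sigma_set_def repulsion_zero_def)
qed

lemma fixed_in_Sigma: "p \<in> {0..r} \<Longrightarrow> T p = p \<Longrightarrow> p \<noteq> 0 \<Longrightarrow> p \<in> Sigma_set T r"
  unfolding Sigma_iff using fixed_in_attractor by blast

lemma Q_neq_0: "Q i \<noteq> 0"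
  using Q_pos[of i] by auto

text \<open>Convergence of backward orbits makes the alpha-limit set a single nonzero fixed point;
  if it lies on axis \<open>i\<close>, it is \<open>Q i\<close>.\<close>

lemma Sigma_axis_iff:
  assumes ij: "i \<noteq> j"
  shows "{x \<in> Sigma_set T r. alpha_limit T r x \<subseteq> Sigma_set T r \<inter> {y \<in> quadrant. y $ j = 0}}
    = {x \<in> A. (\<lambda>n. (g ^^ n) x) \<longlonglongrightarrow> Q i}"
proof (intro equalityI subsetI)
  fix x assume "x \<in> {x \<in> Sigma_set T r. alpha_limit T r x \<subseteq> Sigma_set T r \<inter> {y \<in> quadrant. y $ j = 0}}"
  then obtain p where x: "x \<in> A" and p: "p \<in> {0..r}" "T p = p" "p \<noteq> 0" "(\<lambda>n. (g ^^ n) x) \<longlonglongrightarrow> p"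
    and "alpha_limit T r x \<subseteq> {y \<in> quadrant. y $ j = 0}" using Sigma_iff by blast
  then have "p $ j = 0" by (simp add: backward_limit_unique)
  with p have "p \<in> pos_axis i"
    by (auto simp: pos_axis_iff_2[OF ij] le_vec_iff less_le vec_eq_iff_2[OF ij])
  then have "p = Q i" using p(2) Q_unique by blast
  with x p show "x \<in> {x \<in> A. (\<lambda>n. (g ^^ n) x) \<longlonglongrightarrow> Q i}" by simp
next
  fix x assume "x \<in> {x \<in> A. (\<lambda>n. (g ^^ n) x) \<longlonglongrightarrow> Q i}"
  then have x: "x \<in> A" "(\<lambda>n. (g ^^ n) x) \<longlonglongrightarrow> Q i" by auto
  then have "x \<in> Sigma_set T r" unfolding Sigma_iff using Q_box Q_props(2) Q_neq_0 by blast
  moreover have "Q i \<in> Sigma_set T r" using fixed_in_Sigma Q_box Q_props(2) Q_neq_0 by blast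
  ultimately show "x \<in> {x \<in> Sigma_set T r. alpha_limit T r x \<subseteq> Sigma_set T r \<inter> {y \<in> quadrant. y $ j = 0}}"
    using Q_zero[OF ij] box_quadrant[OF Q_box] by (simp add: backward_limit_unique[OF x(2)])
qed

lemma unstable_manifold_insert:
  "unstable_manifold T r (Q i) \<union> {Q i} = {x \<in> A. (\<lambda>n. (g ^^ n) x) \<longlonglongrightarrow> Q i}"
  using fixed_in_attractor[OF Q_box Q_props(2)] by (auto simp: unstable_manifold_def)

lemma Sigma_H_eq: "Sigma_H T r = unstable_manifold T r (Q 1) \<union> {Q 1}"
  unfolding Sigma_H_def unstable_manifold_insert by (rule Sigma_axis_iff) simp

lemma Sigma_V_eq: "Sigma_V T r = unstable_manifold T r (Q 2) \<union> {Q 2}"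
  unfolding Sigma_V_def unstable_manifold_insert by (rule Sigma_axis_iff) simp

lemma Sigma_0_iff:
  "x \<in> Sigma_0 T r \<longleftrightarrow> x \<in> A \<and> (\<exists>p\<in>interior_fixed. (\<lambda>n. (g ^^ n) x) \<longlonglongrightarrow> p)"
proof -
  have HV: "x \<in> Sigma_H T r \<union> Sigma_V T r \<longleftrightarrow> x \<in> A \<and> (\<exists>i. (\<lambda>n. (g ^^ n) x) \<longlonglongrightarrow> Q i)"
    unfolding Sigma_H_eq Sigma_V_eq unstable_manifold_insert using exhaust_2 by auto metis
  show ?thesis
  proof
    assume x: "x \<in> Sigma_0 T r"
    then obtain p where xA: "x \<in> A" and p: "p \<in> {0..r}" "T p = p" "p \<noteq> 0" "(\<lambda>n. (g ^^ n) x) \<longlonglongrightarrow> p"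
      using Sigma_iff[of x] by (auto simp: Sigma_0_def)
    from box_quadrant[OF p(1)] p(2) have "p \<in> interior_fixed"
    proof (cases rule: fixed_cases)
      case 1 with p show ?thesis by simp
    next
      case (2 i) with x xA p HV show ?thesis unfolding Sigma_0_def by blast
    next
      case 3 with p show ?thesis by (simp add: interior_fixed_def)
    qed
    with xA p show "x \<in> A \<and> (\<exists>p\<in>interior_fixed. (\<lambda>n. (g ^^ n) x) \<longlonglongrightarrow> p)" by blast
  next
    assume "x \<in> A \<and> (\<exists>p\<in>interior_fixed. (\<lambda>n. (g ^^ n) x) \<longlonglongrightarrow> p)"
    then obtain p where x: "x \<in> A" and p: "p \<in> interior_fixed" "(\<lambda>n. (g ^^ n) x) \<longlonglongrightarrow> p" by blast
    have "p \<noteq> 0" using interior_fixed_pos[OF p(1), of 1] by auto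
    then have "x \<in> Sigma_set T r"
      unfolding Sigma_iff using x p interior_fixed_box interior_fixed_T by blast
    moreover have "p \<noteq> Q i" for i
    proof -
      obtain j where "i \<noteq> j" using ex_neq_2 by blast
      then show ?thesis using Q_zero[of i j] interior_fixed_pos[OF p(1), of j] by auto
    qed
    then have "x \<notin> Sigma_H T r \<union> Sigma_V T r" unfolding HV using p(2) LIMSEQ_unique by blast
    ultimately show "x \<in> Sigma_0 T r" by (simp add: Sigma_0_def)
  qed
qed

lemma p0_T: "T p0 = p0" and p1_T: "T p1 = p1" and p0_box: "p0 \<in> {0..r}" and p1_box: "p1 \<in> {0..r}"
  using p0_props(1) p1_props(1) interior_fixed_T interior_fixed_box by auto

text \<open>The bounds by \<open>p0\<close> and \<open>p1\<close> apply to every point of the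
  backward orbit. Conversely, a backward limit above \<open>p0\<close> is an interior fixed
  point.\<close>

lemma Sigma_0_core: "Sigma_0 T r = core {p0..p1}"
proof -
  have inv: "invariant_in_box {p0..p1}"
    by (intro invariant_interval) (simp_all only: p0_T p1_T p0_box p1_box order_refl)
  show ?thesis
  proof (intro equalityI subsetI)
    fix x assume "x \<in> Sigma_0 T r"
    then obtain p where x: "x \<in> A" and p: "p \<in> interior_fixed" "(\<lambda>n. (g ^^ n) x) \<longlonglongrightarrow> p"
      unfolding Sigma_0_iff by blast
    have "(g ^^ n) x \<in> {p0..p1}" for n
    proof -
      have "(\<lambda>m. (g ^^ m) ((g ^^ n) x)) \<longlonglongrightarrow> p"
        using LIMSEQ_ignore_initial_segment[OF p(2), of n] by (simp add: funpow_add)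
      then show ?thesis
        using p0_le[OF funpow_g_attractor[OF x] p(1)] le_p1[OF funpow_g_attractor[OF x]] by simp
    qed
    with x show "x \<in> core {p0..p1}" unfolding core_iff[OF inv] by blast
  next
    fix x assume "x \<in> core {p0..p1}"
    then have x: "x \<in> A" "\<And>n. (g ^^ n) x \<in> {p0..p1}" unfolding core_iff[OF inv] by auto
    obtain p where p: "p \<in> {0..r}" "T p = p" "(\<lambda>n. (g ^^ n) x) \<longlonglongrightarrow> p"
      using backward_convergent[OF x(1)] by blast
    have "p0 \<le> p" using x(2) by (intro ge_vec_limit[OF p(3)]) simp
    then have "0 < p $ i" for i using interior_fixed_pos[OF p0_props(1), of i] by (simp add: le_vec_iff less_le_trans)
    then have "p \<in> interior_fixed" using p(2) by (simp add: interior_fixed_def open_quadrant_def)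
    with x p show "x \<in> Sigma_0 T r" unfolding Sigma_0_iff by blast
  qed
qed

text \<open>The K-relation passes to the backward limits, which are ordered by
  \<open>\<lless>\<close> unless equal, so they coincide. The contraction lemma then applies to both
  coordinates, because an interior limit has both positive.\<close>

lemma Sigma_0_leK:
  assumes "x \<in> Sigma_0 T r" "y \<in> Sigma_0 T r" and xy: "leK i x y"
  shows "x = y"
proof -
  obtain j where ij: "i \<noteq> j" using ex_neq_2 by blast
  obtain p where x: "x \<in> A" and p: "p \<in> interior_fixed" "(\<lambda>n. (g ^^ n) x) \<longlonglongrightarrow> p"
    using assms(1) unfolding Sigma_0_iff by blast
  obtain q where y: "y \<in> A" and q: "q \<in> interior_fixed" "(\<lambda>n. (g ^^ n) y) \<longlonglongrightarrow> q"
    using assms(2) unfolding Sigma_0_iff by blast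
  have K: "(g ^^ n) x $ i \<le> (g ^^ n) y $ i \<and> (g ^^ n) y $ j \<le> (g ^^ n) x $ j" for n
    using backward_leK[OF x y xy, of n] by (simp add: leK_iff[OF ij])
  have "p $ i \<le> q $ i" "q $ j \<le> p $ j"
    using K LIMSEQ_le[OF tendsto_vec_nth[OF p(2)] tendsto_vec_nth[OF q(2)], of i]
      LIMSEQ_le[OF tendsto_vec_nth[OF q(2)] tendsto_vec_nth[OF p(2)], of j] by auto
  then have pq: "q = p"
    using interior_fixed_comparable[OF p(1) q(1)] unfolding sless_iff by (metis not_le)
  note c = interior_fixed_box[OF p(1)] interior_fixed_T[OF p(1)] interior_fixed_pos[OF p(1)]
  have "x $ i = y $ i" by (rule backward_contraction[OF x y xy c p(2) q(2)[unfolded pq]])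
  moreover have "y $ j = x $ j"
    using xy by (intro backward_contraction[OF y x _ c q(2)[unfolded pq] p(2)]) (simp add: leK_swap[OF ij])
  ultimately show ?thesis by (simp add: vec_eq_iff_2[OF ij])
qed

lemma Sigma_0_related: "related_on (\<lless>) (Sigma_0 T r)"
  unfolding related_on_def
proof (intro ballI impI)
  fix x y assume xy: "x \<in> Sigma_0 T r" "y \<in> Sigma_0 T r" "x \<noteq> y"
  then have "\<not> leK 1 x y" "\<not> leK 1 y x" using Sigma_0_leK by blast+
  then show "x \<lless> y \<or> y \<lless> x" by (auto simp: leK_iff[of 1 2] sless_iff forall_2)
qed

lemma Sigma_0_curve:
  assumes "interior_fixed \<noteq> {p0}"
  shows "monotone_curve_from_to (\<lless>) (Sigma_0 T r) p0 p1"
proof -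
  have inv: "invariant_in_box {p0..p1}"
    by (intro invariant_interval) (simp_all only: p0_T p1_T p0_box p1_box order_refl)
  have lt: "p0 < p1" using p0_p1[OF assms] sless_imp_le[of p0 p1]
    by (auto simp: less_iff_le_neq sless_iff)
  have "connected {p0..p1}" by (simp add: interval_cbox convex_connected)
  then have "connected (Sigma_0 T r)"
    unfolding Sigma_0_core by (intro core_connected inv) (simp_all add: interval_cbox)
  moreover have "Sigma_0 T r \<subseteq> {p0..p1}" unfolding Sigma_0_core by (rule core_subset)
  moreover have "p0 \<in> Sigma_0 T r" "p1 \<in> Sigma_0 T r"
    unfolding Sigma_0_core using lt p0_T p1_T by (auto intro!: fixed_in_core[OF inv])
  moreover have "x \<le> y \<or> y \<le> x" if "x \<in> Sigma_0 T r" "y \<in> Sigma_0 T r" for x y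
    using Sigma_0_related[unfolded related_on_def, rule_format, OF that] sless_imp_le by (cases "x = y") auto
  ultimately have "\<exists>\<gamma>. arc \<gamma> \<and> path_image \<gamma> = Sigma_0 T r \<and> pathstart \<gamma> = p0 \<and> pathfinish \<gamma> = p1"
    using lt by (intro chain_arc) auto
  then show ?thesis using Sigma_0_related unfolding monotone_curve_from_to_def by blast
qed

lemma Sigma_0_singleton:
  assumes "interior_fixed = {p0}"
  shows "Sigma_0 T r = {p0}"
proof -
  have "p1 = p0" using assms p1_props(1) by blast
  then have "Sigma_0 T r \<subseteq> {p0}" unfolding Sigma_0_core using core_subset[of "{p0..p1}"] by simp
  moreover have "p0 \<in> Sigma_0 T r"
    unfolding Sigma_0_iff using p0_props(1) fixed_in_attractor[OF p0_box p0_T] by blast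
  ultimately show ?thesis by blast
qed

end

section \<open>The curves issuing from the axes\<close>

context typeK_system begin

text \<open>For \<open>i = 1\<close> and \<open>i = 2\<close> these are \<open>Sigma_H T r\<close>
  and \<open>Sigma_V T r\<close>, described by backward limits.\<close>

definition S_axis :: "2 \<Rightarrow> (real^2) set"
  where "S_axis i = {x \<in> A. (\<lambda>n. (g ^^ n) x) \<longlonglongrightarrow> Q i}"

lemma S_axis_eq: "unstable_manifold T r (Q i) \<union> {Q i} = S_axis i"
  unfolding S_axis_def by (rule unstable_manifold_insert)

lemma Q_in_S_axis: "Q i \<in> S_axis i"
  using fixed_in_attractor[OF Q_box Q_props(2)] by (simp add: S_axis_def)

lemma funpow_g_S_axis:
  assumes "x \<in> S_axis i"
  shows "(g ^^ n) x \<in> S_axis i"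
proof -
  have x: "x \<in> A" "(\<lambda>n. (g ^^ n) x) \<longlonglongrightarrow> Q i" using assms by (auto simp: S_axis_def)
  have "(\<lambda>m. (g ^^ m) ((g ^^ n) x)) \<longlonglongrightarrow> Q i"
    using LIMSEQ_ignore_initial_segment[OF x(2), of n] by (simp add: funpow_add)
  then show ?thesis using funpow_g_attractor[OF x(1)] by (simp add: S_axis_def)
qed

text \<open>Only the i-th coordinate is obtained, since the other one of \<open>Q i\<close> is 0.
  This is why the curves are in general chains for \<open>\<le>\<close> only.\<close>

lemma S_axis_leK:
  assumes "x \<in> S_axis i" "y \<in> S_axis i" "leK i x y"
  shows "x $ i = y $ i"
  using assms backward_contraction[OF _ _ _ Q_box Q_props(2) Q_pos] by (simp add: S_axis_def)

lemma S_axis_chain: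
  assumes x: "x \<in> S_axis i" and y: "y \<in> S_axis i"
  shows "x \<le> y \<or> y \<le> x"
proof -
  obtain j where ij: "i \<noteq> j" using ex_neq_2 by blast
  show ?thesis
    using S_axis_leK[OF x y] S_axis_leK[OF y x]
    unfolding leK_iff[OF ij] le_iff_2[OF ij] by linarith
qed

lemma S_axis_coord_sum_inj:
  "x \<in> S_axis i \<Longrightarrow> y \<in> S_axis i \<Longrightarrow> coord_sum x = coord_sum y \<Longrightarrow> x = y"
  using dist_le_coord_sum[OF S_axis_chain, of x i y] by simp

lemma S_axis_ge_Q:
  assumes "x \<in> S_axis i"
  shows "Q i \<le> x"
proof (cases "x = Q i")
  case False
  obtain j where ij: "i \<noteq> j" using ex_neq_2 by blast
  have "x \<in> unstable_manifold T r (Q i)" using assms False by (auto simp flip: S_axis_eq)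
  then have "0 < x $ j" using unstable_manifold_open by (auto simp: open_quadrant_def)
  then have "\<not> x \<le> Q i" using Q_zero[OF ij] by (auto simp: le_iff_2[OF ij])
  then show ?thesis using S_axis_chain[OF assms Q_in_S_axis] by blast
qed simp

lemma Q_less_p0: "Q i < p0"
proof -
  obtain j where ij: "i \<noteq> j" using ex_neq_2 by blast
  have "Q i \<noteq> p0" using Q_zero[OF ij] interior_fixed_pos[OF p0_props(1), of j] by auto
  then show ?thesis using Q_le_interior_fixed[OF p0_props(1), of i] by (simp add: less_iff_le_neq)
qed

lemma invariant_Q_p0: "invariant_in_box {Q i..p0}"
  by (intro invariant_interval) (simp_all only: p0_T Q_props(2) p0_box Q_box order_refl)

text \<open>The backward limit is above \<open>Q i\<close>, hence it is \<open>Q i\<close> or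
  interior. An interior limit forces \<open>p0 \<le> x \<le> p0\<close>.\<close>

lemma core_Q_p0_subset:
  assumes x: "x \<in> core {Q i..p0}" and ne: "x \<noteq> p0"
  shows "x \<in> S_axis i"
proof -
  have xA: "x \<in> A" and xg: "(g ^^ n) x \<in> {Q i..p0}" for n
    using x unfolding core_iff[OF invariant_Q_p0] by auto
  obtain p where p: "p \<in> {0..r}" "T p = p" "(\<lambda>n. (g ^^ n) x) \<longlonglongrightarrow> p"
    using backward_convergent[OF xA] by blast
  have Qp: "Q i \<le> p" using xg by (intro ge_vec_limit[OF p(3)]) simp
  then have pi: "0 < p $ i" using Q_pos[of i] by (simp add: le_vec_iff less_le_trans)
  from box_quadrant[OF p(1)] p(2) show ?thesis
  proof (cases rule: fixed_cases)
    case 1 then show ?thesis using pi by simp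
  next
    case (2 k)
    then have "k = i" using pi Q_zero[of k i] by (cases "k = i") auto
    with 2 p xA show ?thesis by (simp add: S_axis_def)
  next
    case 3
    then have "p \<in> interior_fixed" using p(2) by (simp add: interior_fixed_def)
    from p0_le[OF xA this p(3)] have "p0 \<le> x" .
    moreover have "x \<le> p0" using xg[of 0] by simp
    ultimately show ?thesis using ne by simp
  qed
qed

text \<open>The core is connected and contains both \<open>Q i\<close> and \<open>p0\<close>, so the
  coordinate sum takes every value between theirs on it.\<close>

lemma core_Q_p0_level:
  assumes "coord_sum (Q i) \<le> t" "t < coord_sum p0"
  shows "\<exists>z\<in>core {Q i..p0} \<inter> S_axis i. coord_sum z = t"
proof -
  have "connected (core {Q i..p0})"
    by (intro core_connected invariant_Q_p0) (simp_all add: interval_cbox convex_connected)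
  moreover have "Q i \<in> core {Q i..p0}" "p0 \<in> core {Q i..p0}"
    using Q_less_p0[of i] by (auto intro!: fixed_in_core[OF invariant_Q_p0] simp: p0_T Q_props(2))
  ultimately have "t \<in> coord_sum ` core {Q i..p0}"
    using assms by (intro connected_image_interval[OF continuous_on_coord_sum, of _ "Q i" p0]) auto
  then obtain z where z: "z \<in> core {Q i..p0}" "coord_sum z = t" by blast
  moreover have "z \<noteq> p0" using z assms by auto
  ultimately show ?thesis using core_Q_p0_subset by blast
qed

text \<open>A late backward point \<open>?y\<close> has a coordinate sum below that of
  \<open>p0\<close>. The core has a point of the curve with the same sum, which is \<open>?y\<close>
  itself since the curve is a chain; then the interval's invariance carries this forward to
  \<open>x\<close>.\<close>

lemma S_axis_subset_core:
  assumes x: "x \<in> S_axis i"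
  shows "x \<in> {Q i..p0}" "x \<noteq> p0"
proof -
  have xA: "x \<in> A" and lim: "(\<lambda>n. (g ^^ n) x) \<longlonglongrightarrow> Q i" using x by (auto simp: S_axis_def)
  have "(\<lambda>n. coord_sum ((g ^^ n) x)) \<longlonglongrightarrow> coord_sum (Q i)"
    unfolding coord_sum_def by (intro tendsto_intros lim)
  from order_tendstoD(2)[OF this coord_sum_strict_mono[OF Q_less_p0]]
  obtain n where n: "coord_sum ((g ^^ n) x) < coord_sum p0" by (auto simp: eventually_sequentially)
  let ?y = "(g ^^ n) x"
  have y: "?y \<in> S_axis i" by (rule funpow_g_S_axis[OF x])
  obtain z where z: "z \<in> core {Q i..p0}" "z \<in> S_axis i" "coord_sum z = coord_sum ?y"
    using core_Q_p0_level[OF coord_sum_mono[OF S_axis_ge_Q[OF y]] n] by blast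
  have "?y \<in> {Q i..p0}"
    using S_axis_coord_sum_inj[OF z(2) y z(3)] z(1) core_subset[of "{Q i..p0}"] by blast
  from invariant_funpow[OF invariant_Q_p0 this, of n] show "x \<in> {Q i..p0}"
    by (simp add: funpow_T_g[OF xA])
  show "x \<noteq> p0"
  proof
    assume "x = p0"
    then have "(\<lambda>n. (g ^^ n) x) \<longlonglongrightarrow> p0" using fixed_in_attractor[OF p0_box p0_T] by simp
    then have "p0 = Q i" using lim LIMSEQ_unique by blast
    then show False using Q_less_p0[of i] by simp
  qed
qed

lemma coord_sum_S_axis: "coord_sum ` S_axis i = {coord_sum (Q i)..<coord_sum p0}"
proof (intro equalityI subsetI)
  fix t assume "t \<in> coord_sum ` S_axis i"
  then obtain x where x: "x \<in> S_axis i" "t = coord_sum x" by blast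
  have "Q i \<le> x" "x < p0" using S_axis_subset_core[OF x(1)] by (auto simp: less_iff_le_neq)
  then show "t \<in> {coord_sum (Q i)..<coord_sum p0}"
    using x(2) by (simp add: coord_sum_mono coord_sum_strict_mono)
next
  fix t assume "t \<in> {coord_sum (Q i)..<coord_sum p0}"
  then obtain z where "z \<in> S_axis i" "coord_sum z = t" using core_Q_p0_level[of i t] by auto
  then show "t \<in> coord_sum ` S_axis i" by blast
qed

lemma S_axis_curve:
  assumes "related_on R (S_axis i)"
  shows "monotone_curve R (S_axis i)"
  using S_axis_chain coord_sum_S_axis coord_sum_strict_mono[OF Q_less_p0] assms
  by (rule chain_monotone_curve)

lemma S_axis_related: "related_on (<) (S_axis i)"
  unfolding related_on_def using S_axis_chain[of _ i] by (auto simp: less_iff_le_neq)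

lemma T_upd_strict_off:
  assumes pd: "\<And>x. x \<in> {0..r} \<Longrightarrow> 0 < partial_deriv f i k x"
    and x: "x \<in> {0..r}" "0 < x $ i" and ab: "0 \<le> a" "a < b" "b \<le> r $ k" and ik: "i \<noteq> k"
  shows "T (upd x k a) $ i < T (upd x k b) $ i"
proof -
  obtain c where c: "a < c" "c < b" "T (upd x k b) $ i - T (upd x k a) $ i
      = (b - a) * J (upd x k c) $ i $ k"
    using coordinate_mvt[OF T_differentiable box_quadrant[OF x(1)] ab(1,2)] by blast
  have u: "upd x k c \<in> {0..r}" using x c ab by (intro upd_in_interval) auto
  have "0 < (b - a) * J (upd x k c) $ i $ k"
    using pd[OF u] x ab ik by (simp add: jacobian_T[OF box_quadrant[OF u]])
  with c show ?thesis by simp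
qed

text \<open>Distinct points differ in coordinate \<open>j\<close> by \<open>S_axis_leK\<close>. If
  they agreed in coordinate \<open>i\<close>, so would their preimages, which differ in coordinate
  \<open>j\<close>; positive off-diagonal derivatives would then separate the i-th coordinates in
  one forward step.\<close>

lemma S_axis_strongly_related:
  assumes pd: "\<And>i j x. x \<in> {0..r} \<Longrightarrow> i \<noteq> j \<Longrightarrow> 0 < partial_deriv f i j x"
  shows "related_on (\<lless>) (S_axis i)"
proof -
  obtain j where ij: "i \<noteq> j" using ex_neq_2 by blast
  have main: "x \<lless> y" if x: "x \<in> S_axis i" and y: "y \<in> S_axis i" and xy: "x \<le> y" "x \<noteq> y" for x y
  proof -
    have xA: "x \<in> A" and yA: "y \<in> A" using x y by (auto simp: S_axis_def)
    have le: "x $ i \<le> y $ i" "x $ j \<le> y $ j" using xy(1) by (simp_all add: le_iff_2[OF ij])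
    have j: "x $ j \<noteq> y $ j"
      using S_axis_leK[OF x y] xy(2) le by (auto simp: leK_iff[OF ij] vec_eq_iff_2[OF ij])
    have "x $ i \<noteq> y $ i"
    proof
      assume i: "x $ i = y $ i"
      have gx: "g x \<in> S_axis i" "g x \<in> {0..r}" "T (g x) = x"
        using funpow_g_S_axis[OF x, of 1] funpow_g_box[OF xA, of 1] T_funpow_g_Suc[OF xA, of 0] by auto
      have gy: "g y \<in> S_axis i" "g y \<in> {0..r}" "T (g y) = y"
        using funpow_g_S_axis[OF y, of 1] funpow_g_box[OF yA, of 1] T_funpow_g_Suc[OF yA, of 0] by auto
      have "leK i y x" using i le by (simp add: leK_iff[OF ij])
      then have K: "leK i (g y) (g x)" using backward_leK[OF yA xA, of i 1] by simp
      then have gi: "g y $ i = g x $ i" by (rule S_axis_leK[OF gy(1) gx(1)])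
      have gj: "g x $ j \<le> g y $ j" using K by (simp add: leK_iff[OF ij])
      have "g x $ j \<noteq> g y $ j"
      proof
        assume "g x $ j = g y $ j"
        with gi have "g x = g y" by (simp add: vec_eq_iff_2[OF ij])
        with gx gy xy(2) show False by simp
      qed
      with gj have lt: "g x $ j < g y $ j" by simp
      have "0 < g x $ i" using S_axis_ge_Q[OF gx(1)] Q_pos[of i] by (simp add: le_vec_iff less_le_trans)
      then have "T (upd (g x) j (g x $ j)) $ i < T (upd (g x) j (g y $ j)) $ i"
        using gx(2) gy(2) lt by (intro T_upd_strict_off pd ij) (auto simp: le_vec_iff ij)
      moreover have "upd (g x) j (g y $ j) = g y" using gi ij by (simp add: vec_eq_iff_2[OF ij])
      ultimately have "x $ i < y $ i" by (simp add: gx gy)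
      with i show False by simp
    qed
    with le j have "x $ i < y $ i \<and> x $ j < y $ j" by simp
    then show ?thesis unfolding sless_iff by (rule all_2_iff[OF ij, THEN iffD2])
  qed
  show ?thesis
    unfolding related_on_def
  proof (intro ballI impI)
    fix x y assume xy: "x \<in> S_axis i" "y \<in> S_axis i" "x \<noteq> y"
    from S_axis_chain[OF xy(1,2)] show "x \<lless> y \<or> y \<lless> x"
    proof
      assume "x \<le> y"
      from main[OF xy(1,2) this xy(3)] show ?thesis ..
    next
      assume "y \<le> x"
      from main[OF xy(2,1) this xy(3)[symmetric]] show ?thesis ..
    qed
  qed
qed

text \<open>A compact set enters \<open>away \<delta>\<close> within a uniform time, and the core of
  that compact invariant set attracts it uniformly.\<close>

lemma Sigma_global_attractor: "global_attractor T (quadrant - {0}) (Sigma_set T r)"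
proof -
  obtain \<delta> c where nz: "near_zero \<delta> c" using near_zero_exists by blast
  note inv = away_invariant[OF nz] and Sig = Sigma_core[OF nz]
  have "T x \<in> quadrant - {0}" if "x \<in> quadrant - {0}" for x
    using that T_quadrant[of x] T_eq_0D[of x] by auto
  then have "T ` (quadrant - {0}) \<subseteq> quadrant - {0}" by (rule image_subsetI)
  moreover have "Sigma_set T r \<noteq> {}"
    using fixed_in_Sigma[OF Q_box Q_props(2) Q_neq_0] by blast
  moreover have "compact (Sigma_set T r)" unfolding Sig by (rule core_compact[OF inv away_compact])
  moreover have "Sigma_set T r \<subseteq> quadrant - {0}"
    using core_subset[of "away \<delta>"] nz box_quadrant
    unfolding Sig by (force simp: away_def near_zero_def)
  moreover have "T ` Sigma_set T r = Sigma_set T r" unfolding Sig by (rule T_core[OF inv])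
  moreover have "\<forall>\<^sub>F n in sequentially. \<forall>x\<in>S. infdist ((T ^^ n) x) (Sigma_set T r) < \<epsilon>"
    if S: "compact S" "S \<subseteq> quadrant - {0}" and \<epsilon>: "0 < \<epsilon>" for S and \<epsilon> :: real
  proof -
    obtain N where N: "\<And>n x. N \<le> n \<Longrightarrow> x \<in> S \<Longrightarrow> (T ^^ n) x \<in> away \<delta>"
      using compact_enters_away[OF nz S] by blast
    obtain M where M: "\<And>n x. M \<le> n \<Longrightarrow> x \<in> away \<delta> \<Longrightarrow> infdist ((T ^^ n) x) (Sigma_set T r) < \<epsilon>"
      using core_attracts[OF inv away_compact \<epsilon>] unfolding Sig by blast
    have "infdist ((T ^^ n) x) (Sigma_set T r) < \<epsilon>" if "M + N \<le> n" "x \<in> S" for n x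
    proof -
      have "(T ^^ n) x = (T ^^ (n - N)) ((T ^^ N) x)"
        using that(1) by (metis add_leD2 funpow_add le_add_diff_inverse2 o_apply)
      then show ?thesis using M[OF _ N[OF order_refl that(2)], of "n - N"] that(1) by simp
    qed
    then show ?thesis unfolding eventually_sequentially by blast
  qed
  ultimately show ?thesis unfolding global_attractor_def by blast
qed

end

theorem theorem3p1:
  fixes f T :: "real^2 \<Rightarrow> real^2" and r :: "real^2"
  assumes T_eq: "\<And>x. x \<in> quadrant \<Longrightarrow> T x = (\<chi> i. x $ i * f x $ i)"
    and f_maps: "f ` quadrant \<subseteq> quadrant"
    and f_C1: "C1_on_quadrant f"
    and f_pos: "\<And>x i. x \<in> quadrant \<Longrightarrow> 0 < f x $ i"
    and dissip: "dissipative T"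
    and f_zero: "\<And>i. 1 < f 0 $ i"
    and r_pos: "0 \<lless> r"
    and omega: "\<And>x. x \<in> quadrant \<Longrightarrow> omega_limit T x \<subseteq> {0..r}"
    and T_box: "T ` {0..r} \<subseteq> halfopen_box r"
    and spec: "\<And>x. x \<in> {0..r} \<Longrightarrow> spectral_radius (complex_matrix (M_matrix f x)) < 1"
    and typeK: "\<And>x. x \<in> {0..r} \<Longrightarrow>
        partial_deriv f 1 1 x < 0 \<and> partial_deriv f 2 2 x < 0 \<and>
        0 \<le> partial_deriv f 1 2 x \<and> 0 \<le> partial_deriv f 2 1 x"
  shows "\<exists>Q :: 2 \<Rightarrow> real^2.
    (\<forall>i. {q \<in> pos_axis i. T q = q} = {Q i} \<and>
         saddle_point T (Q i) \<and>
         unstable_manifold T r (Q i) \<subseteq> open_quadrant \<and>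
         stable_manifold T (Q i) = pos_axis i) \<and>
    (\<exists>p0 p1.
       p0 \<in> open_quadrant \<and> T p0 = p0 \<and>
       ({p \<in> open_quadrant. T p = p} = {p0} \<longrightarrow>
          globally_asymptotically_stable_in T open_quadrant p0) \<and>
       ({p \<in> open_quadrant. T p = p} \<noteq> {p0} \<longrightarrow>
          p0 \<lless> p1 \<and> T p1 = p1 \<and>
          (\<forall>x\<in>open_quadrant.
             (eventually_monotone (\<lless>\<^sub>K) (\<lambda>n. (T ^^ n) x) \<or>
              eventually_monotone (<) (\<lambda>n. (T ^^ n) x)) \<and>
             (\<exists>p\<in>{p0..p1}. T p = p \<and> (\<lambda>n. (T ^^ n) x) \<longlonglongrightarrow> p))) \<and>
       (Sigma_0 T r = {p0} \<or>
          {p \<in> open_quadrant. T p = p} \<noteq> {p0} \<and>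
          monotone_curve_from_to (\<lless>) (Sigma_0 T r) p0 p1)) \<and>
    global_attractor T (quadrant - {0}) (Sigma_set T r) \<and>
    Sigma_set T r = Sigma_H T r \<union> Sigma_0 T r \<union> Sigma_V T r \<and>
    Sigma_H T r = unstable_manifold T r (Q 1) \<union> {Q 1} \<and>
    Sigma_V T r = unstable_manifold T r (Q 2) \<union> {Q 2} \<and>
    monotone_curve (<) (Sigma_H T r) \<and> monotone_curve (<) (Sigma_V T r) \<and>
    ((\<forall>x\<in>{0..r}. 0 < partial_deriv f 1 2 x \<and> 0 < partial_deriv f 2 1 x) \<longrightarrow>
       monotone_curve (\<lless>) (Sigma_H T r) \<and> monotone_curve (\<lless>) (Sigma_V T r))"
proof -
  interpret typeK_system f T r
    using T_eq f_C1 f_pos dissip f_zero r_pos omega T_box spec typeK by unfold_locales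
  show ?thesis
  proof (intro exI[of _ Q] conjI allI impI)
  fix i
  show "{q \<in> pos_axis i. T q = q} = {Q i}" using Q_props[of i] Q_unique[of _ i] by blast
  show "saddle_point T (Q i)" by (rule Q_saddle)
  show "unstable_manifold T r (Q i) \<subseteq> open_quadrant" by (rule unstable_manifold_open)
  show "stable_manifold T (Q i) = pos_axis i" by (rule stable_manifold_Q)
next
  have open_lim: "\<exists>p\<in>{p0..p1}. T p = p \<and> (\<lambda>n. (T ^^ n) x) \<longlonglongrightarrow> p" if x: "x \<in> open_quadrant" for x
  proof -
    obtain p where "p \<in> interior_fixed" "(\<lambda>n. (T ^^ n) x) \<longlonglongrightarrow> p"
      using forward_limit_open[OF x] by (auto simp: interior_fixed_def)
    then show ?thesis using p0_least p1_greatest interior_fixed_T by (intro bexI[of _ p]) auto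
  qed
  have mono: "eventually_monotone (\<lless>\<^sub>K) (\<lambda>n. (T ^^ n) x) \<or> eventually_monotone (<) (\<lambda>n. (T ^^ n) x)"
    if "x \<in> open_quadrant" for x
    using that by (intro forward_monotone) (simp add: open_quadrant_def quadrant_def less_imp_le)
  show "\<exists>p0 p1.
       p0 \<in> open_quadrant \<and> T p0 = p0 \<and>
       ({p \<in> open_quadrant. T p = p} = {p0} \<longrightarrow>
          globally_asymptotically_stable_in T open_quadrant p0) \<and>
       ({p \<in> open_quadrant. T p = p} \<noteq> {p0} \<longrightarrow>
          p0 \<lless> p1 \<and> T p1 = p1 \<and>
          (\<forall>x\<in>open_quadrant.
             (eventually_monotone (\<lless>\<^sub>K) (\<lambda>n. (T ^^ n) x) \<or>
              eventually_monotone (<) (\<lambda>n. (T ^^ n) x)) \<and>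
             (\<exists>p\<in>{p0..p1}. T p = p \<and> (\<lambda>n. (T ^^ n) x) \<longlonglongrightarrow> p))) \<and>
       (Sigma_0 T r = {p0} \<or>
          {p \<in> open_quadrant. T p = p} \<noteq> {p0} \<and>
          monotone_curve_from_to (\<lless>) (Sigma_0 T r) p0 p1)"
    unfolding interior_fixed_def[symmetric]
  \<comment> \<open>If \<open>p0\<close> is the only interior fixed point, then the witness
    \<open>p1\<close> equals it and the implication about \<open>p1\<close> is vacuous.\<close>
  proof (rule exI[of _ p0], rule exI[of _ p1], intro conjI impI ballI)
    show "p0 \<in> open_quadrant" using p0_props(1) by (simp add: interior_fixed_def)
    show "Sigma_0 T r = {p0} \<or>
        interior_fixed \<noteq> {p0} \<and> monotone_curve_from_to (\<lless>) (Sigma_0 T r) p0 p1"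
      using Sigma_0_singleton Sigma_0_curve by blast
  qed (rule p0_T p1_T p0_stable p0_p1 open_lim mono; assumption?)+
next
  show "global_attractor T (quadrant - {0}) (Sigma_set T r)" by (rule Sigma_global_attractor)
  show "Sigma_set T r = Sigma_H T r \<union> Sigma_0 T r \<union> Sigma_V T r"
    by (auto simp: Sigma_0_def Sigma_H_def Sigma_V_def)
  show "Sigma_H T r = unstable_manifold T r (Q 1) \<union> {Q 1}" by (rule Sigma_H_eq)
  show "Sigma_V T r = unstable_manifold T r (Q 2) \<union> {Q 2}" by (rule Sigma_V_eq)
  show "monotone_curve (<) (Sigma_H T r)" "monotone_curve (<) (Sigma_V T r)"
    unfolding Sigma_H_eq Sigma_V_eq S_axis_eq by (rule S_axis_curve[OF S_axis_related])+
next
  assume *: "\<forall>x\<in>{0..r}. 0 < partial_deriv f 1 2 x \<and> 0 < partial_deriv f 2 1 x"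
  have "0 < partial_deriv f i j x" if "x \<in> {0..r}" "i \<noteq> j" for i j x
    using * that exhaust_2[of i] exhaust_2[of j] by auto
  note S_axis_curve[OF S_axis_strongly_related[OF this]]
  then show "monotone_curve (\<lless>) (Sigma_H T r)" "monotone_curve (\<lless>) (Sigma_V T r)"
    unfolding Sigma_H_eq Sigma_V_eq S_axis_eq by blast+
qed
qed

end
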